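(* Let $\mathbb R[\mathbb j]=\{x_1+x_2\mathbb j:x_1,x_2\in\mathbb R,\ \mathbb j^2=1\}$, with $\overline{x_1+x_2\mathbb j}=x_1-x_2\mathbb j$ and $Q(x_1+x_2\mathbb j)=x_1^2-x_2^2$. Fix $\alpha=\alpha_1+\alpha_2\mathbb j\in\mathbb R[\mathbb j]$ with $|\alpha_1|+|\alpha_2|<1$. Consider the continued fraction (CF) algorithm on $\mathbb R^{1,1}\cong\mathbb R[\mathbb j]$ given by the inversion $\iota(x)=\overline x/Q(x)$, the lattice $\mathcal Z=\mathbb Z\frac{1+\mathbb j}{2}\oplus\mathbb Z\frac{1-\mathbb j}{2}$, and the fundamental domain given by the $\alpha$-shifted little diamond $$K=-\alpha+\{x_1+x_2\mathbb j:|x_1-\tfrac12|+|x_2|\le\tfrac12\}$$ (the diamond being taken half-open: $0\le x_1+x_2<1$, $0\le x_1-x_2<1$), and assume $0\in K$. Then the resulting CF algorithm is convergent and exact, with a finite invariant measure equivalent to Lebesgue measure.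
   Context: Let $\mathcal N=\{x:Q(x)=0\}$; for $x\notin\mathcal N$, $\iota(x)=1/x$. For $x\in\mathbb R[\mathbb j]$, $[x]_K\in\mathcal Z$ is the unique lattice point with $x-[x]_K\in K$. The generalized Gauss map $T:K\to K$ is $T(x)=\iota(x)-[\iota(x)]_K$ for $x\in K\setminus\mathcal N$. The digits of $x\in K$ are $a_i=[\iota(T^{i-1}x)]_K$, defined as long as $T^{i-1}x\notin\mathcal N$. The algorithm is convergent if for every $x\in K$ with an infinite digit sequence $(a_i)$ one has $\lim_{n\to\infty}\iota(a_1+\iota(a_2+\cdots+\iota(a_n)))=x$ in the Euclidean topology. (Under the algebra isomorphism $x_1+x_2\mathbb j\mapsto(x_1+x_2,x_1-x_2)$ onto $\mathbb R^2$ with coordinate-wise operations, the finite fractions are evaluated coordinate-wise, in $\mathbb R\cup\{\infty\}$ if necessary.) The algorithm is exact if $T$ is exact with respect to some invariant probability measure $\mu$ on $K$ equivalent to Lebesgue measure $\mu_L$, in the sense that $C^{-1}\mu\le\mu_L\le C\mu$ for some $C\ge1$. A map $T$ preserving a probability measure $\mu$ is exact if $\mu(A)>0$ implies $\lim_{n\to\infty}\mu(T^nA)=1$; equivalently, every set in $\bigcap_{n>0}T^{-n}\mathcal M$ is null or co-null, where $\mathcal M$ is the $\sigma$-algebra of measurable sets. *)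

theory Defs
  imports "HOL-Probability.Probability"
begin

text \<open>
  The split-complex number \<open>x\<^sub>1 + x\<^sub>2 j\<close> is the pair \<open>(x\<^sub>1, x\<^sub>2)\<close>; addition, scaling, topology and
  Lebesgue measure are those of \<^typ>\<open>real \<times> real\<close>.
\<close>

type_synonym split = "real \<times> real"

definition split_mult :: "split \<Rightarrow> split \<Rightarrow> split" where
  "split_mult x y = (fst x * fst y + snd x * snd y, fst x * snd y + snd x * fst y)"

definition split_cnj :: "split \<Rightarrow> split" where
  "split_cnj x = (fst x, - snd x)"

definition split_Q :: "split \<Rightarrow> real" where
  "split_Q x = (fst x)\<^sup>2 - (snd x)\<^sup>2"

definition null_cone :: "split set" where
  "null_cone = {x. split_Q x = 0}"

definition split_inv :: "split \<Rightarrow> split" where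
  "split_inv x = split_cnj x /\<^sub>R split_Q x"

lemma split_mult_cnj: "split_mult x (split_cnj x) = (split_Q x, 0)"
  by (simp add: split_mult_def split_cnj_def split_Q_def power2_eq_square)

lemma split_mult_inv:
  assumes "x \<notin> null_cone"
  shows "split_mult x (split_inv x) = (1, 0)"
proof -
  have "split_mult x (split_inv x) = split_mult x (split_cnj x) /\<^sub>R split_Q x"
    by (simp add: split_mult_def split_inv_def algebra_simps)
  then show ?thesis
    using assms by (simp add: split_mult_cnj null_cone_def)
qed

text \<open>The algebra isomorphism onto the plane with coordinate-wise operations.\<close>

definition split_coords :: "split \<Rightarrow> real \<times> real" where
  "split_coords x = (fst x + snd x, fst x - snd x)"

lemma split_coords_mult:
  "split_coords (split_mult x y) =
     (fst (split_coords x) * fst (split_coords y), snd (split_coords x) * snd (split_coords y))"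
  by (simp add: split_coords_def split_mult_def algebra_simps)

definition split_lattice :: "split set" where
  "split_lattice =
     {of_int m *\<^sub>R (1/2, 1/2) + of_int n *\<^sub>R (1/2, - 1/2) | m n :: int. True}"

definition little_diamond :: "split set" where
  "little_diamond =
     {x. 0 \<le> fst x + snd x \<and> fst x + snd x < 1 \<and> 0 \<le> fst x - snd x \<and> fst x - snd x < 1}"

lemma little_diamond_eq:
  "little_diamond =
     {x. \<bar>fst x - 1/2\<bar> + \<bar>snd x\<bar> \<le> 1/2} - {x. fst x + snd x = 1 \<or> fst x - snd x = 1}"
  by (auto simp: little_diamond_def abs_if)

definition shifted_diamond :: "split \<Rightarrow> split set" where
  "shifted_diamond \<alpha> = (\<lambda>x. - \<alpha> + x) ` little_diamond"

definition lattice_part :: "split set \<Rightarrow> split \<Rightarrow> split" where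
  "lattice_part K x = (THE z. z \<in> split_lattice \<and> x - z \<in> K)"

lemma ex1_lattice_part: "\<exists>!z. z \<in> split_lattice \<and> x - z \<in> shifted_diamond \<alpha>"
proof -
  have K: "y \<in> shifted_diamond \<alpha> \<longleftrightarrow> y + \<alpha> \<in> little_diamond" for y
    unfolding shifted_diamond_def by (auto simp: image_iff algebra_simps intro!: bexI[of _ "y + \<alpha>"])
  define u where "u = fst x + fst \<alpha> + (snd x + snd \<alpha>)"
  define v where "v = fst x + fst \<alpha> - (snd x + snd \<alpha>)"
  define P where "P m n = (of_int m *\<^sub>R (1/2, 1/2) + of_int n *\<^sub>R (1/2, - 1/2) :: split)"
    for m n :: int
  have *: "x - P m n \<in> shifted_diamond \<alpha> \<longleftrightarrow> m = \<lfloor>u\<rfloor> \<and> n = \<lfloor>v\<rfloor>" for m n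
  proof -
    have "x - P m n \<in> shifted_diamond \<alpha> \<longleftrightarrow>
        of_int m \<le> u \<and> u < of_int m + 1 \<and> of_int n \<le> v \<and> v < of_int n + 1"
      unfolding K little_diamond_def P_def u_def v_def by (auto simp: field_simps)
    also have "\<dots> \<longleftrightarrow> m = \<lfloor>u\<rfloor> \<and> n = \<lfloor>v\<rfloor>"
      by (metis floor_eq_iff)
    finally show ?thesis .
  qed
  have L: "z \<in> split_lattice \<longleftrightarrow> (\<exists>m n. z = P m n)" for z
    unfolding split_lattice_def P_def by blast
  show ?thesis
    by (rule ex1I[of _ "P \<lfloor>u\<rfloor> \<lfloor>v\<rfloor>"]) (auto simp: L *)
qed

text \<open>
  The Gauss map is only meaningful off the null cone. There it is totalised by the value \<open>0\<close>, which
  lies in \<open>K\<close> in the situation of interest and is itself null, so an orbit that meets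
  the null cone stays in it. The set where the convention matters has Lebesgue measure zero.
\<close>

definition gauss_map :: "split set \<Rightarrow> split \<Rightarrow> split" where
  "gauss_map K x =
     (if x \<in> null_cone then 0 else split_inv x - lattice_part K (split_inv x))"

text \<open>Indices start at zero: \<open>cf_digit K x i\<close> is the digit \<open>a\<^sub>i\<^sub>+\<^sub>1\<close>.\<close>

definition cf_digit :: "split set \<Rightarrow> split \<Rightarrow> nat \<Rightarrow> split" where
  "cf_digit K x i = lattice_part K (split_inv ((gauss_map K ^^ i) x))"

definition infinite_digits :: "split set \<Rightarrow> split \<Rightarrow> bool" where
  "infinite_digits K x \<longleftrightarrow> (\<forall>i. (gauss_map K ^^ i) x \<notin> null_cone)"

text \<open>
  Finite fractions are evaluated in the coordinates of \<^const>\<open>split_coords\<close>, with values in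
  \<open>\<real> \<union> {\<infinity>}\<close>. In \<^typ>\<open>ereal\<close> we have \<open>inverse 0 = \<infinity>\<close>, \<open>inverse \<infinity> = 0\<close> and
  \<open>a + \<infinity> = \<infinity>\<close> for real \<open>a\<close>, so \<open>-\<infinity>\<close> never occurs. Convergence to a finite point in
  \<^typ>\<open>ereal \<times> ereal\<close> means that the values are eventually finite and
  converge in the Euclidean topology.
\<close>

definition ext_coords :: "split \<Rightarrow> ereal \<times> ereal" where
  "ext_coords x = map_prod ereal ereal (split_coords x)"

fun cf_value :: "split list \<Rightarrow> ereal \<times> ereal" where
  "cf_value [] = (0, 0)"
| "cf_value (a # as) = map_prod inverse inverse (ext_coords a + cf_value as)"

definition cf_convergent :: "split set \<Rightarrow> bool" where
  "cf_convergent K \<longleftrightarrow>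
     (\<forall>x\<in>K. infinite_digits K x \<longrightarrow>
        (\<lambda>n. cf_value (map (cf_digit K x) [0..<n])) \<longlonglongrightarrow> ext_coords x)"

definition invariant_measure :: "'a measure \<Rightarrow> ('a \<Rightarrow> 'a) \<Rightarrow> bool" where
  "invariant_measure M T \<longleftrightarrow> T \<in> measurable M M \<and> distr M M T = M"

text \<open>
  Non-measurable sets have \<^const>\<open>measure\<close> zero, so the limit condition includes the measurability
  of \<open>T\<^sup>n A\<close> for all large \<open>n\<close>.
\<close>

definition exact_map :: "'a measure \<Rightarrow> ('a \<Rightarrow> 'a) \<Rightarrow> bool" where
  "exact_map M T \<longleftrightarrow>
     prob_space M \<and> invariant_measure M T \<and>
     (\<forall>A\<in>sets M. measure M A > 0 \<longrightarrow> (\<lambda>n. measure M ((T ^^ n) ` A)) \<longlonglongrightarrow> 1)"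

definition comparable_measures :: "'a measure \<Rightarrow> 'a measure \<Rightarrow> bool" where
  "comparable_measures M N \<longleftrightarrow>
     sets M = sets N \<and>
     (\<exists>C\<ge>1::real. \<forall>A\<in>sets M.
        ennreal (inverse C) * emeasure M A \<le> emeasure N A \<and>
        emeasure N A \<le> ennreal C * emeasure M A)"

definition cf_exact :: "split set \<Rightarrow> bool" where
  "cf_exact K \<longleftrightarrow>
     (\<exists>\<mu>. comparable_measures \<mu> (lebesgue_on K) \<and> exact_map \<mu> (gauss_map K))"

end

theory Submission imports Defs begin

text \<open>
  In the coordinates of \<^const>\<open>split_coords\<close> the Gauss map is the product of two interval maps
  \<open>T x = 1 / x - \<lfloor>1 / x + a\<rfloor>\<close> on \<open>J = [- a, 1 - a)\<close> with \<open>0 \<le> a < 1\<close>. Everything rests on the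
  inequality \<open>\<bar>x\<bar> (1 + \<bar>T x\<bar>) \<le> 1\<close>.

  It gives \<open>\<bar>x\<bar> \<bar>T x\<bar> \<le> 1/2\<close>, hence convergence. It also shows that the inverse branches contract
  by less than \<open>1/2\<close> with respect to \<open>dx / (1 + \<bar>x\<bar>)\<close>, while the image of an interval consists of
  full copies of \<open>J\<close> and at most two further pieces. As in a Lasota-Yorke inequality, this bounds
  the transfer operator: \<open>\<bar>T\<^sup>-\<^sup>n E\<bar> \<le> B \<bar>E\<bar>\<close> for all \<open>n\<close>, and \<open>\<bar>I \<inter> T\<^sup>-\<^sup>n E\<bar> \<ge> c \<bar>I\<bar> \<bar>E\<bar>\<close> for
  every interval \<open>I\<close> and all \<open>n \<ge> n\<^sub>0(I)\<close>, with \<open>c\<close> independent of \<open>I\<close>. Both bounds pass to products.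

  The two bounds yield an invariant measure comparable to Lebesgue measure. For exactness, let \<open>A\<close>
  have positive measure and choose a rectangle \<open>R\<close> with \<open>\<bar>R - A\<bar> \<le> \<epsilon> \<bar>R\<bar>\<close>. If \<open>E\<close> is the complement
  of \<open>T\<^sup>n A\<close>, then \<open>T\<^sup>-\<^sup>n E\<close> misses \<open>A\<close>, so \<open>c \<bar>R\<bar> \<bar>E\<bar> \<le> \<bar>R \<inter> T\<^sup>-\<^sup>n E\<bar> \<le> \<epsilon> \<bar>R\<bar>\<close>.
\<close>

section \<open>The interval maps\<close>

text \<open>The obstacle is weak expansion. The slope of \<open>T\<close> at \<open>x\<close> has
  modulus \<open>1 / x^2\<close>, which exceeds \<open>1\<close> but comes arbitrarily close to it
  when \<open>a = 0\<close>, and for other \<open>a\<close> may lie below the value \<open>2\<close>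
  that would outweigh two incomplete pieces. Weighting length by \<open>1 / (1 + |x|)\<close>
  repairs this, and strictness at the borderline \<open>1/2\<close> needs a separate look at the
  digit \<open>1\<close> when \<open>a = 0\<close>. No function space is involved: the densities
  that arise from Lebesgue measure on an interval form an explicit two-parameter family closed under
  the branches, so the transfer operator is followed through an interval and two real numbers. Both
  bounds are tested against every measurable \<open>E\<close>, which lets Fubini carry them to the
  product of two maps with different parameters. In the density argument \<open>R\<close> depends on
  \<open>\<epsilon>\<close>, and only a constant \<open>c\<close> independent of \<open>R\<close>
  survives the division by \<open>|R|\<close>. The Gauss map is the product map only off a null set:
  a point with one zero coordinate is sent to \<open>0\<close> as a whole. Since exactness speaks of
  forward images, their Lebesgue measurability has to be proved as well.\<close>

definition cf_interval :: "real \<Rightarrow> real set" where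
  "cf_interval a = {- a..<1 - a}"

definition cf_map :: "real \<Rightarrow> real \<Rightarrow> real" where
  "cf_map a x = 1 / x - of_int \<lfloor>1 / x + a\<rfloor>"

locale shifted_cf =
  fixes a :: real
  assumes shift_nonneg: "0 \<le> a" and shift_less_1: "a < 1"
begin

abbreviation "J \<equiv> cf_interval a"
abbreviation "T \<equiv> cf_map a"
abbreviation digit :: "real \<Rightarrow> int" where "digit x \<equiv> \<lfloor>1 / x + a\<rfloor>"

lemma mem_J: "x \<in> J \<longleftrightarrow> - a \<le> x \<and> x < 1 - a"
  by (auto simp: cf_interval_def)

lemma zero_in_J: "0 \<in> J"
  using shift_nonneg shift_less_1 by (simp add: mem_J)

lemma abs_less_1: "x \<in> J \<Longrightarrow> \<bar>x\<bar> < 1"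
  using shift_nonneg shift_less_1 by (auto simp: mem_J)

lemma cf_map_in_J: "T x \<in> J"
  unfolding mem_J cf_map_def by linarith

lemma inverse_eq: "1 / x = of_int (digit x) + T x"
  by (simp add: cf_map_def)

lemma eq_inverse: "x \<noteq> 0 \<Longrightarrow> x = 1 / (of_int (digit x) + T x)"
  using inverse_eq[of x] by (metis inverse_inverse_eq inverse_eq_divide)

lemma inverse_gt_1: "x \<in> J \<Longrightarrow> 0 < x \<Longrightarrow> 1 < 1 / x"
  using abs_less_1[of x] by simp

lemma digit_pos: "x \<in> J \<Longrightarrow> 0 < x \<Longrightarrow> digit x \<ge> 1"
  using inverse_gt_1[of x] shift_nonneg by linarith

lemma inverse_less: "x \<in> J \<Longrightarrow> x < 0 \<Longrightarrow> 1 / x < - 1 \<and> 1 / x \<le> - 1 / a \<and> 0 < a"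
proof -
  assume x: "x \<in> J" "x < 0"
  then have "- x \<le> a" "- x < 1" "0 < a"
    using abs_less_1[of x] by (auto simp: mem_J)
  have "1 / (- x) > 1"
    using x \<open>- x < 1\<close> by (subst less_divide_eq) auto
  moreover have "1 / (- x) \<ge> 1 / a"
    using x \<open>- x \<le> a\<close> by (intro frac_le) auto
  ultimately show ?thesis using \<open>0 < a\<close> by simp
qed

lemma digit_neg: "x \<in> J \<Longrightarrow> x < 0 \<Longrightarrow> digit x \<le> - 1"
proof -
  assume x: "x \<in> J" "x < 0"
  have "1 < 1 / a"
    using inverse_less[OF x] shift_less_1 by simp
  then have "1 / x + a < 0"
    using inverse_less[OF x] shift_less_1 by simp
  then show ?thesis by linarith
qed

lemma digit_nonzero: "x \<in> J \<Longrightarrow> x \<noteq> 0 \<Longrightarrow> digit x \<noteq> 0"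
  using digit_pos[of x] digit_neg[of x] by linarith

text \<open>As \<open>|1 / x| > 1\<close>, what remains after subtracting a digit \<open>1\<close>
  or \<open>-1\<close> cannot have the opposite sign. This keeps the denominators of finite
  fractions away from \<open>0\<close>.\<close>

lemma digit_pm_1_sign:
  assumes x: "x \<in> J" "x \<noteq> 0"
  shows "digit x = 1 \<Longrightarrow> 0 \<le> T x" and "digit x = - 1 \<Longrightarrow> T x \<le> 0"
proof -
  show "0 \<le> T x" if d: "digit x = 1"
  proof -
    have "0 < x"
      using digit_neg[of x] x d by linarith
    then show ?thesis
      using inverse_gt_1[of x] x d by (simp add: cf_map_def)
  qed
  show "T x \<le> 0" if d: "digit x = - 1"
  proof -
    have "x < 0"
      using digit_pos[of x] x d by linarith
    then show ?thesis
      using inverse_less[of x] x d by (simp add: cf_map_def)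
  qed
qed

text \<open>For \<open>x \<noteq> 0\<close> the claim is \<open>1 + |t| \<le> |d + t|\<close> with
  \<open>d\<close> the digit and \<open>t = T x\<close>. It is clear when \<open>d\<close> and
  \<open>t\<close> have the same sign. Otherwise \<open>|d| \<ge> 1 + 2 |t|\<close> is required. If
  \<open>|t| \<le> 1/2\<close>, then \<open>|d| \<ge> 2\<close> is enough; if \<open>J\<close> is
  long enough on the side of \<open>t\<close> to allow more, it is so short on the side of
  \<open>x\<close> that \<open>|1 / x| > 2\<close> and \<open>|d| \<ge> 3\<close>.\<close>

lemma abs_mult_image_le_1:
  assumes x: "x \<in> J"
  shows "\<bar>x\<bar> * (1 + \<bar>T x\<bar>) \<le> 1"
proof (cases "x = 0")
  case False
  define t where "t = T x"
  define d where "d = digit x"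
  have e: "1 / x = of_int d + t"
    using inverse_eq[of x] by (simp add: t_def d_def)
  have tJ: "- a \<le> t" "t < 1 - a"
    using cf_map_in_J[of x] by (auto simp: mem_J t_def)
  have "1 + \<bar>t\<bar> \<le> 1 / \<bar>x\<bar>"
  proof (cases "0 < x")
    case True
    have d: "d \<ge> 1" using digit_pos x True by (simp add: d_def)
    have gt: "1 < of_int d + t" using inverse_gt_1[OF x True] e by simp
    show ?thesis
    proof (cases "t \<ge> 0")
      case True
      then show ?thesis using e d \<open>0 < x\<close> by simp
    next
      case False
      have "of_int d \<ge> 1 - 2 * t"
      proof (cases "a \<le> 1 / 2")
        case True
        have "d \<ge> 2" using gt False by linarith
        then show ?thesis using True tJ by linarith
      next
        case F: False
        then have "x < 1 / 2" using x by (simp add: mem_J)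
        then have "2 < 1 / x" using \<open>0 < x\<close> by (simp add: field_simps)
        then have "d \<ge> 3" using e False by linarith
        then show ?thesis using tJ shift_less_1 by linarith
      qed
      then show ?thesis using e False \<open>0 < x\<close> by simp
    qed
  next
    case F: False
    then have neg: "x < 0" using False by simp
    have d: "d \<le> - 1" using digit_neg x neg by (simp add: d_def)
    note lt = inverse_less[OF x neg]
    have ax: "1 / \<bar>x\<bar> = - of_int d - t" using e neg by simp
    show ?thesis
    proof (cases "t \<le> 0")
      case True
      then show ?thesis using ax d by simp
    next
      case False
      have "- of_int d \<ge> 1 + 2 * t"
      proof (cases "a \<ge> 1 / 2")
        case True
        have "d \<le> - 2" using lt e False by linarith
        then show ?thesis using True tJ by linarith
      next
        case G: False
        then have "2 < 1 / a" using lt by (simp add: field_simps)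
        then have "d \<le> - 3" using lt e False by linarith
        then show ?thesis using tJ shift_nonneg by linarith
      qed
      then show ?thesis using ax False by simp
    qed
  qed
  then show ?thesis
    using False by (simp add: t_def field_simps)
qed simp

text \<open>
  In terms of the metric \<open>dx / (1 + \<bar>x\<bar>)\<close> the inverse branches contract by
  \<open>x\<^sup>2 (1 + \<bar>T x\<bar>) / (1 + \<bar>x\<bar>) \<le> \<bar>x\<bar> / (1 + \<bar>x\<bar>) \<le> 1/2\<close>. An interval has at most two pieces
  that are not mapped onto \<open>J\<close>, so that the total contraction of these pieces decides.
\<close>

lemma piece_weights:
  obtains W :: "int \<Rightarrow> real" and l :: real
  where "0 \<le> l" "l < 1" "\<And>d. 0 \<le> W d" "\<And>d. W d \<le> l" "\<And>d e. d \<noteq> e \<Longrightarrow> W d + W e \<le> l"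
    and "\<And>x. x \<in> J \<Longrightarrow> x \<noteq> 0 \<Longrightarrow> \<bar>x\<bar> / (1 + \<bar>x\<bar>) \<le> W (digit x)"
proof (cases "a = 0")
  case True
  \<comment> \<open>Near \<open>x = 1\<close> the ratio \<open>x / (1 + x)\<close> approaches
    \<open>1/2\<close>, so equal weights would only add up to \<open>1\<close>. Every digit other
    than \<open>1\<close> forces \<open>x \<le> 1/2\<close> and hence a ratio of at most
    \<open>1/3\<close>; two distinct digits then total at most \<open>5/6\<close>.\<close>
  define W :: "int \<Rightarrow> real" where "W d = (if d = 1 then 1 / 2 else 1 / 3)" for d
  show ?thesis
  proof (rule that[of "5 / 6" W])
    fix x assume x: "x \<in> J" "x \<noteq> 0"
    then have p: "0 < x" using True mem_J[of x] by linarith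
    have "x < 1" using x True mem_J[of x] by linarith
    show "\<bar>x\<bar> / (1 + \<bar>x\<bar>) \<le> W (digit x)"
    proof (cases "digit x = 1")
      case True
      then show ?thesis using p \<open>x < 1\<close> by (simp add: W_def field_simps)
    next
      case False
      then have "2 \<le> digit x" using digit_pos[OF x(1) p] by linarith
      then have "2 \<le> 1 / x" using \<open>a = 0\<close> by linarith
      then have "x \<le> 1 / 2" using p by (simp add: field_simps)
      then show ?thesis using p False by (simp add: W_def field_simps)
    qed
  qed (auto simp: W_def)
next
  case False
  then have a: "0 < a" "a < 1" using shift_nonneg shift_less_1 by auto
  \<comment> \<open>\<open>r\<close> is the supremum of \<open>|x|\<close> on \<open>J\<close>. It
    is below \<open>1\<close> because \<open>0 < a < 1\<close>, and \<open>t / (1 + t)\<close>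
    increases with \<open>t\<close>, so even two equal weights total less than
    \<open>1\<close>.\<close>
  define r where "r = max a (1 - a)"
  have r: "0 < r" "r < 1" using a by (auto simp: r_def)
  have m: "\<bar>x\<bar> / (1 + \<bar>x\<bar>) \<le> r / (1 + r)" if "x \<in> J" for x
  proof -
    have "\<bar>x\<bar> \<le> r" using that by (auto simp: mem_J r_def)
    then show ?thesis using r by (simp add: field_simps)
  qed
  show ?thesis
  proof (rule that[of "2 * (r / (1 + r))" "\<lambda>_. r / (1 + r)"])
    show "2 * (r / (1 + r)) < 1" using r by (simp add: field_simps)
    show "r / (1 + r) \<le> 2 * (r / (1 + r))" using r divide_nonneg_pos[of r "1 + r"] by linarith
  qed (use r m in auto)
qed

end

section \<open>Mass of intervals under the branches\<close>

lemma mem_is_interval_1: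
  fixes x y z :: real
  shows "is_interval I \<Longrightarrow> x \<in> I \<Longrightarrow> y \<in> I \<Longrightarrow> x \<le> z \<Longrightarrow> z \<le> y \<Longrightarrow> z \<in> I"
  unfolding is_interval_1 by blast

lemma nn_integral_lborel_uminus:
  fixes F :: "real \<Rightarrow> ennreal"
  assumes [measurable]: "F \<in> borel_measurable borel"
  shows "(\<integral>\<^sup>+x. F (- x) \<partial>lborel) = (\<integral>\<^sup>+x. F x \<partial>lborel)"
  using nn_integral_real_affine[OF assms, of "- 1" 0] by simp

context shifted_cf
begin

lemma digit_add_nonzero: "d \<noteq> 0 \<Longrightarrow> y \<in> J \<Longrightarrow> of_int d + y \<noteq> (0::real)"
  using abs_less_1[of y] by linarith

text \<open>For \<open>d \<noteq> 0\<close> and \<open>I \<subseteq> J\<close> this is the image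
  under \<open>T\<close> of the points of \<open>I\<close> with digit \<open>d\<close>. Describing
  it by the inverse branch makes membership a condition on \<open>y\<close> alone.\<close>

definition pull :: "int \<Rightarrow> real set \<Rightarrow> real set" where
  "pull d I = {y \<in> J. 1 / (of_int d + y) \<in> I}"

lemma digit_branch:
  assumes "d \<noteq> 0" "y \<in> J"
  shows "digit (1 / (of_int d + y)) = d" "T (1 / (of_int d + y)) = y"
proof -
  have "\<lfloor>of_int d + y + a\<rfloor> = d"
    using assms(2) unfolding mem_J by linarith
  then show "digit (1 / (of_int d + y)) = d" "T (1 / (of_int d + y)) = y"
    by (auto simp: cf_map_def)
qed

lemma pull_subset: "pull d I \<subseteq> J"
  by (auto simp: pull_def)

lemma borel_cf_map [measurable]: "T \<in> borel_measurable borel"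
  unfolding cf_map_def by measurable

lemma borel_J [measurable]: "J \<in> sets borel"
  by (simp add: cf_interval_def)

lemma borel_pull [measurable]: 
  assumes [measurable]: "I \<in> sets borel"
  shows "pull d I \<in> sets borel"
proof -
  have "pull d I = J \<inter> (\<lambda>y. 1 / (of_int d + y)) -` I"
    by (auto simp: pull_def)
  moreover have "(\<lambda>y. 1 / (of_int d + y)) -` I \<in> sets borel"
    by (rule measurable_sets_borel[OF _ assms]) measurable
  ultimately show ?thesis by simp
qed

lemma is_interval_J: "is_interval J"
  by (auto simp: is_interval_1 mem_J)

text \<open>Since \<open>|y| < 1 \<le> |d|\<close>, the number \<open>d + y\<close> keeps one sign
  on \<open>J\<close>, and \<open>1 / (d + y)\<close> is decreasing there.\<close>

lemma is_interval_pull: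
  assumes I: "is_interval I" and d: "d \<noteq> 0"
  shows "is_interval (pull d I)"
  unfolding is_interval_1
proof (intro ballI allI impI)
  fix x y z assume x: "x \<in> pull d I" and y: "y \<in> pull d I" and z: "x \<le> z \<and> z \<le> y"
  have zJ: "z \<in> J"
    using x y z by (auto simp: pull_def mem_J)
  have J: "x \<in> J" "y \<in> J"
    using x y by (auto simp: pull_def)
  have s: "(0 < of_int d + x \<and> 0 < of_int d + y) \<or> (of_int d + x < 0 \<and> of_int d + y < 0)"
    using abs_less_1[OF J(1)] abs_less_1[OF J(2)] d by linarith
  have "1 / (of_int d + y) \<le> 1 / (of_int d + z)" "1 / (of_int d + z) \<le> 1 / (of_int d + x)"
    using s z by (auto simp: field_simps)
  then have "1 / (of_int d + z) \<in> I"
    using mem_is_interval_1[OF I] x y by (auto simp: pull_def)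
  then show "z \<in> pull d I"
    using zJ by (simp add: pull_def)
qed

definition cyl :: "int \<Rightarrow> real set" where
  "cyl d = {x \<in> J. x \<noteq> 0 \<and> digit x = d}"

lemma borel_cyl [measurable]: "cyl d \<in> sets borel"
  unfolding cyl_def by measurable

text \<open>Change of variables \<open>x = 1 / (d + y)\<close>. The branch is decreasing while the
  substitution rule is for increasing ones, so the integral is reflected and
  \<open>-1 / (d + y)\<close> is used. The closed interval \<open>[-a, 1 - a]\<close> of that rule
  differs from \<open>J\<close> by one point.\<close>

lemma nn_integral_cyl:
  fixes F :: "real \<Rightarrow> ennreal"
  assumes [measurable]: "F \<in> borel_measurable borel"
    and supp: "\<And>x. x \<notin> cyl d \<Longrightarrow> F x = 0" and d: "d \<noteq> 0"
  shows "(\<integral>\<^sup>+x. F x \<partial>lborel) =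
    (\<integral>\<^sup>+y. F (1 / (of_int d + y)) * ennreal (1 / (of_int d + y)\<^sup>2) * indicator J y \<partial>lborel)"
proof (cases "\<forall>y\<in>{- a..1 - a}. of_int d + y \<noteq> 0")
  case False
  \<comment> \<open>The closed interval meets the pole \<open>y = -d\<close> only at its right end,
    for \<open>a = 0\<close> and \<open>d = -1\<close>. Negative digits do not occur then, and both
    sides vanish.\<close>
  have d1: "a = 0 \<and> d = - 1"
  proof -
    obtain y where y: "- a \<le> y" "y \<le> 1 - a" "of_int d + y = 0"
      using False by auto
    have "- 1 \<le> d" "d \<le> 0"
      using y shift_nonneg shift_less_1 by linarith+
    then have "d = - 1" using d by linarith
    then show ?thesis using y shift_nonneg by simp
  qed
  have "cyl d = {}"
  proof -
    have False if "x \<in> cyl d" for x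
    proof -
      have "x \<in> J" "x \<noteq> 0" "digit x = - 1" using that conjunct2[OF d1] unfolding cyl_def by blast+
      moreover from this have "0 < x" using d1 mem_J[of x] by linarith
      ultimately show False using digit_pos[of x] by linarith
    qed
    then show ?thesis by blast
  qed
  then have "F x = 0" for x using supp[of x] by blast
  then show ?thesis by simp
next
  case True
  let ?g = "\<lambda>y. - 1 / (of_int d + y) :: real"
  let ?F = "\<lambda>x. F (- x)"
  have supp': "F (- x) = F (- x) * indicator {?g (- a)..?g (1 - a)} x" for x
  proof (cases "- x \<in> cyl d")
    case C: True
    define t where "t = T (- x)"
    have t: "t \<in> J" by (simp add: t_def cf_map_in_J)
    have "x = ?g t"
      using C eq_inverse[of "- x"] by (auto simp: cyl_def t_def)
    moreover have "?g (- a) \<le> ?g t" "?g t \<le> ?g (1 - a)"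
    proof -
      have "(0 < of_int d - a \<and> 0 < of_int d + (1 - a)) \<or> (of_int d - a < 0 \<and> of_int d + (1 - a) < 0)"
      proof (cases "d \<ge> 1")
        case True
        then show ?thesis using shift_less_1 by linarith
      next
        case F: False
        have "of_int d + (1 - a) \<noteq> 0" using True shift_nonneg by auto
        moreover have "d \<le> - 1" using F d by linarith
        ultimately show ?thesis using shift_nonneg by linarith
      qed
      then show "?g (- a) \<le> ?g t" "?g t \<le> ?g (1 - a)"
        using t by (auto simp: mem_J field_simps)
    qed
    ultimately show ?thesis by simp
  qed (simp add: supp)
  have "(\<integral>\<^sup>+x. F x \<partial>lborel) = (\<integral>\<^sup>+x. F (- x) * indicator {?g (- a)..?g (1 - a)} x \<partial>lborel)"
    unfolding nn_integral_lborel_uminus[OF assms(1), symmetric] using supp' by simp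
  also have "\<dots> = (\<integral>\<^sup>+y. F (- ?g y) * ennreal (1 / (of_int d + y)\<^sup>2) * indicator {- a..1 - a} y \<partial>lborel)"
  proof (rule nn_integral_substitution_aux)
    show "(?g has_real_derivative 1 / (of_int d + y)\<^sup>2) (at y)" if "y \<in> {- a..1 - a}" for y
      using that True by (auto intro!: derivative_eq_intros simp: power2_eq_square field_simps)
    show "continuous_on {- a..1 - a} (\<lambda>y. 1 / (of_int d + y)\<^sup>2)"
      using True by (intro continuous_intros) auto
  qed (auto simp: shift_less_1)
  also have "\<dots> = (\<integral>\<^sup>+y. F (1 / (of_int d + y)) * ennreal (1 / (of_int d + y)\<^sup>2) * indicator J y \<partial>lborel)"
  proof (rule nn_integral_cong_AE)
    have "AE y in lborel. y \<noteq> 1 - a"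
      by (rule AE_lborel_singleton)
    then show "AE y in lborel. F (- ?g y) * ennreal (1 / (of_int d + y)\<^sup>2) * indicator {- a..1 - a} y =
        F (1 / (of_int d + y)) * ennreal (1 / (of_int d + y)\<^sup>2) * indicator J y"
      by eventually_elim (auto simp: indicator_def mem_J)
  qed
  finally show ?thesis .
qed

text \<open>
  The densities \<open>1 / (q + r x)\<^sup>2\<close> are those that arise from Lebesgue measure under the inverse
  branches; the pair \<open>(q, r)\<close> is formed by the denominators of two successive convergents.
\<close>

definition dens :: "real \<Rightarrow> real \<Rightarrow> real set \<Rightarrow> ennreal" where
  "dens q r S = (\<integral>\<^sup>+x. ennreal (1 / (q + r * x)\<^sup>2) * indicator S x \<partial>lborel)"

lemma dens_eq_emeasure:
  "S \<in> sets borel \<Longrightarrow> dens q r S = emeasure (density lborel (\<lambda>x. ennreal (1 / (q + r * x)\<^sup>2))) S"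
  by (simp add: dens_def emeasure_density)

text \<open>With \<open>x = 1 / (d + y)\<close>, the identity
  \<open>(q + r x) (d + y) = (q d + r) + q y\<close> absorbs the Jacobian
  \<open>1 / (d + y)^2\<close>. The family of densities is thus closed under the branches, which act
  on \<open>(q, r)\<close> by the recursion for denominators.\<close>

lemma dens_branch:
  assumes [measurable]: "I \<in> sets borel" "B \<in> sets borel" and d: "d \<noteq> 0" and I: "I \<subseteq> J"
  shows "dens q r (I \<inter> cyl d \<inter> T -` B) = dens (q * of_int d + r) q (pull d I \<inter> B)"
proof -
  have [measurable]: "T -` B \<in> sets borel"
    using measurable_sets[OF borel_cf_map, of B] by simp
  have "dens q r (I \<inter> cyl d \<inter> T -` B) = (\<integral>\<^sup>+y. ennreal (1 / (q + r * (1 / (of_int d + y)))\<^sup>2) *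
      indicator (I \<inter> cyl d \<inter> T -` B) (1 / (of_int d + y)) * ennreal (1 / (of_int d + y)\<^sup>2) * indicator J y \<partial>lborel)"
    unfolding dens_def by (rule nn_integral_cyl) (use d in auto)
  also have "\<dots> = dens (q * of_int d + r) q (pull d I \<inter> B)"
    unfolding dens_def
  proof (rule nn_integral_cong)
    fix y :: real
    show "ennreal (1 / (q + r * (1 / (of_int d + y)))\<^sup>2) *
      indicator (I \<inter> cyl d \<inter> T -` B) (1 / (of_int d + y)) * ennreal (1 / (of_int d + y)\<^sup>2) * indicator J y =
      ennreal (1 / (q * of_int d + r + q * y)\<^sup>2) * indicator (pull d I \<inter> B) y"
    proof (cases "y \<in> J")
      case True
      note nz = digit_add_nonzero[OF d True]
      have "1 / (of_int d + y) \<in> cyl d \<inter> T -` B \<longleftrightarrow> y \<in> B" if "1 / (of_int d + y) \<in> I"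
        using that nz digit_branch[OF d True] I by (auto simp: cyl_def)
      then have ind: "indicator (I \<inter> cyl d \<inter> T -` B) (1 / (of_int d + y)) = (indicator (pull d I \<inter> B) y :: ennreal)"
        using True by (auto simp: indicator_def pull_def)
      have "(1 / (q + r * (1 / (of_int d + y)))\<^sup>2) * (1 / (of_int d + y)\<^sup>2) =
          1 / (q * of_int d + r + q * y)\<^sup>2"
      proof -
        have "(q + r * (1 / (of_int d + y))) * (of_int d + y) = q * of_int d + r + q * y"
          using nz by (simp add: field_simps)
        then show ?thesis by (metis power_mult_distrib times_divide_times_eq mult_1)
      qed
      then have eq: "ennreal (1 / (q + r * (1 / (of_int d + y)))\<^sup>2) * ennreal (1 / (of_int d + y)\<^sup>2) =
          ennreal (1 / (q * of_int d + r + q * y)\<^sup>2)"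
        by (subst ennreal_mult[symmetric]) auto
      have jy: "indicator J y = (1 :: ennreal)"
        using True by simp
      have ac: "u * v * w * 1 = (u * w) * v" for u v w :: ennreal
        by (simp add: ac_simps)
      show ?thesis
        unfolding ind jy ac eq ..
    qed (simp add: pull_def)
  qed
  finally show ?thesis .
qed

text \<open>The sum of \<open>dens_branch\<close> over all digits, the point \<open>0\<close> being
  null. Peeling off one digit in this way gives the induction over the iterates of \<open>T\<close>,
  with \<open>B\<close> a preimage under the remaining ones.\<close>

lemma dens_split:
  assumes [measurable]: "I \<in> sets borel" "B \<in> sets borel" and I: "I \<subseteq> J"
  shows "dens q r (I \<inter> T -` B) = (\<integral>\<^sup>+d. dens (q * of_int d + r) q (pull d I \<inter> B) \<partial>count_space (- {0}))"
proof -
  have [measurable]: "T -` B \<in> sets borel"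
    using measurable_sets[OF borel_cf_map, of B] by simp
  let ?X = "\<lambda>d. I \<inter> cyl d \<inter> T -` B"
  have "dens q r (I \<inter> T -` B) = dens q r (\<Union> (?X ` (- {0})))"
    unfolding dens_def
  proof (rule nn_integral_cong_AE)
    have "AE x in lborel. x \<noteq> (0::real)"
      by (rule AE_lborel_singleton)
    then show "AE x in lborel. ennreal (1 / (q + r * x)\<^sup>2) * indicator (I \<inter> T -` B) x =
        ennreal (1 / (q + r * x)\<^sup>2) * indicator (\<Union> (?X ` (- {0}))) x"
    proof eventually_elim
      case (elim x)
      then have "x \<in> I \<inter> T -` B \<longleftrightarrow> x \<in> \<Union> (?X ` (- {0}))"
        using I digit_nonzero[of x] by (auto simp: cyl_def)
      then show ?case by (simp add: indicator_def)
    qed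
  qed
  also have "\<dots> = (\<integral>\<^sup>+d. dens q r (?X d) \<partial>count_space (- {0}))"
  proof -
    have "dens q r (\<Union> (?X ` (- {0}))) = emeasure (density lborel (\<lambda>x. ennreal (1 / (q + r * x)\<^sup>2))) (\<Union> (?X ` (- {0})))"
      by (rule dens_eq_emeasure) (intro sets.countable_UN', auto)
    also have "\<dots> = (\<integral>\<^sup>+d. emeasure (density lborel (\<lambda>x. ennreal (1 / (q + r * x)\<^sup>2))) (?X d) \<partial>count_space (- {0}))"
      by (rule emeasure_UN_countable) (auto simp: disjoint_family_on_def cyl_def)
    also have "\<dots> = (\<integral>\<^sup>+d. dens q r (?X d) \<partial>count_space (- {0}))"
      by (intro nn_integral_cong dens_eq_emeasure[symmetric]) auto
    finally show ?thesis .
  qed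
  also have "\<dots> = (\<integral>\<^sup>+d. dens (q * of_int d + r) q (pull d I \<inter> B) \<partial>count_space (- {0}))"
    by (intro nn_integral_cong dens_branch) (use I in auto)
  finally show ?thesis .
qed

text \<open>
  The constant \<open>2\<close> in the regularity condition on a density reproduces itself under the branches,
  and it bounds the distortion of the density by \<open>9\<close>. The sup bound is taken relative to the
  density \<open>1 / (1 + \<bar>x\<bar>)\<close>, for which all branches contract.
\<close>

definition regular :: "real \<Rightarrow> real \<Rightarrow> real set \<Rightarrow> bool" where
  "regular q r I \<longleftrightarrow> (\<forall>x\<in>I. q + r * x \<noteq> 0 \<and> \<bar>r\<bar> * (1 + \<bar>x\<bar>) \<le> 2 * \<bar>q + r * x\<bar>)"

definition sup_bound :: "ennreal \<Rightarrow> real \<Rightarrow> real \<Rightarrow> real set \<Rightarrow> bool" where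
  "sup_bound s q r I \<longleftrightarrow> (\<forall>x\<in>I. ennreal ((1 + \<bar>x\<bar>) / (q + r * x)\<^sup>2) \<le> s)"

lemma pullE:
  assumes "y \<in> pull d I" "I \<subseteq> J" "d \<noteq> 0"
  obtains x where "x \<in> I" "x \<in> J" "x \<noteq> 0" "of_int d + y = 1 / x" "x = 1 / (of_int d + y)"
    "y = T x" "d = digit x" "\<bar>x\<bar> * (1 + \<bar>y\<bar>) \<le> 1" "\<bar>x\<bar> < 1" "y \<in> J"
proof -
  have y: "y \<in> J" "1 / (of_int d + y) \<in> I"
    using assms(1) by (auto simp: pull_def)
  show ?thesis
  proof (rule that[of "1 / (of_int d + y)"])
    show "1 / (of_int d + y) \<in> J" using y assms(2) by blast
    show "\<bar>1 / (of_int d + y)\<bar> * (1 + \<bar>y\<bar>) \<le> 1" "\<bar>1 / (of_int d + y)\<bar> < 1"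
      using abs_mult_image_le_1[OF \<open>1 / (of_int d + y) \<in> J\<close>] abs_less_1[OF \<open>1 / (of_int d + y) \<in> J\<close>]
        digit_branch(2)[OF assms(3) y(1)] by simp_all
  qed (use y digit_add_nonzero[OF assms(3) y(1)] digit_branch[OF assms(3) y(1)] in auto)
qed

text \<open>Put \<open>Z = q + r x\<close>; the new denominator is \<open>Z / x\<close>. From
  \<open>|x| < 1\<close> the old condition yields \<open>|r x| \<le> |Z|\<close>, so
  \<open>|q| \<le> 2 |Z|\<close>. Together with \<open>|x| (1 + |y|) \<le> 1\<close> this gives the
  new condition with the same factor \<open>2\<close>.\<close>

lemma regular_pull:
  assumes "regular q r I" "I \<subseteq> J" "d \<noteq> 0"
  shows "regular (q * of_int d + r) q (pull d I)"
  unfolding regular_def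
proof
  fix y assume "y \<in> pull d I"
  then obtain x where x: "x \<in> I" "x \<noteq> 0" "of_int d + y = 1 / x"
    "\<bar>x\<bar> * (1 + \<bar>y\<bar>) \<le> 1" "\<bar>x\<bar> < 1"
    using pullE[OF _ assms(2,3)] by metis
  define Z where "Z = q + r * x"
  have Z: "Z \<noteq> 0" "\<bar>r\<bar> * (1 + \<bar>x\<bar>) \<le> 2 * \<bar>Z\<bar>"
    using assms(1) x(1) by (auto simp: regular_def Z_def)
  have eq: "q * of_int d + r + q * y = Z / x"
  proof -
    have "q * of_int d + r + q * y = q * (of_int d + y) + r" by (simp add: algebra_simps)
    then show ?thesis unfolding x(3) using x(2) by (simp add: Z_def field_simps)
  qed
  have "\<bar>r\<bar> * \<bar>x\<bar> \<le> \<bar>r\<bar> * 1" using x(5) by (intro mult_left_mono) auto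
  then have "\<bar>r * x\<bar> \<le> \<bar>Z\<bar>" using Z(2) by (simp add: abs_mult algebra_simps)
  then have q: "\<bar>q\<bar> \<le> 2 * \<bar>Z\<bar>" using abs_triangle_ineq4[of Z "r * x"] by (simp add: Z_def)
  have "\<bar>q\<bar> * (\<bar>x\<bar> * (1 + \<bar>y\<bar>)) \<le> \<bar>q\<bar> * 1" using x(4) by (intro mult_left_mono) auto
  then have "\<bar>q\<bar> * (1 + \<bar>y\<bar>) * \<bar>x\<bar> \<le> 2 * \<bar>Z\<bar>" using q by (simp add: algebra_simps)
  then have "\<bar>q\<bar> * (1 + \<bar>y\<bar>) \<le> 2 * \<bar>Z / x\<bar>"
    using x(2) by (simp add: field_simps)
  then show "q * of_int d + r + q * y \<noteq> 0 \<and> \<bar>q\<bar> * (1 + \<bar>y\<bar>) \<le> 2 * \<bar>q * of_int d + r + q * y\<bar>"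
    unfolding eq using Z(1) x(2) by simp
qed

lemma weight_le:
  fixes x y w :: real
  assumes W: "\<bar>x\<bar> / (1 + \<bar>x\<bar>) \<le> w" and xy: "\<bar>x\<bar> * (1 + \<bar>y\<bar>) \<le> 1"
  shows "x\<^sup>2 * (1 + \<bar>y\<bar>) \<le> w * (1 + \<bar>x\<bar>)"
proof -
  have "x\<^sup>2 * (1 + \<bar>y\<bar>) = \<bar>x\<bar> * (\<bar>x\<bar> * (1 + \<bar>y\<bar>))"
    by (simp add: power2_eq_square mult.assoc[symmetric])
  also have "\<dots> \<le> \<bar>x\<bar> * 1" using xy by (intro mult_left_mono) auto
  also have "\<dots> \<le> w * (1 + \<bar>x\<bar>)" using W by (simp add: pos_divide_le_eq)
  finally show ?thesis .
qed

text \<open>At \<open>y = T x\<close> the weighted density is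
  \<open>x^2 (1 + |y|) / (q + r x)^2\<close>, and the key inequality bounds
  \<open>x^2 (1 + |y|)\<close> by \<open>|x|\<close>, hence by \<open>w (1 + |x|)\<close>.\<close>

lemma sup_bound_pull:
  assumes b: "sup_bound s q r I" and "I \<subseteq> J" "d \<noteq> 0" and w: "0 \<le> w"
    and W: "\<And>x. x \<in> J \<Longrightarrow> x \<noteq> 0 \<Longrightarrow> digit x = d \<Longrightarrow> \<bar>x\<bar> / (1 + \<bar>x\<bar>) \<le> w"
  shows "sup_bound (ennreal w * s) (q * of_int d + r) q (pull d I)"
  unfolding sup_bound_def
proof
  fix y assume "y \<in> pull d I"
  then obtain x where x: "x \<in> I" "x \<in> J" "x \<noteq> 0" "of_int d + y = 1 / x" "d = digit x"
    "\<bar>x\<bar> * (1 + \<bar>y\<bar>) \<le> 1"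
    using pullE[OF _ assms(2,3)] by metis
  define Z where "Z = q + r * x"
  have eq: "q * of_int d + r + q * y = Z / x"
  proof -
    have "q * of_int d + r + q * y = q * (of_int d + y) + r" by (simp add: algebra_simps)
    then show ?thesis unfolding x(4) using x(3) by (simp add: Z_def field_simps)
  qed
  have "(1 + \<bar>y\<bar>) / (Z / x)\<^sup>2 = x\<^sup>2 * (1 + \<bar>y\<bar>) / Z\<^sup>2"
    by (simp add: power_divide mult.commute)
  also have "\<dots> \<le> w * (1 + \<bar>x\<bar>) / Z\<^sup>2"
    by (intro divide_right_mono weight_le W) (use x in auto)
  finally have "ennreal ((1 + \<bar>y\<bar>) / (Z / x)\<^sup>2) \<le> ennreal (w * ((1 + \<bar>x\<bar>) / Z\<^sup>2))"
    by (intro ennreal_leI) simp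
  also have "\<dots> = ennreal w * ennreal ((1 + \<bar>x\<bar>) / Z\<^sup>2)"
    using w by (intro ennreal_mult) auto
  also have "\<dots> \<le> ennreal w * s"
    using b x(1) by (intro mult_left_mono) (auto simp: sup_bound_def Z_def)
  finally show "ennreal ((1 + \<bar>y\<bar>) / (q * of_int d + r + q * y)\<^sup>2) \<le> ennreal w * s"
    unfolding eq .
qed

text \<open>\<open>J\<close> has length \<open>1\<close>, so
  \<open>|r (x - y)| \<le> |r| \<le> 2 |q + r x|\<close>. Hence
  \<open>|q + r y| \<le> 3 |q + r x|\<close>, and squaring gives \<open>9\<close>.\<close>

lemma regular_distortion:
  assumes "regular q r I" "I \<subseteq> J" "x \<in> I" "y \<in> I"
  shows "1 / (q + r * x)\<^sup>2 \<le> 9 * (1 / (q + r * y)\<^sup>2)"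
proof -
  have J: "\<bar>x - y\<bar> \<le> 1"
    using assms(2-4) mem_J[of x] mem_J[of y] by force
  have nz: "q + r * x \<noteq> 0" "q + r * y \<noteq> 0" and rx: "\<bar>r\<bar> * (1 + \<bar>x\<bar>) \<le> 2 * \<bar>q + r * x\<bar>"
    using assms by (auto simp: regular_def)
  have "\<bar>r\<bar> * 1 \<le> \<bar>r\<bar> * (1 + \<bar>x\<bar>)" "\<bar>r\<bar> * \<bar>x - y\<bar> \<le> \<bar>r\<bar> * 1"
    using J by (intro mult_left_mono; simp)+
  then have "\<bar>r * (x - y)\<bar> \<le> 2 * \<bar>q + r * x\<bar>"
    using rx by (simp add: abs_mult)
  moreover have "\<bar>(q + r * x) - r * (x - y)\<bar> \<le> \<bar>q + r * x\<bar> + \<bar>r * (x - y)\<bar>"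
    by (rule abs_triangle_ineq4)
  moreover have "(q + r * x) - r * (x - y) = q + r * y"
    by (simp add: algebra_simps)
  ultimately have "\<bar>q + r * y\<bar> \<le> 3 * \<bar>q + r * x\<bar>"
    by simp
  then have "\<bar>q + r * y\<bar>\<^sup>2 \<le> (3 * \<bar>q + r * x\<bar>)\<^sup>2"
    by (intro power_mono) auto
  then show ?thesis
    using nz by (simp add: field_simps)
qed

lemma dens_mono_density:
  assumes "S \<in> sets borel" "\<And>x. x \<in> S \<Longrightarrow> k * (1 / (q + r * x)\<^sup>2) \<le> k'" "0 \<le> k"
  shows "ennreal k * dens q r S \<le> ennreal k' * emeasure lborel S"
proof -
  have [measurable]: "S \<in> sets borel" by fact
  have "ennreal k * dens q r S = (\<integral>\<^sup>+x. ennreal k * (ennreal (1 / (q + r * x)\<^sup>2) * indicator S x) \<partial>lborel)"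
    unfolding dens_def by (subst nn_integral_cmult) auto
  also have "\<dots> \<le> (\<integral>\<^sup>+x. ennreal k' * indicator S x \<partial>lborel)"
    using assms(2,3)
    by (intro nn_integral_mono) (auto simp: indicator_def ennreal_mult'[symmetric] intro!: ennreal_leI)
  also have "\<dots> = ennreal k' * emeasure lborel S"
    by (simp add: nn_integral_cmult_indicator)
  finally show ?thesis .
qed

lemma dens_mono_density':
  assumes "S \<in> sets borel" "\<And>x. x \<in> S \<Longrightarrow> k' \<le> k * (1 / (q + r * x)\<^sup>2)" "0 \<le> k"
  shows "ennreal k' * emeasure lborel S \<le> ennreal k * dens q r S"
proof -
  have [measurable]: "S \<in> sets borel" by fact
  have "ennreal k' * emeasure lborel S = (\<integral>\<^sup>+x. ennreal k' * indicator S x \<partial>lborel)"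
    by (simp add: nn_integral_cmult_indicator)
  also have "\<dots> \<le> (\<integral>\<^sup>+x. ennreal k * (ennreal (1 / (q + r * x)\<^sup>2) * indicator S x) \<partial>lborel)"
    using assms(2,3)
    by (intro nn_integral_mono) (auto simp: indicator_def ennreal_mult'[symmetric] intro!: ennreal_leI)
  also have "\<dots> = ennreal k * dens q r S"
    unfolding dens_def by (subst nn_integral_cmult) auto
  finally show ?thesis .
qed

lemma emeasure_J: "emeasure lborel J = 1"
  by (simp add: cf_interval_def)

lemma emeasure_le_1: "S \<subseteq> J \<Longrightarrow> emeasure lborel S \<le> 1"
  using emeasure_mono[of S J lborel] emeasure_J by simp

text \<open>On all of \<open>J\<close>, which has measure \<open>1\<close>, the mass is at least a
  ninth of each value of the density, and \<open>1 + |y| < 2\<close>; this accounts for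
  \<open>18\<close>. On a short interval the mass gives no such bound, which is why incomplete
  pieces are treated separately.\<close>

lemma sup_bound_full:
  assumes "regular q r J"
  shows "sup_bound (18 * dens q r J) q r J"
  unfolding sup_bound_def
proof
  fix y assume y: "y \<in> J"
  have "ennreal (1 / (q + r * y)\<^sup>2) * emeasure lborel J \<le> ennreal 9 * dens q r J"
    by (intro dens_mono_density' regular_distortion[OF assms]) (use y in auto)
  then have "ennreal (1 / (q + r * y)\<^sup>2) \<le> 9 * dens q r J"
    by (simp add: emeasure_J)
  then have *: "2 * ennreal (1 / (q + r * y)\<^sup>2) \<le> 2 * (9 * dens q r J)"
    by (intro mult_left_mono) auto
  have "ennreal ((1 + \<bar>y\<bar>) / (q + r * y)\<^sup>2) \<le> ennreal (2 * (1 / (q + r * y)\<^sup>2))"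
    using abs_less_1[OF y] by (intro ennreal_leI) (simp add: divide_right_mono)
  also have "\<dots> = 2 * ennreal (1 / (q + r * y)\<^sup>2)"
    by (subst ennreal_mult) auto
  also note *
  also have "2 * (9 * dens q r J) = 18 * dens q r J"
    by (subst mult.assoc[symmetric]) simp
  finally show "ennreal ((1 + \<bar>y\<bar>) / (q + r * y)\<^sup>2) \<le> 18 * dens q r J" .
qed

section \<open>Incomplete pieces of an interval\<close>

definition partial_digits :: "real set \<Rightarrow> int set" where
  "partial_digits I = {d. d \<noteq> 0 \<and> pull d I \<noteq> {} \<and> pull d I \<noteq> J}"

text \<open>On the line the cylinders come in the order of the reciprocals \<open>1 / d\<close>. The
  four cases say that \<open>e\<close> lies strictly between \<open>f\<close> and \<open>d\<close>
  in this order, with \<open>f\<close> on the left. An interval that meets the outer two cylinders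
  contains every value of the branch of \<open>e\<close>.\<close>

lemma pull_between:
  assumes I: "is_interval I" and "pull d I \<noteq> {}" "pull f I \<noteq> {}"
    and "(0 < d \<and> d < e \<and> e < f) \<or> (d < e \<and> e < f \<and> f < 0) \<or> (f < 0 \<and> 0 < d \<and> d < e) \<or> (e < f \<and> f < 0 \<and> 0 < d)"
  shows "pull e I = J"
proof -
  obtain u v where u: "u \<in> J" "1 / (of_int d + u) \<in> I" and v: "v \<in> J" "1 / (of_int f + v) \<in> I"
    using assms(2,3) by (auto simp: pull_def)
  have "y \<in> pull e I" if y: "y \<in> J" for y
  proof -
    \<comment> \<open>Points of \<open>J\<close> differ by less than \<open>1\<close>, so adding
      them to distinct digits cannot reverse the order of these.\<close>
    have b: "\<bar>y\<bar> < 1" "\<bar>u\<bar> < 1" "\<bar>v\<bar> < 1" "\<bar>y - u\<bar> < 1" "\<bar>y - v\<bar> < 1"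
      using y u(1) v(1) abs_less_1[of y] abs_less_1[of u] abs_less_1[of v] by (auto simp: mem_J)
    have "1 / (of_int f + v) \<le> 1 / (of_int e + y) \<and> 1 / (of_int e + y) \<le> 1 / (of_int d + u)"
      using assms(4)
    proof (elim disjE)
      assume o: "0 < d \<and> d < e \<and> e < f"
      then have "0 < of_int d + u" "of_int d + u \<le> of_int e + y" "of_int e + y \<le> of_int f + v"
        using b by linarith+
      then show ?thesis by (auto intro!: divide_left_mono)
    next
      assume o: "d < e \<and> e < f \<and> f < 0"
      then have "of_int f + v < 0" "of_int d + u \<le> of_int e + y" "of_int e + y \<le> of_int f + v"
        using b by linarith+
      then show ?thesis by (auto intro!: divide_left_mono mult_neg_neg)
    next
      assume o: "f < 0 \<and> 0 < d \<and> d < e"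
      then have *: "of_int f + v < 0" "0 < of_int d + u" "of_int d + u \<le> of_int e + y"
        using b by linarith+
      then have "1 / (of_int f + v) \<le> 0" "0 \<le> 1 / (of_int e + y)"
        "1 / (of_int e + y) \<le> 1 / (of_int d + u)"
        by (auto intro!: divide_left_mono)
      then show ?thesis by linarith
    next
      assume o: "e < f \<and> f < 0 \<and> 0 < d"
      then have *: "of_int f + v < 0" "0 < of_int d + u" "of_int e + y \<le> of_int f + v"
        using b by linarith+
      then have "1 / (of_int e + y) \<le> 0" "0 \<le> 1 / (of_int d + u)"
        "1 / (of_int f + v) \<le> 1 / (of_int e + y)"
        by (auto intro!: divide_left_mono mult_neg_neg)
      then show ?thesis by linarith
    qed
    then have "1 / (of_int e + y) \<in> I"
      using mem_is_interval_1[OF I v(2) u(2)] by blast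
    then show ?thesis using y by (simp add: pull_def)
  qed
  then show ?thesis using pull_subset by blast
qed

lemma partial_digits_le_2:
  assumes I: "is_interval I"
  obtains d e where "partial_digits I \<subseteq> {d, e}"
proof -
  have sorted: False if "d \<in> partial_digits I" "e \<in> partial_digits I" "f \<in> partial_digits I" "d < e" "e < f" for d e f
  proof -
    have nz: "d \<noteq> 0" "e \<noteq> 0" "f \<noteq> 0"
      and ne: "pull d I \<noteq> {}" "pull e I \<noteq> {}" "pull f I \<noteq> {}"
      and nJ: "pull d I \<noteq> J" "pull e I \<noteq> J" "pull f I \<noteq> J"
      using that by (auto simp: partial_digits_def)
    \<comment> \<open>The middle digit in the order of the reciprocals need not be the numerical
      middle: when both signs occur, it is the digit of larger modulus among the two that share a
      sign.\<close>
    consider "0 < d" | "f < 0" | "d < 0" "0 < e" | "e < 0" "0 < f"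
      using nz that by linarith
    then show False
    proof cases
      case 1
      then show ?thesis using pull_between[OF I ne(1,3), of e] that nJ by blast
    next
      case 2
      then show ?thesis using pull_between[OF I ne(1,3), of e] that nJ by blast
    next
      case 3
      then show ?thesis using pull_between[OF I ne(2,1), of f] that nJ by blast
    next
      case 4
      then show ?thesis using pull_between[OF I ne(3,2), of d] that nJ by blast
    qed
  qed
  have "\<exists>d e. partial_digits I \<subseteq> {d, e}"
  proof (rule ccontr)
    assume *: "\<nexists>d e. partial_digits I \<subseteq> {d, e}"
    then obtain d where d: "d \<in> partial_digits I" by blast
    with * obtain e where e: "e \<in> partial_digits I" "e \<noteq> d" by blast
    with * obtain f where f: "f \<in> partial_digits I" "f \<noteq> d" "f \<noteq> e" by blast
    show False
      using sorted[of d e f] sorted[of d f e] sorted[of e d f] sorted[of e f d] sorted[of f d e] sorted[of f e d]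
        d e f by (metis linorder_neqE)
  qed
  then show ?thesis using that by blast
qed

lemma finite_partial_digits: "is_interval I \<Longrightarrow> finite (partial_digits I)"
  by (metis partial_digits_le_2 finite.emptyI finite.insertI finite_subset)

lemma sum_partial_le:
  fixes W :: "int \<Rightarrow> real"
  assumes I: "is_interval I" and W: "\<And>d. 0 \<le> W d" "\<And>d. W d \<le> l" "\<And>d e. d \<noteq> e \<Longrightarrow> W d + W e \<le> l"
  shows "sum W (partial_digits I) \<le> l"
proof -
  obtain d e where "partial_digits I \<subseteq> {d, e}"
    using partial_digits_le_2[OF I] by blast
  then have "sum W (partial_digits I) \<le> sum W {d, e}"
    using W(1) by (intro sum_mono2) auto
  also have "\<dots> \<le> l"
    using W(2,3) by (cases "d = e") auto
  finally show ?thesis .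
qed

lemma borel_funpow [measurable]: "(T ^^ n) \<in> borel_measurable borel"
proof (induction n)
  case (Suc n)
  then show ?case by simp
qed simp

lemma borel_vimage [measurable]: "E \<in> sets borel \<Longrightarrow> (T ^^ n) -` E \<in> sets borel"
  by (rule measurable_sets_borel[OF borel_funpow])

lemma funpow_vimage: "(T ^^ Suc n) -` E = T -` ((T ^^ n) -` E)"
  by (auto simp: funpow_swap1)

lemma partial_sum:
  assumes I: "is_interval I" and W: "\<And>d. 0 \<le> W d" "\<And>d. W d \<le> l" "\<And>d e. d \<noteq> e \<Longrightarrow> W d + W e \<le> l"
  shows "(\<integral>\<^sup>+d. ennreal (W d) * s * indicator (partial_digits I) d \<partial>count_space (- {0})) \<le> ennreal l * s"
proof -
  have "(\<integral>\<^sup>+d. ennreal (W d) * s * indicator (partial_digits I) d \<partial>count_space (- {0})) =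
      (\<Sum>d\<in>partial_digits I. ennreal (W d) * s * indicator (partial_digits I) d)"
    by (rule nn_integral_count_space') (use finite_partial_digits[OF I] in \<open>auto simp: partial_digits_def\<close>)
  also have "\<dots> = (\<Sum>d\<in>partial_digits I. ennreal (W d)) * s"
    by (simp add: sum_distrib_right)
  also have "\<dots> = ennreal (sum W (partial_digits I)) * s"
    using W(1) by (simp add: sum_ennreal)
  also have "\<dots> \<le> ennreal l * s"
    using sum_partial_le[OF I W] by (intro mult_right_mono ennreal_leI) auto
  finally show ?thesis .
qed

text \<open>
  After one step, the sup bounds of all pieces together are controlled by the total mass and a
  contracted multiple of the previous sup bound.
\<close>

definition lasota_yorke :: "real \<Rightarrow> bool" where
  "lasota_yorke l \<longleftrightarrow> 0 \<le> l \<and> l < 1 \<and>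
    (\<forall>I q r s. I \<subseteq> J \<longrightarrow> is_interval I \<longrightarrow> I \<in> sets borel \<longrightarrow> regular q r I \<longrightarrow> sup_bound s q r I \<longrightarrow>
      (\<exists>t. (\<forall>d. d \<noteq> 0 \<longrightarrow> sup_bound (t d) (q * of_int d + r) q (pull d I)) \<and>
        (\<integral>\<^sup>+d. t d \<partial>count_space (- {0})) \<le> 18 * dens q r I + ennreal l * s))"

lemma lasota_yorke_bounds: "lasota_yorke l \<Longrightarrow> 0 \<le> l" "lasota_yorke l \<Longrightarrow> l < 1"
  by (simp_all add: lasota_yorke_def)

lemma lasota_yorke_step:
  assumes "lasota_yorke l" "I \<subseteq> J" "is_interval I" "I \<in> sets borel" "regular q r I" "sup_bound s q r I"
  obtains t where "\<And>d. d \<noteq> 0 \<Longrightarrow> sup_bound (t d) (q * of_int d + r) q (pull d I)"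
    "(\<integral>\<^sup>+d. t d \<partial>count_space (- {0})) \<le> 18 * dens q r I + ennreal l * s"
proof -
  have "\<exists>t. (\<forall>d. d \<noteq> 0 \<longrightarrow> sup_bound (t d) (q * of_int d + r) q (pull d I)) \<and>
      (\<integral>\<^sup>+d. t d \<partial>count_space (- {0})) \<le> 18 * dens q r I + ennreal l * s"
    using assms(1)[unfolded lasota_yorke_def, THEN conjunct2, THEN conjunct2, rule_format, OF assms(2-6)] .
  then show ?thesis using that by blast
qed

text \<open>A full piece is bounded by its own mass (\<open>sup_bound_full\<close>), an incomplete
  one by the contracted old bound (\<open>sup_bound_pull\<close>). The masses add up to that of
  \<open>I\<close>, and the weights of the incomplete pieces, at most two in number, to at most
  \<open>l < 1\<close>.\<close>

lemma lasota_yorke_exists: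
  obtains l where "lasota_yorke l"
proof -
  obtain W :: "int \<Rightarrow> real" and l where l: "0 \<le> l" "l < 1"
    and W: "\<And>d. 0 \<le> W d" "\<And>d. W d \<le> l" "\<And>d e. d \<noteq> e \<Longrightarrow> W d + W e \<le> l"
      "\<And>x. x \<in> J \<Longrightarrow> x \<noteq> 0 \<Longrightarrow> \<bar>x\<bar> / (1 + \<bar>x\<bar>) \<le> W (digit x)"
    using piece_weights by metis
  have "\<exists>t. (\<forall>d. d \<noteq> 0 \<longrightarrow> sup_bound (t d) (q * of_int d + r) q (pull d I)) \<and>
      (\<integral>\<^sup>+d. t d \<partial>count_space (- {0})) \<le> 18 * dens q r I + ennreal l * s"
    if I: "I \<subseteq> J" "is_interval I" and Ib: "I \<in> sets borel" and regular: "regular q r I" and b: "sup_bound s q r I" for I q r s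
  proof -
    note [measurable] = Ib
    define t where "t d = 18 * dens (q * of_int d + r) q (pull d I) +
      ennreal (W d) * s * indicator (partial_digits I) d" for d
    have "sup_bound (t d) (q * of_int d + r) q (pull d I)" if d: "d \<noteq> 0" for d
    proof (cases "pull d I = J")
      case True
      have "sup_bound (18 * dens (q * of_int d + r) q (pull d I)) (q * of_int d + r) q (pull d I)"
        using sup_bound_full regular_pull[OF regular I(1) d] unfolding True by blast
      then show ?thesis
        unfolding sup_bound_def t_def by (meson add_increasing2 order_trans zero_le)
    next
      case False
      have *: "sup_bound (ennreal (W d) * s) (q * of_int d + r) q (pull d I)"
        by (rule sup_bound_pull[OF b I(1) d]) (use W in auto)
      show ?thesis
        unfolding sup_bound_def
      proof
        fix y assume y: "y \<in> pull d I"
        then have "d \<in> partial_digits I"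
          using False d by (auto simp: partial_digits_def)
        then have "ennreal (W d) * s \<le> t d"
          unfolding t_def by (simp add: add_increasing)
        then show "ennreal ((1 + \<bar>y\<bar>) / (q * of_int d + r + q * y)\<^sup>2) \<le> t d"
          using * y by (auto simp: sup_bound_def intro: order_trans)
      qed
    qed
    moreover have "(\<integral>\<^sup>+d. t d \<partial>count_space (- {0})) \<le> 18 * dens q r I + ennreal l * s"
    proof -
      have "(\<integral>\<^sup>+d. t d \<partial>count_space (- {0})) =
          18 * (\<integral>\<^sup>+d. dens (q * of_int d + r) q (pull d I) \<partial>count_space (- {0})) +
          (\<integral>\<^sup>+d. ennreal (W d) * s * indicator (partial_digits I) d \<partial>count_space (- {0}))"
        unfolding t_def by (subst nn_integral_add) (auto simp: nn_integral_cmult)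
      also have "(\<integral>\<^sup>+d. dens (q * of_int d + r) q (pull d I) \<partial>count_space (- {0})) = dens q r I"
        using dens_split[of I UNIV q r] I by simp
      finally show ?thesis
        using partial_sum[OF I(2) W(1-3), where s = s] by (simp add: add_left_mono)
    qed
    ultimately show ?thesis by blast
  qed
  then have "lasota_yorke l"
    using l unfolding lasota_yorke_def by blast
  then show ?thesis by (rule that)
qed

lemma sup_bound_imp_dens_le:
  assumes b: "sup_bound s q r I" and S: "S \<in> sets borel" "S \<subseteq> I"
  shows "dens q r S \<le> s * emeasure lborel S"
proof -
  have [measurable]: "S \<in> sets borel" by fact
  have "dens q r S \<le> (\<integral>\<^sup>+x. s * indicator S x \<partial>lborel)"
    unfolding dens_def
  proof (rule nn_integral_mono)
    fix x
    show "ennreal (1 / (q + r * x)\<^sup>2) * indicator S x \<le> s * indicator S x"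
    proof (cases "x \<in> S")
      case True
      have "ennreal (1 / (q + r * x)\<^sup>2) \<le> ennreal ((1 + \<bar>x\<bar>) / (q + r * x)\<^sup>2)"
        by (intro ennreal_leI divide_right_mono) auto
      also have "\<dots> \<le> s" using b True S by (auto simp: sup_bound_def)
      finally show ?thesis using True by simp
    qed simp
  qed
  also have "\<dots> = s * emeasure lborel S"
    by (simp add: nn_integral_cmult_indicator)
  finally show ?thesis .
qed

text \<open>One step replaces the sup bound \<open>s\<close> by a family with sum at most
  \<open>18 m + l s\<close>, while the total mass \<open>m\<close> is preserved. Iteration gives
  \<open>l^n s\<close> plus \<open>18 m\<close> times a geometric sum. The induction hypothesis is
  applied to the pieces of \<open>I\<close> with their own densities and bounds, so all of these are
  arbitrary in it.\<close>

lemma upper_bound_aux: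
  assumes ly: "lasota_yorke l"
    and E: "E \<in> sets borel" "E \<subseteq> J"
    and I: "I \<subseteq> J" "is_interval I" "I \<in> sets borel" "regular q r I" "sup_bound s q r I"
  shows "dens q r (I \<inter> (T ^^ n) -` E) \<le>
    (ennreal (l ^ n) * s + ennreal (18 * (\<Sum>i<n. l ^ i)) * dens q r I) * emeasure lborel E"
  using I
proof (induction n arbitrary: I q r s)
  case 0
  then have "dens q r (I \<inter> E) \<le> s * emeasure lborel (I \<inter> E)"
    by (intro sup_bound_imp_dens_le) (use E in auto)
  also have "\<dots> \<le> s * emeasure lborel E"
    using E by (intro mult_left_mono emeasure_mono) auto
  finally show ?case by simp
next
  case (Suc n)
  note [measurable] = E(1) Suc.prems(3)
  note l = lasota_yorke_bounds[OF ly]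
  obtain t where t: "\<And>d. d \<noteq> 0 \<Longrightarrow> sup_bound (t d) (q * of_int d + r) q (pull d I)"
    and ts: "(\<integral>\<^sup>+d. t d \<partial>count_space (- {0})) \<le> 18 * dens q r I + ennreal l * s"
    using lasota_yorke_step[OF ly Suc.prems] by blast
  let ?b = "ennreal (18 * (\<Sum>i<n. l ^ i))" and ?D = "\<lambda>d. dens (q * of_int d + r) q (pull d I)"
  have Dsum: "(\<integral>\<^sup>+d. ?D d \<partial>count_space (- {0})) = dens q r I"
    using dens_split[of I UNIV q r] Suc.prems(1) by simp
  have "dens q r (I \<inter> (T ^^ Suc n) -` E) =
      (\<integral>\<^sup>+d. dens (q * of_int d + r) q (pull d I \<inter> (T ^^ n) -` E) \<partial>count_space (- {0}))"
    unfolding funpow_vimage by (rule dens_split) (use Suc.prems in auto)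
  also have "\<dots> \<le> (\<integral>\<^sup>+d. (ennreal (l ^ n) * t d + ?b * ?D d) * emeasure lborel E \<partial>count_space (- {0}))"
  proof (rule nn_integral_mono, simp)
    fix d :: int assume d: "d \<noteq> 0"
    show "dens (q * of_int d + r) q (pull d I \<inter> (T ^^ n) -` E) \<le> (ennreal (l ^ n) * t d + ?b * ?D d) * emeasure lborel E"
      by (rule Suc.IH) (use pull_subset is_interval_pull[OF Suc.prems(2) d] regular_pull[OF Suc.prems(4,1) d] t[OF d] in auto)
  qed
  also have "\<dots> = (ennreal (l ^ n) * (\<integral>\<^sup>+d. t d \<partial>count_space (- {0})) + ?b * dens q r I) * emeasure lborel E"
    by (simp add: nn_integral_multc nn_integral_add nn_integral_cmult Dsum)
  also have "\<dots> \<le> (ennreal (l ^ n) * (18 * dens q r I + ennreal l * s) + ?b * dens q r I) * emeasure lborel E"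
    using ts by (intro mult_right_mono add_right_mono mult_left_mono) auto
  also have "ennreal (l ^ n) * (18 * dens q r I + ennreal l * s) + ?b * dens q r I =
      ennreal (l ^ Suc n) * s + (ennreal (18 * l ^ n) + ?b) * dens q r I"
  proof -
    have "ennreal (l ^ Suc n) = ennreal (l ^ n) * ennreal l"
      using l by (subst ennreal_mult[symmetric]) (auto simp: mult.commute)
    moreover have "ennreal (18 * l ^ n) = ennreal (l ^ n) * 18"
      using l by (subst ennreal_mult) (auto simp: mult.commute)
    ultimately show ?thesis by (simp add: algebra_simps)
  qed
  also have "ennreal (18 * l ^ n) + ?b = ennreal (18 * (\<Sum>i<Suc n. l ^ i))"
    using l by (subst ennreal_plus[symmetric]) (auto simp: sum_nonneg algebra_simps)
  finally show ?case .
qed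

lemma sum_power_le: "0 \<le> l \<Longrightarrow> l < 1 \<Longrightarrow> (\<Sum>i<n. l ^ i) \<le> 1 / (1 - l :: real)"
  by (subst sum_gp_strict) (auto simp: divide_right_mono)

lemma regular_1_0: "regular 1 0 I"
  by (simp add: regular_def)

lemma sup_bound_1_0: "I \<subseteq> J \<Longrightarrow> sup_bound 2 1 0 I"
proof -
  assume I: "I \<subseteq> J"
  have "ennreal (1 + \<bar>x\<bar>) \<le> ennreal 2" if "x \<in> I" for x
    using that abs_less_1[of x] I by (intro ennreal_leI) auto
  then show ?thesis by (simp add: sup_bound_def)
qed

lemma dens_1_0: "S \<in> sets borel \<Longrightarrow> dens 1 0 S = emeasure lborel S"
  by (simp add: dens_def)

lemma upper_bound:
  obtains B :: real where "0 < B"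
    "\<And>n E. E \<in> sets borel \<Longrightarrow> E \<subseteq> J \<Longrightarrow> emeasure lborel (J \<inter> (T ^^ n) -` E) \<le> ennreal B * emeasure lborel E"
proof -
  obtain l where ly: "lasota_yorke l"
    by (rule lasota_yorke_exists)
  note l = lasota_yorke_bounds[OF ly]
  show ?thesis
  \<comment> \<open>Lebesgue measure on \<open>J\<close> has \<open>q = 1\<close>,
    \<open>r = 0\<close>, mass \<open>1\<close> and sup bound \<open>2\<close>; the second summand
    is \<open>18\<close> times the geometric series.\<close>
  proof (rule that[of "2 + 18 * (1 / (1 - l))"])
    show "0 < 2 + 18 * (1 / (1 - l))" using l by (intro add_pos_nonneg) auto
    fix n and E :: "real set" assume E: "E \<in> sets borel" "E \<subseteq> J"
    note [measurable] = E(1)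
    have "emeasure lborel (J \<inter> (T ^^ n) -` E) = dens 1 0 (J \<inter> (T ^^ n) -` E)"
      by (simp add: dens_1_0)
    also have "\<dots> \<le> (ennreal (l ^ n) * 2 + ennreal (18 * (\<Sum>i<n. l ^ i)) * dens 1 0 J) * emeasure lborel E"
      by (rule upper_bound_aux[OF ly E]) (auto simp: is_interval_J regular_1_0 sup_bound_1_0)
    also have "\<dots> = ennreal (l ^ n * 2 + 18 * (\<Sum>i<n. l ^ i)) * emeasure lborel E"
      using l by (simp add: dens_1_0 emeasure_J ennreal_plus ennreal_mult sum_nonneg)
    also have "\<dots> \<le> ennreal (2 + 18 * (1 / (1 - l))) * emeasure lborel E"
    proof (intro mult_right_mono ennreal_leI add_mono)
      show "l ^ n * 2 \<le> 2" using l by (simp add: power_le_one)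
      show "18 * (\<Sum>i<n. l ^ i) \<le> 18 * (1 / (1 - l))"
        by (intro mult_left_mono sum_power_le l) auto
    qed auto
    finally show "emeasure lborel (J \<inter> (T ^^ n) -` E) \<le> ennreal (2 + 18 * (1 / (1 - l))) * emeasure lborel E" .
  qed
qed

section \<open>Images of intervals\<close>

text \<open>A quantitative form of \<open>J \<subseteq> T^n I\<close>: the image under
  \<open>T^n\<close> of Lebesgue measure on \<open>I\<close> is at least \<open>c\<close> times
  Lebesgue measure on \<open>J\<close>. It has to measure the preimages of arbitrarily small
  \<open>E\<close>, for which the inclusion alone gives no bound.\<close>

definition covers :: "nat \<Rightarrow> real \<Rightarrow> real set \<Rightarrow> bool" where
  "covers n c I \<longleftrightarrow> (\<forall>E\<in>sets borel. E \<subseteq> J \<longrightarrow>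
    ennreal c * emeasure lborel E \<le> emeasure lborel (I \<inter> (T ^^ n) -` E))"

lemma coversD: "covers n c I \<Longrightarrow> E \<in> sets borel \<Longrightarrow> E \<subseteq> J \<Longrightarrow>
    ennreal c * emeasure lborel E \<le> emeasure lborel (I \<inter> (T ^^ n) -` E)"
  by (simp add: covers_def)

lemma covers_mono:
  assumes c: "covers n c I" and "I \<subseteq> I'" "c' \<le> c" and [measurable]: "I' \<in> sets borel"
  shows "covers n c' I'"
  unfolding covers_def
proof (intro ballI impI)
  fix E :: "real set" assume [measurable]: "E \<in> sets borel" and E: "E \<subseteq> J"
  have "ennreal c' * emeasure lborel E \<le> ennreal c * emeasure lborel E"
    using assms(3) by (intro mult_right_mono ennreal_leI) auto
  also have "\<dots> \<le> emeasure lborel (I \<inter> (T ^^ n) -` E)"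
    by (rule coversD[OF c]) (use E in auto)
  also have "\<dots> \<le> emeasure lborel (I' \<inter> (T ^^ n) -` E)"
    using assms(2) by (intro emeasure_mono) auto
  finally show "ennreal c' * emeasure lborel E \<le> emeasure lborel (I' \<inter> (T ^^ n) -` E)" .
qed

lemma covers_J_0: "covers 0 1 J"
  by (simp add: covers_def Int_absorb1)

text \<open>The branch of \<open>d\<close> has slope of modulus \<open>1 / (d + y)^2\<close>, which
  is at least \<open>1 / (|d| + 1)^2\<close> on \<open>J\<close>. So a covering passes from a piece
  back to the interval, one step later.\<close>

lemma covers_pull:
  assumes c: "covers n c (pull d I)" and d: "d \<noteq> 0" and I: "I \<subseteq> J" and [measurable]: "I \<in> sets borel"
    and "0 \<le> c"
  shows "covers (Suc n) (c / (\<bar>of_int d\<bar> + 1)\<^sup>2) I"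
  unfolding covers_def
proof (intro ballI impI)
  fix E :: "real set" assume [measurable]: "E \<in> sets borel" and E: "E \<subseteq> J"
  let ?k = "1 / (\<bar>of_int d\<bar> + 1)\<^sup>2 :: real"
  let ?S = "pull d I \<inter> (T ^^ n) -` E"
  have "ennreal (c / (\<bar>of_int d\<bar> + 1)\<^sup>2) * emeasure lborel E = ennreal ?k * (ennreal c * emeasure lborel E)"
    using \<open>0 \<le> c\<close> by (subst mult.assoc[symmetric], subst ennreal_mult[symmetric]) auto
  also have "\<dots> \<le> ennreal ?k * emeasure lborel ?S"
    by (intro mult_left_mono coversD[OF c]) (use E in auto)
  also have "\<dots> \<le> ennreal 1 * dens (of_int d) 1 ?S"
  proof (rule dens_mono_density')
    fix y assume "y \<in> ?S"
    then have y: "y \<in> J" by (auto simp: pull_def)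
    have "\<bar>of_int d + y\<bar> \<le> \<bar>of_int d\<bar> + 1"
      using abs_less_1[OF y] by linarith
    then have "\<bar>of_int d + y\<bar>\<^sup>2 \<le> (\<bar>of_int d\<bar> + 1)\<^sup>2"
      by (intro power_mono) auto
    then show "?k \<le> 1 * (1 / (of_int d + 1 * y)\<^sup>2)"
      using digit_add_nonzero[OF d y] by (simp add: frac_le)
  qed auto
  also have "\<dots> = dens (1 * of_int d + 0) 1 (pull d I \<inter> (T ^^ n) -` E)" by simp
  also have "\<dots> = dens 1 0 (I \<inter> cyl d \<inter> T -` ((T ^^ n) -` E))"
    by (subst dens_branch) (use d I in auto)
  also have "\<dots> = emeasure lborel (I \<inter> cyl d \<inter> (T ^^ Suc n) -` E)"
    unfolding funpow_vimage[symmetric] by (rule dens_1_0) measurable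
  also have "\<dots> \<le> emeasure lborel (I \<inter> (T ^^ Suc n) -` E)"
    by (intro emeasure_mono) auto
  finally show "ennreal (c / (\<bar>of_int d\<bar> + 1)\<^sup>2) * emeasure lborel E \<le>
      emeasure lborel (I \<inter> (T ^^ Suc n) -` E)" .
qed

lemma covers_J_1: obtains c where "0 < c" "covers 1 c J"
proof -
  \<comment> \<open>The digit is so large that its whole branch, \<open>1 / (d + y)\<close> for
    \<open>y\<close> in \<open>J\<close>, is positive and below \<open>1 - a\<close>, hence in
    \<open>J\<close>.\<close>
  define d where "d = \<lceil>1 / (1 - a)\<rceil> + 2"
  have d: "of_int d > 1 / (1 - a) + 1"
    unfolding d_def by linarith
  have p: "0 < 1 / (1 - a)"
    using shift_less_1 by simp
  then have "0 < real_of_int d" using d by linarith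
  then have d0: "d \<noteq> 0" by simp
  have "1 / (of_int d + y) \<in> J" if y: "y \<in> J" for y
  proof -
    have g: "1 / (1 - a) < of_int d + y" using d abs_less_1[OF y] by linarith
    then have "1 < (of_int d + y) * (1 - a)" using shift_less_1 by (simp add: pos_divide_less_eq)
    moreover have "0 < of_int d + y" using g p by linarith
    ultimately have "1 / (of_int d + y) < 1 - a" by (simp add: pos_divide_less_eq mult.commute)
    moreover have "- a \<le> 1 / (of_int d + y)"
      using \<open>0 < of_int d + y\<close> shift_nonneg by (smt (verit) zero_le_divide_1_iff)
    ultimately show ?thesis by (simp add: mem_J)
  qed
  then have "pull d J = J" by (auto simp: pull_def)
  then have "covers (Suc 0) (1 / (\<bar>of_int d\<bar> + 1)\<^sup>2) J"
    using covers_J_0 d0 by (intro covers_pull) auto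
  then show ?thesis
    using that[of "1 / (\<bar>of_int d\<bar> + 1)\<^sup>2"] by simp
qed

text \<open>Since \<open>J\<close> covers itself in one step, a covering persists at all later
  times. This gives finitely many intervals a common time.\<close>

lemma covers_later:
  assumes c: "covers n c I" "0 < c" and "n \<le> m" and [measurable]: "I \<in> sets borel"
  obtains c' where "0 < c'" "covers m c' I"
proof -
  obtain k where k: "0 < k" "covers 1 k J"
    using covers_J_1 .
  have "\<exists>c'>0. covers m c' I"
    using \<open>n \<le> m\<close>
  proof (induction m rule: dec_induct)
    case base
    then show ?case using c by blast
  next
    case (step m)
    then obtain c' where c': "0 < c'" "covers m c' I" by blast
    have "covers (Suc m) (c' * k) I"
      unfolding covers_def
    proof (intro ballI impI)
      fix E :: "real set" assume E[measurable]: "E \<in> sets borel" and EJ: "E \<subseteq> J"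
      have [measurable]: "T -` E \<in> sets borel"
        using borel_vimage[OF E, of 1] by simp
      have "ennreal (c' * k) * emeasure lborel E = ennreal c' * (ennreal k * emeasure lborel E)"
        using c' k by (simp add: ennreal_mult mult.assoc)
      also have "\<dots> \<le> ennreal c' * emeasure lborel (J \<inter> T -` E)"
        using coversD[OF k(2) E EJ] by (intro mult_left_mono) auto
      also have "\<dots> \<le> emeasure lborel (I \<inter> (T ^^ m) -` (J \<inter> T -` E))"
        by (rule coversD[OF c'(2)]) auto
      also have "\<dots> \<le> emeasure lborel (I \<inter> (T ^^ Suc m) -` E)"
        by (intro emeasure_mono) auto
      finally show "ennreal (c' * k) * emeasure lborel E \<le> emeasure lborel (I \<inter> (T ^^ Suc m) -` E)" .
    qed
    then show ?case using c' k by (intro exI[of _ "c' * k"]) auto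
  qed
  then show ?thesis using that by blast
qed

section \<open>Growth of intervals in the metric dx / (1 + |x|)\<close>

definition log_length :: "real set \<Rightarrow> ennreal" where
  "log_length S = (\<integral>\<^sup>+x. ennreal (1 / (1 + \<bar>x\<bar>)) * indicator S x \<partial>lborel)"

lemma log_length_cyl_le:
  assumes d: "d \<noteq> 0" and I: "I \<subseteq> J" and [measurable]: "I \<in> sets borel" and w: "0 \<le> w"
    and W: "\<And>x. x \<in> J \<Longrightarrow> x \<noteq> 0 \<Longrightarrow> digit x = d \<Longrightarrow> \<bar>x\<bar> / (1 + \<bar>x\<bar>) \<le> w"
  shows "log_length (I \<inter> cyl d) \<le> ennreal w * log_length (pull d I)"
proof -
  have "log_length (I \<inter> cyl d) = (\<integral>\<^sup>+y. ennreal (1 / (1 + \<bar>1 / (of_int d + y)\<bar>)) * indicator (I \<inter> cyl d) (1 / (of_int d + y)) *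
      ennreal (1 / (of_int d + y)\<^sup>2) * indicator J y \<partial>lborel)"
    unfolding log_length_def by (rule nn_integral_cyl) (use d in auto)
  also have "\<dots> \<le> (\<integral>\<^sup>+y. ennreal w * (ennreal (1 / (1 + \<bar>y\<bar>)) * indicator (pull d I) y) \<partial>lborel)"
  proof (rule nn_integral_mono)
    fix y :: real
    let ?x = "1 / (of_int d + y)"
    show "ennreal (1 / (1 + \<bar>?x\<bar>)) * indicator (I \<inter> cyl d) ?x * ennreal (1 / (of_int d + y)\<^sup>2) * indicator J y
      \<le> ennreal w * (ennreal (1 / (1 + \<bar>y\<bar>)) * indicator (pull d I) y)"
    proof (cases "y \<in> J \<and> ?x \<in> I")
      case True
      then have p: "y \<in> pull d I" by (simp add: pull_def)
      obtain x where x: "x \<in> J" "x \<noteq> 0" "x = ?x" "digit x = d" "\<bar>x\<bar> * (1 + \<bar>y\<bar>) \<le> 1"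
        using pullE[OF p I d] by metis
      have "x\<^sup>2 * (1 + \<bar>y\<bar>) \<le> w * (1 + \<bar>x\<bar>)"
        by (intro weight_le W x)
      then have "1 / (1 + \<bar>x\<bar>) * x\<^sup>2 \<le> w * (1 / (1 + \<bar>y\<bar>))"
        by (simp add: field_simps)
      moreover have "x\<^sup>2 = 1 / (of_int d + y)\<^sup>2"
        unfolding x(3) by (simp add: power_divide)
      ultimately have "ennreal (1 / (1 + \<bar>?x\<bar>)) * ennreal (1 / (of_int d + y)\<^sup>2) \<le> ennreal w * ennreal (1 / (1 + \<bar>y\<bar>))"
        using w x(3) by (subst (1 2) ennreal_mult[symmetric]) (auto intro!: ennreal_leI simp: mult.commute)
      then show ?thesis using True p by (auto simp: indicator_def)
    qed (auto simp: indicator_def)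
  qed
  also have "\<dots> = ennreal w * log_length (pull d I)"
    unfolding log_length_def by (subst nn_integral_cmult) auto
  finally show ?thesis .
qed

lemma log_length_split:
  assumes I: "I \<subseteq> J" and [measurable]: "I \<in> sets borel"
  shows "log_length I = (\<integral>\<^sup>+d. log_length (I \<inter> cyl d) \<partial>count_space (- {0}))"
proof -
  let ?M = "density lborel (\<lambda>x. ennreal (1 / (1 + \<bar>x\<bar>)))"
  have e: "log_length S = emeasure ?M S" if "S \<in> sets borel" for S
    using that by (simp add: log_length_def emeasure_density)
  have "log_length I = log_length (\<Union>d\<in>- {0}. I \<inter> cyl d)"
    unfolding log_length_def
  proof (rule nn_integral_cong_AE)
    have "AE x in lborel. x \<noteq> (0::real)"
      by (rule AE_lborel_singleton)
    then show "AE x in lborel. ennreal (1 / (1 + \<bar>x\<bar>)) * indicator I x =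
        ennreal (1 / (1 + \<bar>x\<bar>)) * indicator (\<Union>d\<in>- {0}. I \<inter> cyl d) x"
    proof eventually_elim
      case (elim x)
      then have "x \<in> I \<longleftrightarrow> x \<in> (\<Union>d\<in>- {0}. I \<inter> cyl d)"
        using I digit_nonzero[of x] by (auto simp: cyl_def)
      then show ?case by (simp add: indicator_def)
    qed
  qed
  also have "\<dots> = emeasure ?M (\<Union>d\<in>- {0}. I \<inter> cyl d)"
    by (rule e) (intro sets.countable_UN', auto)
  also have "\<dots> = (\<integral>\<^sup>+d. emeasure ?M (I \<inter> cyl d) \<partial>count_space (- {0}))"
    by (rule emeasure_UN_countable) (auto simp: disjoint_family_on_def cyl_def)
  also have "\<dots> = (\<integral>\<^sup>+d. log_length (I \<inter> cyl d) \<partial>count_space (- {0}))"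
    by (intro nn_integral_cong e[symmetric]) auto
  finally show ?thesis .
qed

lemma log_length_le_1: assumes "I \<subseteq> J" "I \<in> sets borel" shows "log_length I \<le> 1"
proof -
  have [measurable]: "I \<in> sets borel" by fact
  have "log_length I \<le> (\<integral>\<^sup>+x. indicator I x \<partial>lborel)"
    unfolding log_length_def by (intro nn_integral_mono) (auto simp: indicator_def)
  then show ?thesis using emeasure_le_1[OF assms(1)] by simp
qed

lemma log_length_eq_0: assumes "log_length I = 0" "I \<in> sets borel" shows "emeasure lborel I = 0"
proof -
  have [measurable]: "I \<in> sets borel" by fact
  have "AE x in lborel. ennreal (1 / (1 + \<bar>x\<bar>)) * indicator I x = 0"
    using assms(1) unfolding log_length_def by (subst (asm) nn_integral_0_iff_AE) auto
  then have "AE x in lborel. x \<notin> I"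
    by eventually_elim (auto simp: indicator_def ennreal_eq_0_iff divide_le_0_iff split: if_splits)
  then show ?thesis
    by (subst (asm) AE_iff_null_sets[symmetric]) (auto simp: null_sets_def)
qed

text \<open>
  If no image of \<open>I\<close> covered \<open>J\<close>, then \<open>I\<close> would only have partial pieces, and one of them would
  have a longer image. Hence the supremum of the lengths of such intervals is \<open>0\<close>.
\<close>

lemma interval_covers:
  assumes I0: "is_interval I0" "I0 \<subseteq> J" "I0 \<in> sets borel" "emeasure lborel I0 \<noteq> 0"
  obtains n c where "0 < c" "covers n c I0"
proof (rule ccontr)
  assume "\<not> thesis"
  then have bad0: "\<not> (\<exists>n c. 0 < c \<and> covers n c I0)" using that by blast
  obtain W :: "int \<Rightarrow> real" and l where l: "0 \<le> l" "l < 1"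
    and W: "\<And>d. 0 \<le> W d" "\<And>d. W d \<le> l" "\<And>d e. d \<noteq> e \<Longrightarrow> W d + W e \<le> l"
      "\<And>x. x \<in> J \<Longrightarrow> x \<noteq> 0 \<Longrightarrow> \<bar>x\<bar> / (1 + \<bar>x\<bar>) \<le> W (digit x)"
    using piece_weights by metis
  define BAD where "BAD = {I. is_interval I \<and> I \<subseteq> J \<and> I \<in> sets borel \<and> \<not> (\<exists>n c. 0 < c \<and> covers n c I)}"
  define M where "M = (SUP I\<in>BAD. log_length I)"
  have "log_length I \<le> ennreal l * M" if "I \<in> BAD" for I
  proof -
    have I: "is_interval I" "I \<subseteq> J" and [measurable]: "I \<in> sets borel" and bad: "\<not> (\<exists>n c. 0 < c \<and> covers n c I)"
      using that by (auto simp: BAD_def)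
    \<comment> \<open>By \<open>covers_pull\<close>, a covering by a piece would give one by
      \<open>I\<close>.\<close>
    have pullbad: "pull d I \<in> BAD" if d: "d \<noteq> 0" for d
    proof -
      have "\<not> (0 < c \<and> covers n c (pull d I))" for n c
      proof
        assume *: "0 < c \<and> covers n c (pull d I)"
        then have "covers (Suc n) (c / (\<bar>of_int d\<bar> + 1)\<^sup>2) I"
          using d I by (intro covers_pull) auto
        moreover have "0 < c / (\<bar>of_int d\<bar> + 1)\<^sup>2"
        proof -
          have "0 < (\<bar>of_int d\<bar> + 1 :: real)" by linarith
          then show ?thesis using * by simp
        qed
        ultimately show False using bad by blast
      qed
      then show ?thesis
        using is_interval_pull[OF I(1) d] pull_subset by (auto simp: BAD_def)
    qed
    have "log_length I = (\<integral>\<^sup>+d. log_length (I \<inter> cyl d) \<partial>count_space (- {0}))"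
      by (rule log_length_split) (use I in auto)
    also have "\<dots> \<le> (\<integral>\<^sup>+d. ennreal (W d) * M * indicator (partial_digits I) d \<partial>count_space (- {0}))"
    proof (rule nn_integral_mono, simp)
      fix d :: int assume d: "d \<noteq> 0"
      have le: "log_length (I \<inter> cyl d) \<le> ennreal (W d) * log_length (pull d I)"
        by (rule log_length_cyl_le) (use d I W in auto)
      show "log_length (I \<inter> cyl d) \<le> ennreal (W d) * M * indicator (partial_digits I) d"
      proof (cases "d \<in> partial_digits I")
        case True
        have "log_length (pull d I) \<le> M"
          unfolding M_def by (rule SUP_upper) (rule pullbad[OF d])
        then have "ennreal (W d) * log_length (pull d I) \<le> ennreal (W d) * M"
          by (rule mult_left_mono) simp
        then show ?thesis using le True by simp
      next
        case False
        \<comment> \<open>A full piece would be \<open>J\<close>, which covers itself at time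
          \<open>0\<close>. So the pieces of a bad interval are incomplete or empty.\<close>
        have "pull d I \<noteq> J"
          using pullbad[OF d] covers_J_0 by (auto simp: BAD_def)
        then have "pull d I = {}" using False d by (auto simp: partial_digits_def)
        then show ?thesis using le by (simp add: log_length_def)
      qed
    qed
    also have "\<dots> \<le> ennreal l * M"
      by (rule partial_sum[OF I(1) W(1-3)])
    finally show ?thesis .
  qed
  then have Ml: "M \<le> ennreal l * M"
    unfolding M_def by (intro SUP_least) auto
  \<comment> \<open>Finiteness is what lets \<open>M \<le> l M\<close> with \<open>l < 1\<close>
    force \<open>M = 0\<close>.\<close>
  have "M \<le> 1"
    unfolding M_def by (intro SUP_least) (auto simp: BAD_def intro: log_length_le_1)
  then obtain m where m: "M = ennreal m" "0 \<le> m"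
    by (cases M) (auto simp: top_unique)
  have "m \<le> l * m"
    using Ml l m by (simp add: ennreal_mult[symmetric])
  then have "m * (1 - l) \<le> 0" by (simp add: algebra_simps)
  then have "m = 0"
    using l m(2) by (simp add: mult_le_0_iff)
  moreover have "log_length I0 \<le> M"
    unfolding M_def by (rule SUP_upper) (use I0 bad0 in \<open>auto simp: BAD_def\<close>)
  ultimately have "log_length I0 = 0" using m by simp
  then show False using log_length_eq_0 I0 by blast
qed

text \<open>A grid of cells of length \<open>1 / m\<close> makes the covering uniform: every
  interval of length at least \<open>\<delta>\<close> contains a cell, and finitely many cells admit
  a largest time and a smallest constant.\<close>

lemma long_intervals_cover:
  assumes "0 < \<delta>"
  obtains N c where "0 < c"
    "\<And>I. is_interval I \<Longrightarrow> I \<subseteq> J \<Longrightarrow> I \<in> sets borel \<Longrightarrow> ennreal \<delta> \<le> emeasure lborel I \<Longrightarrow> covers N c I"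
proof -
  \<comment> \<open>Two cell lengths are then at most \<open>\<delta> / 3\<close>. Below,
    \<open>I\<close> has points \<open>u < v\<close> further apart than \<open>\<delta> / 3\<close>,
    and the first complete cell to the right of \<open>u\<close> ends within \<open>2 / m\<close> of
    \<open>u\<close>.\<close>
  obtain m :: nat where m: "6 / \<delta> < real m" using reals_Archimedean2 by blast
  then have m0: "0 < real m" using assms by (smt (verit) divide_nonneg_pos)
  have m\<delta>: "2 / real m \<le> \<delta> / 3" using m m0 assms by (simp add: field_simps)
  define G where "G k = {- a + real k / real m..<- a + (real k + 1) / real m}" for k :: nat
  have G: "\<exists>n c. 0 < c \<and> covers n c (G k)" if "k < m" for k
  proof -
    have "G k \<subseteq> J"
    proof
      fix x assume "x \<in> G k"
      then have "- a + real k / real m \<le> x" "x < - a + (real k + 1) / real m"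
        by (auto simp: G_def)
      moreover have "0 \<le> real k / real m" by simp
      moreover have "(real k + 1) / real m \<le> 1" using that m0 by (simp add: field_simps)
      ultimately show "x \<in> J" unfolding mem_J by linarith
    qed
    moreover have "emeasure lborel (G k) \<noteq> 0"
      using m0 by (simp add: G_def divide_right_mono field_simps)
    moreover have "is_interval (G k)" by (auto simp: G_def is_interval_1)
    moreover have "G k \<in> sets borel" by (simp add: G_def)
    ultimately show ?thesis using interval_covers[of "G k"] by blast
  qed
  then obtain n c where nc: "\<And>k. k < m \<Longrightarrow> 0 < c k \<and> covers (n k) (c k) (G k)" by metis
  define N where "N = Max (n ` {..<m})"
  have "\<exists>c'. 0 < c' \<and> covers N c' (G k)" if "k < m" for k
  proof -
    have "n k \<le> N" unfolding N_def using that by (intro Max_ge) auto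
    then show ?thesis using covers_later[of "n k" "c k" "G k" N] nc[OF that] by (auto simp: G_def)
  qed
  then obtain c' where c': "\<And>k. k < m \<Longrightarrow> 0 < c' k \<and> covers N (c' k) (G k)" by metis
  define C where "C = Min (c' ` {..<m})"
  have mpos: "0 < m" using m0 by simp
  show ?thesis
  proof (rule that)
    show "0 < C" unfolding C_def using c' mpos by (subst Min_gr_iff) auto
    fix I assume I: "is_interval I" "I \<subseteq> J" and [measurable]: "I \<in> sets borel" and len: "ennreal \<delta> \<le> emeasure lborel I"
    have "I \<noteq> {}" using len assms by auto
    then obtain p where p: "p \<in> I" by blast
    \<comment> \<open>Otherwise \<open>I\<close> would lie in an interval of length
      \<open>2 \<delta> / 3\<close> about \<open>p\<close>.\<close>
    obtain q where q: "q \<in> I" "\<delta> / 3 < \<bar>q - p\<bar>"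
    proof (rule ccontr)
      assume "\<not> thesis"
      then have close: "\<And>q. q \<in> I \<Longrightarrow> \<bar>q - p\<bar> \<le> \<delta> / 3" using that by force
      have "p - \<delta> / 3 \<le> x \<and> x \<le> p + \<delta> / 3" if "x \<in> I" for x
        using close[OF that] by linarith
      then have "I \<subseteq> {p - \<delta> / 3..p + \<delta> / 3}" by auto
      then have "emeasure lborel I \<le> emeasure lborel {p - \<delta> / 3..p + \<delta> / 3}"
        by (intro emeasure_mono) auto
      also have "\<dots> = ennreal (2 * \<delta> / 3)" using assms by simp
      finally have "ennreal \<delta> \<le> ennreal (2 * \<delta> / 3)" using len by (rule order_trans[rotated])
      then show False using assms by (simp add: ennreal_le_iff2)
    qed
    obtain u v where uv: "u \<in> I" "v \<in> I" "\<delta> / 3 < v - u"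
    proof (cases "p < q")
      case True
      then show ?thesis using that[of p q] p q by simp
    next
      case False
      then show ?thesis using that[of q p] p q by simp
    qed
    have uJ: "- a \<le> u" "v < 1 - a" using uv I(2) by (auto simp: mem_J)
    define k where "k = nat \<lceil>(u + a) * real m\<rceil>"
    have nn: "0 \<le> (u + a) * real m" using uJ by simp
    have k: "(u + a) * real m \<le> real k" "real k < (u + a) * real m + 1"
      unfolding k_def using nn by linarith+
    have k1: "u + a \<le> real k / real m" using k(1) m0 by (simp add: field_simps)
    have "(real k + 1) / real m < ((u + a) * real m + 2) / real m"
      using k(2) m0 by (intro divide_strict_right_mono) auto
    then have "(real k + 1) / real m < u + a + 2 / real m"
      using m0 by (simp add: add_divide_distrib)
    then have k2: "(real k + 1) / real m < v + a" using m\<delta> uv(3) by linarith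
    then have "(real k + 1) / real m < 1" using uJ by linarith
    then have "real k + 1 < real m" using m0 by simp
    then have km: "k < m" by linarith
    have GI: "G k \<subseteq> I"
    proof
      fix x assume "x \<in> G k"
      then have "u \<le> x" "x \<le> v" using k1 k2 by (auto simp: G_def)
      then show "x \<in> I" using mem_is_interval_1[OF I(1) uv(1,2)] by blast
    qed
    have "C \<le> c' k" unfolding C_def using km by (intro Min_le) auto
    then show "covers N C I"
      by (rule covers_mono[OF conjunct2[OF c'[OF km]] GI]) measurable
  qed
qed

text \<open>At \<open>n = 0\<close> an interval of length at least \<open>\<delta>\<close> satisfies
  the bound by \<open>long\<close>; a shorter one has mass at most \<open>\<delta> s\<close>, which
  is conceded as an error. The step propagates this error by the recursion for \<open>s\<close>
  known from the upper bound. The error is added on the right instead of being subtracted on the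
  left because subtraction truncates in \<open>ennreal\<close>.\<close>

lemma lower_bound_aux:
  assumes ly: "lasota_yorke l"
    and long: "\<And>I. is_interval I \<Longrightarrow> I \<subseteq> J \<Longrightarrow> I \<in> sets borel \<Longrightarrow> ennreal \<delta> \<le> emeasure lborel I \<Longrightarrow> covers N c I"
    and c: "0 < c" and \<delta>: "0 < \<delta>"
    and E: "E \<in> sets borel" "E \<subseteq> J"
    and I: "I \<subseteq> J" "is_interval I" "I \<in> sets borel" "regular q r I" "sup_bound s q r I"
  shows "ennreal (c / 81) * dens q r I * emeasure lborel E \<le> dens q r (I \<inter> (T ^^ (N + n)) -` E) +
    ennreal (c / 81) * (ennreal (\<delta> * l ^ n) * s + ennreal (18 * \<delta> * (\<Sum>i<n. l ^ i)) * dens q r I) * emeasure lborel E"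
  using I
proof (induction n arbitrary: I q r s)
  case 0
  note [measurable] = E(1) 0(3)
  show ?case
  proof (cases "ennreal \<delta> \<le> emeasure lborel I")
    case True
    then have "I \<noteq> {}" using \<delta> by auto
    then obtain y where y: "y \<in> I" by blast
    let ?f = "1 / (q + r * y)\<^sup>2"
    let ?X = "I \<inter> (T ^^ N) -` E"
    have cov: "ennreal c * emeasure lborel E \<le> emeasure lborel ?X"
      by (rule coversD[OF long]) (use 0 True E in auto)
    \<comment> \<open>\<open>81\<close> is \<open>9\<close> squared: the distortion enters once in
      comparing the mass of \<open>I\<close> with the value at \<open>y\<close>, and once in
      comparing that value with the density on \<open>?X\<close>.\<close>
    have "ennreal (c / 81) * dens q r I * emeasure lborel E \<le> ennreal (c / 81) * ennreal (9 * ?f) * emeasure lborel E"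
    proof (intro mult_right_mono mult_left_mono)
      have "ennreal 1 * dens q r I \<le> ennreal (9 * ?f) * emeasure lborel I"
        by (rule dens_mono_density) (use 0 y regular_distortion[of q r I _ y] in auto)
      also have "\<dots> \<le> ennreal (9 * ?f) * 1"
        using emeasure_le_1[OF 0(1)] by (intro mult_left_mono) auto
      finally show "dens q r I \<le> ennreal (9 * ?f)" by simp
    qed auto
    also have "\<dots> = ennreal (1 / 9 * ?f) * (ennreal c * emeasure lborel E)"
    proof -
      have "ennreal (c / 81) * ennreal (9 * ?f) = ennreal (1 / 9 * ?f) * ennreal c"
        using c by (subst (1 2) ennreal_mult[symmetric]) auto
      then show ?thesis by (simp only: mult.assoc[symmetric])
    qed
    also have "\<dots> \<le> ennreal (1 / 9 * ?f) * emeasure lborel ?X"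
      using cov by (intro mult_left_mono) auto
    also have "\<dots> \<le> ennreal 1 * dens q r ?X"
    proof (rule dens_mono_density')
      fix x assume "x \<in> ?X"
      then show "1 / 9 * ?f \<le> 1 * (1 / (q + r * x)\<^sup>2)"
        using regular_distortion[OF 0(4,1) y, of x] by simp
    qed auto
    finally show ?thesis by (simp add: add_increasing2)
  next
    case False
    have "dens q r I \<le> s * emeasure lborel I"
      by (rule sup_bound_imp_dens_le[OF 0(5,3) order_refl])
    also have "\<dots> \<le> s * ennreal \<delta>"
      using False by (intro mult_left_mono) auto
    finally have "ennreal (c / 81) * dens q r I * emeasure lborel E \<le>
        ennreal (c / 81) * (ennreal \<delta> * s) * emeasure lborel E"
      by (intro mult_left_mono mult_right_mono) (auto simp: mult.commute)
    then show ?thesis by (simp add: add_increasing)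
  qed
next
  case (Suc n)
  note [measurable] = E(1) Suc.prems(3)
  note l = lasota_yorke_bounds[OF ly]
  obtain t where t: "\<And>d. d \<noteq> 0 \<Longrightarrow> sup_bound (t d) (q * of_int d + r) q (pull d I)"
    and ts: "(\<integral>\<^sup>+d. t d \<partial>count_space (- {0})) \<le> 18 * dens q r I + ennreal l * s"
    using lasota_yorke_step[OF ly Suc.prems] by blast
  let ?c = "ennreal (c / 81)" and ?e = "emeasure lborel E"
  let ?b = "ennreal (18 * \<delta> * (\<Sum>i<n. l ^ i))" and ?D = "\<lambda>d. dens (q * of_int d + r) q (pull d I)"
  let ?X = "\<lambda>d. dens (q * of_int d + r) q (pull d I \<inter> (T ^^ (N + n)) -` E)"
  have Dsum: "(\<integral>\<^sup>+d. ?D d \<partial>count_space (- {0})) = dens q r I"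
    using dens_split[of I UNIV q r] Suc.prems(1) by simp
  have Xsum: "(\<integral>\<^sup>+d. ?X d \<partial>count_space (- {0})) = dens q r (I \<inter> (T ^^ (N + Suc n)) -` E)"
    unfolding add_Suc_right funpow_vimage by (rule dens_split[symmetric]) (use Suc.prems in auto)
  have "?c * dens q r I * ?e = (\<integral>\<^sup>+d. ?c * ?D d * ?e \<partial>count_space (- {0}))"
    by (simp add: nn_integral_multc nn_integral_cmult Dsum)
  also have "\<dots> \<le> (\<integral>\<^sup>+d. ?X d + ?c * (ennreal (\<delta> * l ^ n) * t d + ?b * ?D d) * ?e \<partial>count_space (- {0}))"
  proof (rule nn_integral_mono, simp)
    fix d :: int assume d: "d \<noteq> 0"
    show "?c * ?D d * ?e \<le> ?X d + ?c * (ennreal (\<delta> * l ^ n) * t d + ?b * ?D d) * ?e"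
      by (rule Suc.IH) (use pull_subset is_interval_pull[OF Suc.prems(2) d] regular_pull[OF Suc.prems(4,1) d] t[OF d] in auto)
  qed
  also have "\<dots> = dens q r (I \<inter> (T ^^ (N + Suc n)) -` E) +
      ?c * (ennreal (\<delta> * l ^ n) * (\<integral>\<^sup>+d. t d \<partial>count_space (- {0})) + ?b * dens q r I) * ?e"
    by (simp add: nn_integral_multc nn_integral_add nn_integral_cmult Dsum Xsum)
  also have "\<dots> \<le> dens q r (I \<inter> (T ^^ (N + Suc n)) -` E) +
      ?c * (ennreal (\<delta> * l ^ n) * (18 * dens q r I + ennreal l * s) + ?b * dens q r I) * ?e"
    using ts by (intro add_left_mono mult_right_mono mult_left_mono add_right_mono) auto
  also have "ennreal (\<delta> * l ^ n) * (18 * dens q r I + ennreal l * s) + ?b * dens q r I =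
      ennreal (\<delta> * l ^ Suc n) * s + (ennreal (18 * \<delta> * l ^ n) + ?b) * dens q r I"
  proof -
    have "ennreal (\<delta> * l ^ Suc n) = ennreal (\<delta> * l ^ n) * ennreal l"
      using l \<delta> by (subst ennreal_mult[symmetric]) (auto simp: mult_ac)
    moreover have "ennreal (18 * \<delta> * l ^ n) = ennreal (\<delta> * l ^ n) * 18"
    proof -
      have "ennreal (18 * \<delta> * l ^ n) = ennreal ((\<delta> * l ^ n) * 18)" by (simp add: mult_ac)
      then show ?thesis using l \<delta> by (simp add: ennreal_mult)
    qed
    ultimately show ?thesis by (simp add: algebra_simps)
  qed
  also have "ennreal (18 * \<delta> * l ^ n) + ?b = ennreal (18 * \<delta> * (\<Sum>i<Suc n. l ^ i))"
    using l \<delta> by (subst ennreal_plus[symmetric]) (auto simp: sum_nonneg algebra_simps)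
  finally show ?case .
qed

text \<open>The constant \<open>c\<close> does not depend on \<open>I\<close>; this uniformity gives exactness.\<close>

lemma lower_bound:
  obtains c :: real where "0 < c"
    "\<And>I. is_interval I \<Longrightarrow> I \<subseteq> J \<Longrightarrow> I \<in> sets borel \<Longrightarrow>
      \<exists>n0. \<forall>n\<ge>n0. \<forall>E\<in>sets borel. E \<subseteq> J \<longrightarrow>
        ennreal c * emeasure lborel I * emeasure lborel E \<le> emeasure lborel (I \<inter> (T ^^ n) -` E)"
proof -
  obtain l where ly: "lasota_yorke l"
    by (rule lasota_yorke_exists)
  note l = lasota_yorke_bounds[OF ly]
  \<comment> \<open>Chosen so that \<open>18 \<delta> / (1 - l) = 1/4\<close>: the part of the error
    proportional to the mass takes up a quarter of it. The other part is pushed below a quarter of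
    \<open>i\<close> by the choice of \<open>k\<close>, so that the time, but not the constant,
    depends on \<open>I\<close>.\<close>
  define \<delta> where "\<delta> = (1 - l) / 72"
  have \<delta>: "0 < \<delta>" using l by (simp add: \<delta>_def)
  obtain N c where c: "0 < c" and long:
    "\<And>I. is_interval I \<Longrightarrow> I \<subseteq> J \<Longrightarrow> I \<in> sets borel \<Longrightarrow> ennreal \<delta> \<le> emeasure lborel I \<Longrightarrow> covers N c I"
    using long_intervals_cover[OF \<delta>] by blast
  show ?thesis
  \<comment> \<open>Half of \<open>c / 81\<close>; the other half absorbs the error.\<close>
  proof (rule that[of "c / 162"])
    show "0 < c / 162" using c by simp
    fix I assume I: "is_interval I" "I \<subseteq> J" and Ib[measurable]: "I \<in> sets borel"
    obtain i where i: "emeasure lborel I = ennreal i" "0 \<le> i"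
      using emeasure_le_1[OF I(2)] by (cases "emeasure lborel I") (auto simp: top_unique)
    show "\<exists>n0. \<forall>n\<ge>n0. \<forall>E\<in>sets borel. E \<subseteq> J \<longrightarrow>
        ennreal (c / 162) * emeasure lborel I * emeasure lborel E \<le> emeasure lborel (I \<inter> (T ^^ n) -` E)"
    proof (cases "i = 0")
      case True
      then show ?thesis using i by simp
    next
      case False
      then have "0 < i / (8 * \<delta>)" using i \<delta> by simp
      then obtain k where k: "l ^ k < i / (8 * \<delta>)"
        using real_arch_pow_inv[OF _ l(2)] by blast
      show ?thesis
      proof (intro exI allI impI ballI)
        fix n and E :: "real set" assume n: "N + k \<le> n" and E: "E \<in> sets borel" "E \<subseteq> J"
        note [measurable] = E(1)
        define j where "j = n - N"
        have nj: "n = N + j" "k \<le> j" using n by (auto simp: j_def)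
        obtain e where e: "emeasure lborel E = ennreal e" "0 \<le> e"
          using emeasure_le_1[OF E(2)] by (cases "emeasure lborel E") (auto simp: top_unique)
        have "emeasure lborel (I \<inter> (T ^^ n) -` E) \<le> 1"
          using I by (intro emeasure_le_1) auto
        then obtain x where x: "emeasure lborel (I \<inter> (T ^^ n) -` E) = ennreal x" "0 \<le> x"
          by (cases "emeasure lborel (I \<inter> (T ^^ n) -` E)") (auto simp: top_unique)
        let ?S = "\<Sum>i<j. l ^ i"
        have S: "0 \<le> ?S" "?S \<le> 1 / (1 - l)" using l sum_power_le by (auto simp: sum_nonneg)
        have "ennreal (c / 81) * dens 1 0 I * emeasure lborel E \<le> dens 1 0 (I \<inter> (T ^^ (N + j)) -` E) +
          ennreal (c / 81) * (ennreal (\<delta> * l ^ j) * 2 + ennreal (18 * \<delta> * ?S) * dens 1 0 I) * emeasure lborel E"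
          by (rule lower_bound_aux[OF ly long c \<delta> E]) (use I regular_1_0 sup_bound_1_0 in auto)
        moreover have "ennreal (c / 81) * dens 1 0 I * emeasure lborel E = ennreal (c / 81 * i * e)"
        proof -
          have "ennreal (c / 81 * i * e) = ennreal (c / 81) * ennreal i * ennreal e"
            using c i(2) e(2) by (subst ennreal_mult, simp, simp, subst ennreal_mult, auto)
          then show ?thesis unfolding i(1)[symmetric] e(1)[symmetric] by (simp add: dens_1_0)
        qed
        moreover have "dens 1 0 (I \<inter> (T ^^ (N + j)) -` E) = ennreal x"
          using x nj by (simp add: dens_1_0)
        moreover have "ennreal (c / 81) * (ennreal (\<delta> * l ^ j) * 2 + ennreal (18 * \<delta> * ?S) * dens 1 0 I) * emeasure lborel E =
            ennreal (c / 81 * (\<delta> * l ^ j * 2 + 18 * \<delta> * ?S * i) * e)"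
        proof -
          have "ennreal (\<delta> * l ^ j * 2) = ennreal (\<delta> * l ^ j) * 2"
            using l \<delta> by (subst ennreal_mult) auto
          moreover have "ennreal (18 * \<delta> * ?S * i) = ennreal (18 * \<delta> * ?S) * dens 1 0 I"
            using l \<delta> S i by (subst ennreal_mult) (auto simp: dens_1_0)
          moreover have "ennreal (\<delta> * l ^ j * 2 + 18 * \<delta> * ?S * i) = ennreal (\<delta> * l ^ j * 2) + ennreal (18 * \<delta> * ?S * i)"
            using l \<delta> S i by (subst ennreal_plus) auto
          moreover have "ennreal (c / 81 * (\<delta> * l ^ j * 2 + 18 * \<delta> * ?S * i) * e) =
              ennreal (c / 81) * ennreal (\<delta> * l ^ j * 2 + 18 * \<delta> * ?S * i) * emeasure lborel E"
            unfolding e(1) using c l \<delta> S i(2) e(2) by (subst ennreal_mult, simp, simp, subst ennreal_mult, auto)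
          ultimately show ?thesis by simp
        qed
        ultimately have "c / 81 * i * e \<le> x + c / 81 * (\<delta> * l ^ j * 2 + 18 * \<delta> * ?S * i) * e"
          using x c i e \<delta> l S by (simp add: ennreal_plus[symmetric] del: ennreal_plus)
        moreover have "c / 81 * (\<delta> * l ^ j * 2 + 18 * \<delta> * ?S * i) * e \<le> c / 81 * (i / 2) * e"
        proof (intro mult_right_mono mult_left_mono)
          have "l ^ j \<le> l ^ k" using nj(2) l by (intro power_decreasing) auto
          then have "\<delta> * l ^ j * 2 \<le> \<delta> * (i / (8 * \<delta>)) * 2" using k \<delta> by (intro mult_right_mono mult_left_mono) auto
          also have "\<dots> = i / 4" using \<delta> by simp
          finally have "\<delta> * l ^ j * 2 \<le> i / 4" .
          moreover have "18 * \<delta> * ?S * i \<le> 18 * \<delta> * (1 / (1 - l)) * i"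
            using S \<delta> i by (intro mult_right_mono mult_left_mono) auto
          moreover have "18 * \<delta> * (1 / (1 - l)) * i = i / 4"
            using l by (simp add: \<delta>_def field_simps)
          ultimately show "\<delta> * l ^ j * 2 + 18 * \<delta> * ?S * i \<le> i / 2" by linarith
        qed (use c e in auto)
        ultimately have "c / 81 * i * e \<le> x + c / 81 * (i / 2) * e" by linarith
        then have "c / 162 * i * e \<le> x" by (simp add: field_simps)
        then have "ennreal (c / 162 * i * e) \<le> ennreal x" by (rule ennreal_leI)
        then show "ennreal (c / 162) * emeasure lborel I * emeasure lborel E \<le> emeasure lborel (I \<inter> (T ^^ n) -` E)"
        proof -
          have "ennreal (c / 162 * i * e) = ennreal (c / 162) * ennreal i * ennreal e"
            using c i(2) e(2) by (subst ennreal_mult, simp, simp, subst ennreal_mult, auto)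
          then show ?thesis
            using \<open>ennreal (c / 162 * i * e) \<le> ennreal x\<close> unfolding i(1) e(1) x(1) by simp
        qed
      qed
    qed
  qed
qed

end

section \<open>Criteria for invariant measures and exactness\<close>

text \<open>Tychonoff for a product of unit intervals, viewed as a set of functions.\<close>

lemma compact_Pi_unit: "compact {f :: 'a \<Rightarrow> real. \<forall>x. 0 \<le> f x \<and> f x \<le> 1}"
proof -
  have "compactin (product_topology (\<lambda>_. euclidean) UNIV) (PiE UNIV (\<lambda>_ :: 'a. {0..1 :: real}))"
    by (simp add: compactin_PiE)
  then have "compact (PiE UNIV (\<lambda>_ :: 'a. {0..1 :: real}))"
    by (simp add: euclidean_product_topology)
  moreover have "PiE UNIV (\<lambda>_ :: 'a. {0..1 :: real}) = {f. \<forall>x. 0 \<le> f x \<and> f x \<le> 1}"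
    by (auto simp: PiE_def)
  ultimately show ?thesis by simp
qed

text \<open>The index type may be uncountable, so compactness gives a cluster point but in general
  no convergent subsequence. Allowing every continuous \<open>h\<close> lets relations between
  finitely many coordinates pass to \<open>L\<close>, each equality as two inequalities.\<close>

lemma pointwise_cluster_point:
  fixes g :: "nat \<Rightarrow> 'a \<Rightarrow> real"
  assumes "\<And>n x. 0 \<le> g n x \<and> g n x \<le> 1"
  obtains L :: "'a \<Rightarrow> real" where
    "\<And>h e. continuous_on UNIV h \<Longrightarrow> eventually (\<lambda>n. h (g n) \<le> (e :: real)) sequentially \<Longrightarrow> h L \<le> e"
proof -
  have "\<exists>L\<in>{f :: 'a \<Rightarrow> real. \<forall>x. 0 \<le> f x \<and> f x \<le> 1}. inf (nhds L) (filtermap g sequentially) \<noteq> bot"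
    using compact_Pi_unit[unfolded compact_filter, THEN spec, of "filtermap g sequentially"] assms
    by (auto simp: eventually_filtermap filtermap_bot_iff)
  then obtain L where L: "inf (nhds L) (filtermap g sequentially) \<noteq> bot" by blast
  show ?thesis
  proof (rule that)
    fix h :: "('a \<Rightarrow> real) \<Rightarrow> real" and e
    assume h: "continuous_on UNIV h" and ev: "eventually (\<lambda>n. h (g n) \<le> e) sequentially"
    show "h L \<le> e"
    proof (rule ccontr)
      assume "\<not> h L \<le> e"
      then have "L \<in> {x. e < h x}" by simp
      moreover have "open {x. e < h x}"
        using h by (intro open_Collect_less continuous_intros)
      ultimately have "eventually (\<lambda>x. e < h x) (nhds L)"
        by (auto simp: eventually_nhds)
      moreover have "eventually (\<lambda>x. h x \<le> e) (filtermap g sequentially)"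
        using ev by (simp add: eventually_filtermap)
      ultimately have "eventually (\<lambda>x. False) (inf (nhds L) (filtermap g sequentially))"
        unfolding eventually_inf by (auto intro!: exI simp: not_less)
      then show False using L by (simp add: trivial_limit_def)
    qed
  qed
qed

lemma continuous_on_coordinate [continuous_intros]: "continuous_on UNIV (\<lambda>f :: 'a \<Rightarrow> real. f x)"
  by (rule continuous_on_product_coordinates)

lemma funpow_vimage_space:
  assumes "T \<in> measurable M M"
  shows "(T ^^ Suc n) -` A \<inter> space M = (T ^^ n) -` (T -` A \<inter> space M) \<inter> space M"
proof -
  have "(T ^^ n) x \<in> space M" if "x \<in> space M" for x
    using that by (induction n) (auto intro: measurable_space[OF assms])
  then show ?thesis by auto
qed

lemma funpow_measurable:
  assumes "T \<in> measurable M M"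
  shows "(T ^^ n) \<in> measurable M M"
  by (induction n) (auto simp: o_def intro: measurable_compose[OF _ assms])

text \<open>
  An invariant measure is a cluster point of the averages of the push-forwards, in the topology of
  setwise convergence. The upper bound makes it countably additive.
\<close>

lemma invariant_measure_exists:
  fixes M :: "'a measure"
  assumes fin: "finite_measure M" and m0: "measure M (space M) > 0" and T: "T \<in> measurable M M"
    and B: "0 < B" and upper: "\<And>n A. A \<in> sets M \<Longrightarrow> measure M ((T ^^ n) -` A \<inter> space M) \<le> B * measure M A"
    and lower: "\<And>n A. n0 \<le> n \<Longrightarrow> A \<in> sets M \<Longrightarrow> c * measure M A \<le> measure M ((T ^^ n) -` A \<inter> space M)"
    and c: "0 < c"
  obtains \<mu> where "prob_space \<mu>" "sets \<mu> = sets M" "invariant_measure \<mu> T"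
    "\<And>A. A \<in> sets M \<Longrightarrow> measure \<mu> A \<le> B / measure M (space M) * measure M A"
    "\<And>A. A \<in> sets M \<Longrightarrow> c / measure M (space M) * measure M A \<le> measure \<mu> A"
proof -
  interpret M: finite_measure M by fact
  define m where "m = measure M (space M)"
  have m: "0 < m" using m0 by (simp add: m_def)
  define p where "p k A = measure M ((T ^^ k) -` A \<inter> space M) / m" for k A
  \<comment> \<open>The value \<open>0\<close> on non-measurable sets keeps every \<open>g n\<close>
    a total function into \<open>[0, 1]\<close>.\<close>
  define g where "g n A = (if A \<in> sets M then (\<Sum>k<Suc n. p k A) / real (Suc n) else 0)" for n A
  have meas: "(T ^^ k) -` A \<inter> space M \<in> sets M" if "A \<in> sets M" for k A
    using measurable_sets[OF funpow_measurable[OF T] that] .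
  have p01: "0 \<le> p k A \<and> p k A \<le> 1" for k A
  proof -
    have "measure M ((T ^^ k) -` A \<inter> space M) \<le> m"
      unfolding m_def by (rule M.bounded_measure)
    then show ?thesis using m by (simp add: p_def)
  qed
  have g01: "0 \<le> g n A \<and> g n A \<le> 1" for n A
  proof -
    have "(\<Sum>k<Suc n. p k A) \<le> (\<Sum>k<Suc n. 1)" using p01 by (intro sum_mono) auto
    moreover have "0 \<le> (\<Sum>k<Suc n. p k A)" using p01 by (intro sum_nonneg) auto
    ultimately show ?thesis by (simp add: g_def divide_le_eq)
  qed
  obtain L :: "'a set \<Rightarrow> real" where
    L: "\<And>h e. continuous_on UNIV h \<Longrightarrow> eventually (\<lambda>n. h (g n) \<le> (e :: real)) sequentially \<Longrightarrow> h L \<le> e"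
    using pointwise_cluster_point[of g] g01 by blast
  have L0: "0 \<le> L A" for A
    using L[of "\<lambda>f. - f A" 0, OF continuous_on_minus[OF continuous_on_coordinate]] g01 by simp
  have Lup: "L A \<le> B / m * measure M A" if A: "A \<in> sets M" for A
  proof (rule L)
    have "p k A \<le> B / m * measure M A" for k
      using upper[OF A, of k] m by (simp add: p_def divide_right_mono)
    then have "(\<Sum>k<Suc n. p k A) \<le> (\<Sum>k<Suc n. B / m * measure M A)" for n
      by (intro sum_mono)
    then have "g n A \<le> B / m * measure M A" for n
      using A by (simp add: g_def divide_le_eq mult.commute)
    then show "eventually (\<lambda>n. g n A \<le> B / m * measure M A) sequentially" by simp
  qed (intro continuous_intros)
  have Llow: "c / m * measure M A \<le> L A" if A: "A \<in> sets M" for A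
  proof (rule field_le_epsilon)
    fix e :: real assume e: "0 < e"
    let ?q = "c / m * measure M A"
    have q: "0 \<le> ?q" using c m by simp
    \<comment> \<open>Only the first \<open>n0\<close> terms of an average can violate the lower
      bound. They cost at most \<open>n0 ?q\<close> in the sum, which is at most
      \<open>(n + 1) e\<close> from \<open>n = N\<close> on.\<close>
    obtain N :: nat where N: "real n0 * ?q / e \<le> real N" using real_arch_simple by blast
    have "?q - e \<le> g n A" if "N \<le> n" for n
    proof -
      have "p k A \<ge> ?q - (if k < n0 then ?q else 0)" for k
        using lower[OF _ A, of k] m p01[of k A] by (auto simp: p_def divide_right_mono)
      then have "(\<Sum>k<Suc n. ?q - (if k < n0 then ?q else 0)) \<le> (\<Sum>k<Suc n. p k A)"
        by (intro sum_mono)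
      moreover have "(\<Sum>k<Suc n. if k < n0 then ?q else 0) \<le> real n0 * ?q"
      proof -
        have "(\<Sum>k<Suc n. if k < n0 then ?q else 0) = (\<Sum>k\<in>{..<Suc n} \<inter> {..<n0}. ?q)"
          by (subst sum.inter_restrict) auto
        also have "\<dots> = real (card ({..<Suc n} \<inter> {..<n0})) * ?q"
          by (rule sum_constant)
        also have "\<dots> \<le> real n0 * ?q"
          by (rule mult_right_mono[OF _ q]) (use card_mono[of "{..<n0}" "{..<Suc n} \<inter> {..<n0}"] in simp)
        finally show ?thesis .
      qed
      ultimately have "real (Suc n) * ?q - real n0 * ?q \<le> (\<Sum>k<Suc n. p k A)"
        by (simp only: sum_subtractf) simp
      moreover have "real n0 * ?q \<le> real (Suc n) * e"
      proof -
        have "real n0 * ?q \<le> real N * e" using N pos_divide_le_eq[OF e] by blast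
        also have "\<dots> \<le> real (Suc n) * e" using that e by (intro mult_right_mono) auto
        finally show ?thesis .
      qed
      ultimately have "real (Suc n) * (?q - e) \<le> (\<Sum>k<Suc n. p k A)" by (simp add: algebra_simps)
      then show ?thesis using A by (simp add: g_def pos_le_divide_eq mult.commute)
    qed
    then have "eventually (\<lambda>n. - g n A \<le> e - ?q) sequentially"
      unfolding eventually_sequentially by (intro exI[of _ N]) force
    then have "- L A \<le> e - ?q"
      by (intro L[of "\<lambda>f. - f A"] continuous_intros)
    then show "?q \<le> L A + e" by simp
  qed
  have Ladd: "L (A \<union> A') = L A + L A'" if A: "A \<in> sets M" "A' \<in> sets M" "A \<inter> A' = {}" for A A'
  proof -
    have "p k (A \<union> A') = p k A + p k A'" for k
    proof -
      have "measure M ((T ^^ k) -` (A \<union> A') \<inter> space M) =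
          measure M (((T ^^ k) -` A \<inter> space M) \<union> ((T ^^ k) -` A' \<inter> space M))"
        by (rule arg_cong[where f = "measure M"]) auto
      also have "\<dots> = measure M ((T ^^ k) -` A \<inter> space M) + measure M ((T ^^ k) -` A' \<inter> space M)"
        using A by (intro M.finite_measure_Union meas) auto
      finally show ?thesis by (simp add: p_def add_divide_distrib)
    qed
    then have g: "g n (A \<union> A') = g n A + g n A'" for n
      using A by (simp add: g_def sum.distrib add_divide_distrib)
    have "L (A \<union> A') - L A - L A' \<le> 0"
      by (rule L[of "\<lambda>f. f (A \<union> A') - f A - f A'"]) (auto intro!: continuous_intros simp: g)
    moreover have "L A + L A' - L (A \<union> A') \<le> 0"
      by (rule L[of "\<lambda>f. f A + f A' - f (A \<union> A')"]) (auto intro!: continuous_intros simp: g)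
    ultimately show ?thesis by linarith
  qed
  have Linv: "L (T -` A \<inter> space M) = L A" if A: "A \<in> sets M" for A
  proof -
    let ?A = "T -` A \<inter> space M"
    have A': "?A \<in> sets M" using measurable_sets[OF T A] .
    have pS: "p k ?A = p (Suc k) A" for k
      unfolding p_def funpow_vimage_space[OF T] ..
    \<comment> \<open>The sums for \<open>A\<close> and for its preimage differ by a telescoping
      sum, so the averages differ by at most \<open>1 / (n + 1)\<close>.\<close>
    have diff: "g n ?A - g n A = (p (Suc n) A - p 0 A) / real (Suc n)" for n
    proof -
      have "(\<Sum>k<Suc n. p (Suc k) A) - (\<Sum>k<Suc n. p k A) = p (Suc n) A - p 0 A"
        unfolding sum_subtractf[symmetric] by (rule sum_lessThan_telescope)
      then show ?thesis
        using A A' by (simp only: g_def pS if_True diff_divide_distrib[symmetric])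
    qed
    have ab: "\<bar>g n ?A - g n A\<bar> \<le> 1 / real (Suc n)" for n
    proof -
      have "\<bar>p (Suc n) A - p 0 A\<bar> \<le> 1" using p01[of "Suc n" A] p01[of 0 A] by linarith
      then show ?thesis unfolding diff abs_divide by (simp add: divide_right_mono)
    qed
    have "\<bar>L ?A - L A\<bar> \<le> e" if e: "0 < e" for e
    proof (rule L[of "\<lambda>f. \<bar>f ?A - f A\<bar>"])
      have "eventually (\<lambda>n. 1 / real (Suc n) < e) sequentially"
        using LIMSEQ_inverse_real_of_nat e by (simp add: order_tendsto_iff inverse_eq_divide)
      then show "eventually (\<lambda>n. \<bar>g n ?A - g n A\<bar> \<le> e) sequentially"
        by eventually_elim (use ab in \<open>meson less_imp_le order_trans\<close>)
    qed (intro continuous_intros)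
    then have "\<bar>L ?A - L A\<bar> \<le> 0" by (rule field_le_epsilon[of _ 0, simplified])
    then show ?thesis by simp
  qed
  have Lspace: "L (space M) = 1"
  proof -
    have "p k (space M) = 1" for k
    proof -
      have "(T ^^ k) -` space M \<inter> space M = space M"
        using measurable_space[OF funpow_measurable[OF T]] by auto
      then show ?thesis using m by (simp add: p_def m_def)
    qed
    then have g1: "g n (space M) = 1" for n by (simp add: g_def)
    have "L (space M) \<le> 1" "- L (space M) \<le> - 1"
      by (rule L[of "\<lambda>f. f (space M)"] L[of "\<lambda>f. - f (space M)"]; auto intro!: continuous_intros simp: g1)+
    then show ?thesis by simp
  qed
  have Lempty: "L {} = 0" using Lup[of "{}"] L0[of "{}"] by simp
  define \<mu> where "\<mu> = measure_of (space M) (sets M) (\<lambda>A. ennreal (L A))"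
  have sets: "sets \<mu> = sets M" and space: "space \<mu> = space M"
    by (auto simp: \<mu>_def)
  have pos: "positive (sets M) (\<lambda>A. ennreal (L A))"
    by (simp add: positive_def Lempty)
  have "countably_additive (sets M) (\<lambda>A. ennreal (L A))"
  proof (rule sets.empty_continuous_imp_countably_additive[OF pos])
    show "additive (sets M) (\<lambda>A. ennreal (L A))"
      by (auto simp: additive_def Ladd L0)
    fix A :: "nat \<Rightarrow> 'a set" assume A: "range A \<subseteq> sets M" "decseq A" "(\<Inter>i. A i) = {}"
    have "(\<lambda>i. measure M (A i)) \<longlonglongrightarrow> measure M (\<Inter>i. A i)"
      by (rule M.finite_Lim_measure_decseq[OF A(1,2)])
    then have "(\<lambda>i. measure M (A i)) \<longlonglongrightarrow> 0" using A(3) by simp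
    then have lim: "(\<lambda>i. B / m * measure M (A i)) \<longlonglongrightarrow> 0"
      by (rule tendsto_mult_right_zero)
    have "(\<lambda>i. L (A i)) \<longlonglongrightarrow> 0"
      by (rule tendsto_sandwich[OF _ _ tendsto_const lim]) (use L0 Lup A(1) in auto)
    then show "(\<lambda>i. ennreal (L (A i))) \<longlonglongrightarrow> 0"
      using tendsto_ennrealI by fastforce
  qed auto
  then have em: "emeasure \<mu> A = ennreal (L A)" if "A \<in> sets M" for A
    unfolding \<mu>_def by (intro emeasure_measure_of_sigma) (use pos that sets.sigma_algebra_axioms in auto)
  have ms: "measure \<mu> A = L A" if "A \<in> sets M" for A
    using em[OF that] L0 by (simp add: measure_def)
  show ?thesis
  proof (rule that)
    show "prob_space \<mu>"
      by (rule prob_spaceI) (simp add: space em Lspace)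
    show "sets \<mu> = sets M" by (rule sets)
    have T\<mu>: "T \<in> measurable \<mu> \<mu>"
      using T measurable_cong_sets[OF sets sets] by blast
    moreover have "distr \<mu> \<mu> T = \<mu>"
      by (rule measure_eqI) (auto simp: emeasure_distr[OF T\<mu>] sets space em Linv measurable_sets[OF T])
    ultimately show "invariant_measure \<mu> T" by (simp add: invariant_measure_def)
  qed (use ms Lup Llow in \<open>auto simp: m_def\<close>)
qed

lemma exact_mapI:
  fixes M \<mu> :: "'a measure"
  assumes fin: "finite_measure M" and prob: "prob_space \<mu>" and sets: "sets \<mu> = sets M"
    and inv: "invariant_measure \<mu> T"
    and up: "\<And>A. A \<in> sets M \<Longrightarrow> measure \<mu> A \<le> C * measure M A"
    and c: "0 < c" and C: "0 < C"
    and image: "\<And>n A. A \<in> sets M \<Longrightarrow> (T ^^ n) ` A \<in> sets M"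
    and dense: "\<And>A \<epsilon>. A \<in> sets M \<Longrightarrow> 0 < measure M A \<Longrightarrow> 0 < \<epsilon> \<Longrightarrow>
      \<exists>R\<in>sets M. 0 < measure M R \<and> measure M (R - A) \<le> \<epsilon> * measure M R \<and>
        (\<exists>n0. \<forall>n\<ge>n0. \<forall>E\<in>sets M. c * measure M R * measure M E \<le> measure M (R \<inter> (T ^^ n) -` E))"
  shows "exact_map \<mu> T"
  unfolding exact_map_def
proof (intro conjI ballI impI)
  interpret M: finite_measure M by fact
  interpret \<mu>: prob_space \<mu> by fact
  have space: "space \<mu> = space M" using sets_eq_imp_space_eq[OF sets] .
  fix A assume A: "A \<in> sets \<mu>" "0 < measure \<mu> A"
  then have AM: "A \<in> sets M" by (simp add: sets)
  have "0 < C * measure M A" using up[OF AM] A(2) by linarith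
  then have mA: "0 < measure M A" using C by (simp add: zero_less_mult_iff)
  show "(\<lambda>n. measure \<mu> ((T ^^ n) ` A)) \<longlonglongrightarrow> 1"
  proof (rule LIMSEQ_I)
    fix r :: real assume r: "0 < r"
    \<comment> \<open>With this choice \<open>C (\<epsilon> / c) = r / 2\<close>, which will bound
      the \<open>\<mu>\<close>-measure of the complement of the image.\<close>
    define \<epsilon> where "\<epsilon> = r * c / (2 * C)"
    have \<epsilon>: "0 < \<epsilon>" using r c C by (simp add: \<epsilon>_def)
    obtain R n0 where R: "R \<in> sets M" "0 < measure M R" "measure M (R - A) \<le> \<epsilon> * measure M R"
      and n0: "\<And>n E. n0 \<le> n \<Longrightarrow> E \<in> sets M \<Longrightarrow> c * measure M R * measure M E \<le> measure M (R \<inter> (T ^^ n) -` E)"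
      using dense[OF AM mA \<epsilon>] by blast
    have "norm (measure \<mu> ((T ^^ n) ` A) - 1) < r" if n: "n0 \<le> n" for n
    proof -
      let ?E = "space M - (T ^^ n) ` A"
      have im: "(T ^^ n) ` A \<in> sets M" by (rule image[OF AM])
      have E: "?E \<in> sets M" using im by auto
      have "c * measure M R * measure M ?E \<le> measure M (R \<inter> (T ^^ n) -` ?E)"
        by (rule n0[OF n E])
      also have "\<dots> \<le> measure M (R - A)"
        by (rule M.finite_measure_mono) (use R AM in auto)
      also have "\<dots> \<le> \<epsilon> * measure M R" by (rule R(3))
      finally have "measure M R * (c * measure M ?E) \<le> measure M R * \<epsilon>" by (simp add: mult_ac)
      then have "c * measure M ?E \<le> \<epsilon>" using R(2) by simp
      then have ME: "measure M ?E \<le> r / (2 * C)" using c C by (simp add: \<epsilon>_def field_simps)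
      have "measure \<mu> ?E \<le> C * measure M ?E" by (rule up[OF E])
      also have "\<dots> \<le> C * (r / (2 * C))" using ME C by (intro mult_left_mono) auto
      also have "\<dots> < r" using C r by simp
      finally have "measure \<mu> ?E < r" .
      moreover have "measure \<mu> ?E = 1 - measure \<mu> ((T ^^ n) ` A)"
        using \<mu>.prob_compl[of "(T ^^ n) ` A"] im by (simp add: sets space)
      moreover have "measure \<mu> ((T ^^ n) ` A) \<le> 1" by (rule \<mu>.prob_le_1)
      ultimately show ?thesis by simp
    qed
    then show "\<exists>no. \<forall>n\<ge>no. norm (measure \<mu> ((T ^^ n) ` A) - 1) < r" by blast
  qed
qed (use prob inv in auto)

text \<open>This plays the part of the Lebesgue density theorem, with boxes in place of balls. An
  open \<open>U\<close> around \<open>Z\<close> with \<open>|U - Z| < \<epsilon> |Z|\<close>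
  contains countably many non-overlapping boxes that cover \<open>Z\<close>. If in each of them the
  part outside \<open>Z\<close> exceeded the fraction \<open>\<epsilon>\<close>, summation would
  give \<open>\<epsilon> |Z| \<le> |U - Z|\<close>.\<close>

lemma dense_box:
  fixes Z :: "'a::euclidean_space set"
  assumes Z[measurable]: "Z \<in> sets borel" and sub: "Z \<subseteq> cbox p q" and pos: "0 < emeasure lborel Z"
    and \<epsilon>: "0 < \<epsilon>"
  obtains c d where "box c d \<subseteq> box p q" "box c d \<noteq> {}"
    "emeasure lborel (box c d - Z) \<le> ennreal \<epsilon> * emeasure lborel (box c d)"
proof -
  have fin: "emeasure lborel Z < \<infinity>"
  proof -
    have "emeasure lborel Z \<le> emeasure lborel (cbox p q)" using sub by (intro emeasure_mono) auto
    also have "\<dots> < \<infinity>" using emeasure_lborel_cbox_finite[of p q] by simp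
    finally show ?thesis .
  qed
  then obtain z where z: "emeasure lborel Z = ennreal z" "0 < z"
    using pos by (cases "emeasure lborel Z") (auto simp: ennreal_less_zero_iff)
  have ne: "box p q \<noteq> {}"
  proof
    assume "box p q = {}"
    then have "negligible (cbox p q)" by (simp add: negligible_interval)
    then have "emeasure lborel (cbox p q) = 0"
      by (simp add: negligible_iff_null_sets null_sets_completion_iff null_sets_def)
    moreover have "emeasure lborel Z \<le> emeasure lborel (cbox p q)" using sub by (intro emeasure_mono) auto
    ultimately show False using pos by simp
  qed
  obtain U where U: "open U" "Z \<subseteq> U" "emeasure lborel (U - Z) < ennreal (\<epsilon> * z)"
    using outer_regular_lborel[OF Z, of "\<epsilon> * z"] \<epsilon> z by auto
  \<comment> \<open>At points of \<open>Z\<close> the gauge is \<open>U\<close>, so every box of the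
    cover, being subordinate to such a point, lies in \<open>U\<close>.\<close>
  define g where "g x = (if x \<in> U then U else UNIV)" for x
  have "gauge g" using U(1) by (auto simp: gauge_def g_def)
  then obtain \<D> where D: "countable \<D>" "\<Union>\<D> \<subseteq> cbox p q"
    "\<And>K. K \<in> \<D> \<Longrightarrow> interior K \<noteq> {} \<and> (\<exists>c d. K = cbox c d)"
    "pairwise (\<lambda>A B. interior A \<inter> interior B = {}) \<D>"
    "\<And>K. K \<in> \<D> \<Longrightarrow> \<exists>x \<in> Z \<inter> K. K \<subseteq> g x" "Z \<subseteq> \<Union>\<D>"
    using covering_lemma[OF sub ne] by metis
  have KU: "K \<subseteq> U" if K: "K \<in> \<D>" for K
  proof -
    obtain x where x: "x \<in> Z" "K \<subseteq> g x" using D(5)[OF K] by blast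
    then have "x \<in> U" using U(2) by blast
    then show ?thesis using x(2) by (simp add: g_def)
  qed
  show ?thesis
  proof (rule ccontr)
    assume "\<not> thesis"
    then have neg: "\<not> (box c d \<subseteq> box p q \<and> box c d \<noteq> {} \<and>
        emeasure lborel (box c d - Z) \<le> ennreal \<epsilon> * emeasure lborel (box c d))" for c d
      using that by blast
    have bad: "ennreal \<epsilon> * emeasure lborel (interior K) \<le> emeasure lborel (interior K - Z)" if K: "K \<in> \<D>" for K
    proof -
      obtain c d where cd: "K = cbox c d" using D(3)[OF K] by blast
      have int: "interior K = box c d" by (simp add: cd)
      have "box c d \<subseteq> box p q"
      proof -
        have "interior K \<subseteq> interior (cbox p q)" using D(2) K by (intro interior_mono) auto
        then show ?thesis by (simp add: int)
      qed
      then show ?thesis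
        using neg[of c d] D(3)[OF K] unfolding int by (meson linear)
    qed
    \<comment> \<open>The boxes overlap at most in their boundaries, so the sums are taken over the
      interiors, at the loss of a null set.\<close>
    have null: "(\<Union>K\<in>\<D>. K - interior K) \<in> null_sets lborel"
    proof (rule null_sets_UN'[OF D(1)])
      fix K assume "K \<in> \<D>"
      then obtain c d where cd: "K = cbox c d" using D(3) by blast
      have "negligible (K - interior K)" unfolding cd by (simp add: negligible_frontier_interval)
      moreover have "K - interior K \<in> sets lborel" by (simp add: cd)
      ultimately show "K - interior K \<in> null_sets lborel"
        by (simp add: negligible_iff_null_sets null_sets_completion_iff)
    qed
    have disj: "disjoint_family_on interior \<D>"
      using D(4) by (auto simp: disjoint_family_on_def pairwise_def)
    have [measurable]: "interior K \<in> sets borel" for K :: "'a set" by simp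
    have int_UN: "(\<Union>K\<in>\<D>. interior K) \<in> sets borel"
      by (intro borel_open open_UN) auto
    have "emeasure lborel Z \<le> emeasure lborel ((\<Union>K\<in>\<D>. interior K) \<union> (\<Union>K\<in>\<D>. K - interior K))"
      using D(6) D(1) null by (intro emeasure_mono) (auto intro!: sets.Un open_UN)
    also have "\<dots> = emeasure lborel (\<Union>K\<in>\<D>. interior K)"
      by (rule emeasure_Un_null_set) (use null int_UN in auto)
    finally have Zle: "emeasure lborel Z \<le> emeasure lborel (\<Union>K\<in>\<D>. interior K)" .
    have "ennreal (\<epsilon> * z) = ennreal \<epsilon> * emeasure lborel Z" using \<epsilon> z by (simp add: ennreal_mult)
    also have "\<dots> \<le> ennreal \<epsilon> * emeasure lborel (\<Union>K\<in>\<D>. interior K)"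
      using Zle by (rule mult_left_mono) simp
    also have "\<dots> = (\<integral>\<^sup>+K. ennreal \<epsilon> * emeasure lborel (interior K) \<partial>count_space \<D>)"
      by (subst emeasure_UN_countable) (use D(1) disj in \<open>auto simp: nn_integral_cmult\<close>)
    also have "\<dots> \<le> (\<integral>\<^sup>+K. emeasure lborel (interior K - Z) \<partial>count_space \<D>)"
      by (rule nn_integral_mono) (use bad in auto)
    also have "\<dots> = emeasure lborel (\<Union>K\<in>\<D>. interior K - Z)"
      by (rule emeasure_UN_countable[symmetric]) (use D(1) disj in \<open>auto simp: disjoint_family_on_def\<close>)
    also have "\<dots> \<le> emeasure lborel (U - Z)"
    proof (rule emeasure_mono)
      show "(\<Union>K\<in>\<D>. interior K - Z) \<subseteq> U - Z" using KU interior_subset by blast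
      show "U - Z \<in> sets lborel" using U(1) by simp
    qed
    finally show False using U(3) by simp
  qed
qed

section \<open>Product maps\<close>

text \<open>The hypothesis compares two measures: \<open>k\<close> times Lebesgue measure on
  \<open>J\<close>, and the image under \<open>f\<close> of Lebesgue measure on \<open>I\<close>. An
  inequality between measures extends to integrals.\<close>

lemma nn_integral_image_ge:
  fixes \<phi> :: "real \<Rightarrow> ennreal" and f :: "real \<Rightarrow> real"
  assumes [measurable]: "f \<in> borel_measurable borel" "I \<in> sets borel" "J \<in> sets borel" "\<phi> \<in> borel_measurable borel"
    and le: "\<And>E. E \<in> sets borel \<Longrightarrow> E \<subseteq> J \<Longrightarrow> k * emeasure lborel E \<le> emeasure lborel (I \<inter> f -` E)"
  shows "k * (\<integral>\<^sup>+x. \<phi> x * indicator J x \<partial>lborel) \<le> (\<integral>\<^sup>+x. \<phi> (f x) * indicator I x \<partial>lborel)"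
proof -
  let ?N = "scale_measure k (density lborel (indicator J))"
  let ?M = "distr (density lborel (indicator I)) borel f"
  have "?N \<le> ?M"
  proof (subst le_measure)
    show "\<forall>A\<in>sets ?N. emeasure ?N A \<le> emeasure ?M A"
    proof
      fix A assume "A \<in> sets ?N"
      then have [measurable]: "A \<in> sets borel" by simp
      have v[measurable]: "f -` X \<in> sets borel" if "X \<in> sets borel" for X
        using that by (rule measurable_sets_borel[rotated]) measurable
      have "emeasure ?N A = k * emeasure lborel (J \<inter> A)"
        by (simp add: emeasure_restricted)
      also have "\<dots> \<le> emeasure lborel (I \<inter> f -` (J \<inter> A))" by (rule le) auto
      also have "\<dots> \<le> emeasure lborel (I \<inter> f -` A)" by (intro emeasure_mono) auto
      also have "\<dots> = emeasure ?M A"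
        by (simp add: emeasure_distr emeasure_restricted)
      finally show "emeasure ?N A \<le> emeasure ?M A" .
    qed
  qed simp
  then have "nn_integral ?N \<phi> \<le> nn_integral ?M \<phi>"
    by (intro nn_integral_mono_measure) auto
  moreover have "nn_integral ?N \<phi> = k * (\<integral>\<^sup>+x. \<phi> x * indicator J x \<partial>lborel)"
    by (subst nn_integral_scale_measure) (auto simp: nn_integral_density mult.commute)
  moreover have "nn_integral ?M \<phi> = (\<integral>\<^sup>+x. \<phi> (f x) * indicator I x \<partial>lborel)"
    by (subst nn_integral_distr) (auto simp: nn_integral_density mult.commute)
  ultimately show ?thesis by simp
qed

text \<open>The reverse comparison. Here \<open>le\<close> speaks only of sets inside
  \<open>J\<close>, and \<open>maps\<close> reduces an arbitrary set to its part in
  \<open>J\<close>.\<close>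

lemma nn_integral_image_le:
  fixes \<phi> :: "real \<Rightarrow> ennreal" and f :: "real \<Rightarrow> real"
  assumes [measurable]: "f \<in> borel_measurable borel" "I \<in> sets borel" "J \<in> sets borel" "\<phi> \<in> borel_measurable borel"
    and maps: "\<And>x. x \<in> I \<Longrightarrow> f x \<in> J"
    and le: "\<And>E. E \<in> sets borel \<Longrightarrow> E \<subseteq> J \<Longrightarrow> emeasure lborel (I \<inter> f -` E) \<le> k * emeasure lborel E"
  shows "(\<integral>\<^sup>+x. \<phi> (f x) * indicator I x \<partial>lborel) \<le> k * (\<integral>\<^sup>+x. \<phi> x * indicator J x \<partial>lborel)"
proof -
  let ?N = "scale_measure k (density lborel (indicator J))"
  let ?M = "distr (density lborel (indicator I)) borel f"
  have "?M \<le> ?N"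
  proof (subst le_measure)
    show "\<forall>A\<in>sets ?M. emeasure ?M A \<le> emeasure ?N A"
    proof
      fix A assume "A \<in> sets ?M"
      then have [measurable]: "A \<in> sets borel" by simp
      have v[measurable]: "f -` X \<in> sets borel" if "X \<in> sets borel" for X
        using that by (rule measurable_sets_borel[rotated]) measurable
      have "emeasure ?M A = emeasure lborel (I \<inter> f -` A)"
        by (simp add: emeasure_distr emeasure_restricted)
      also have "I \<inter> f -` A = I \<inter> f -` (J \<inter> A)" using maps by auto
      also have "emeasure lborel \<dots> \<le> k * emeasure lborel (J \<inter> A)" by (rule le) auto
      also have "\<dots> = emeasure ?N A"
        by (simp add: emeasure_restricted)
      finally show "emeasure ?M A \<le> emeasure ?N A" .
    qed
  qed simp
  then have "nn_integral ?M \<phi> \<le> nn_integral ?N \<phi>"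
    by (intro nn_integral_mono_measure) auto
  moreover have "nn_integral ?N \<phi> = k * (\<integral>\<^sup>+x. \<phi> x * indicator J x \<partial>lborel)"
    by (subst nn_integral_scale_measure) (auto simp: nn_integral_density mult.commute)
  moreover have "nn_integral ?M \<phi> = (\<integral>\<^sup>+x. \<phi> (f x) * indicator I x \<partial>lborel)"
    by (subst nn_integral_distr) (auto simp: nn_integral_density mult.commute)
  ultimately show ?thesis by simp
qed

lemma emeasure_lborel_pair:
  fixes E :: "(real \<times> real) set"
  assumes "E \<in> sets borel"
  shows "emeasure lborel E = (\<integral>\<^sup>+x. emeasure lborel (Pair x -` E) \<partial>lborel)"
proof -
  have "E \<in> sets (lborel \<Otimes>\<^sub>M lborel)"
    unfolding lborel_prod using assms by simp
  from lborel.emeasure_pair_measure_alt[OF this] show ?thesis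
    unfolding lborel_prod .
qed

lemma borel_section:
  fixes E :: "(real \<times> real) set"
  assumes "E \<in> sets borel"
  shows "(\<lambda>x. emeasure lborel (Pair x -` E)) \<in> borel_measurable borel" "Pair x -` E \<in> sets borel"
proof -
  have E: "E \<in> sets (lborel \<Otimes>\<^sub>M lborel)" unfolding lborel_prod using assms by simp
  show "(\<lambda>x. emeasure lborel (Pair x -` E)) \<in> borel_measurable borel"
    using lborel.measurable_emeasure_Pair[OF E] by simp
  show "Pair x -` E \<in> sets borel"
    using sets_Pair1[OF E, of x] by simp
qed

lemma borel_Times_real [measurable]:
  "A \<in> sets borel \<Longrightarrow> B \<in> sets borel \<Longrightarrow> A \<times> B \<in> sets (borel :: (real \<times> real) measure)"
  by (simp add: borel_prod[symmetric])

lemma borel_map_prod: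
  fixes f g :: "real \<Rightarrow> real"
  assumes [measurable]: "f \<in> borel_measurable borel" "g \<in> borel_measurable borel"
  shows "map_prod f g \<in> borel_measurable borel"
  unfolding map_prod_def case_prod_beta borel_prod[symmetric] by measurable

text \<open>Fubini: the bound for \<open>g\<close> is applied to the vertical sections of
  \<open>E\<close>, and the bound for \<open>f\<close>, in its integral form, to the function
  \<open>\<phi>\<close> that measures these sections.\<close>

lemma product_lower:
  fixes f g :: "real \<Rightarrow> real" and E :: "(real \<times> real) set"
  assumes [measurable]: "f \<in> borel_measurable borel" "g \<in> borel_measurable borel"
      "I \<in> sets borel" "I' \<in> sets borel" "J \<in> sets borel" "J' \<in> sets borel"
    and le: "\<And>E. E \<in> sets borel \<Longrightarrow> E \<subseteq> J \<Longrightarrow> k * emeasure lborel E \<le> emeasure lborel (I \<inter> f -` E)"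
    and le': "\<And>E. E \<in> sets borel \<Longrightarrow> E \<subseteq> J' \<Longrightarrow> k' * emeasure lborel E \<le> emeasure lborel (I' \<inter> g -` E)"
    and E: "E \<in> sets borel" "E \<subseteq> J \<times> J'"
  shows "k * k' * emeasure lborel E \<le> emeasure lborel (I \<times> I' \<inter> map_prod f g -` E)"
proof -
  note [measurable] = borel_section[OF E(1)]
  define \<phi> where "\<phi> x = k' * emeasure lborel (Pair x -` E)" for x
  have [measurable]: "\<phi> \<in> borel_measurable borel" unfolding \<phi>_def by measurable
  have X: "I \<times> I' \<inter> map_prod f g -` E \<in> sets borel"
    by (intro sets.Int borel_Times_real measurable_sets_borel[OF borel_map_prod E(1)]) auto
  have "k * k' * emeasure lborel E = k * (\<integral>\<^sup>+x. \<phi> x \<partial>lborel)"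
    unfolding \<phi>_def by (simp add: nn_integral_cmult emeasure_lborel_pair[OF E(1)] mult.assoc)
  also have "(\<integral>\<^sup>+x. \<phi> x \<partial>lborel) = (\<integral>\<^sup>+x. \<phi> x * indicator J x \<partial>lborel)"
  proof (rule nn_integral_cong)
    fix x
    show "\<phi> x = \<phi> x * indicator J x"
    proof (cases "x \<in> J")
      case False
      then have "Pair x -` E = {}" using E(2) by auto
      then show ?thesis using False by (simp add: \<phi>_def)
    qed simp
  qed
  also have "k * \<dots> \<le> (\<integral>\<^sup>+x. \<phi> (f x) * indicator I x \<partial>lborel)"
    by (rule nn_integral_image_ge[OF _ _ _ _ le]) auto
  also have "\<dots> \<le> (\<integral>\<^sup>+x. emeasure lborel (Pair x -` (I \<times> I' \<inter> map_prod f g -` E)) \<partial>lborel)"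
  proof (rule nn_integral_mono)
    fix x
    show "\<phi> (f x) * indicator I x \<le> emeasure lborel (Pair x -` (I \<times> I' \<inter> map_prod f g -` E))"
    proof (cases "x \<in> I")
      case True
      have "\<phi> (f x) \<le> emeasure lborel (I' \<inter> g -` (Pair (f x) -` E))"
        unfolding \<phi>_def by (rule le') (use E(2) borel_section(2)[OF E(1)] in auto)
      also have "I' \<inter> g -` (Pair (f x) -` E) = Pair x -` (I \<times> I' \<inter> map_prod f g -` E)"
        using True by auto
      finally show ?thesis using True by simp
    qed simp
  qed
  also have "\<dots> = emeasure lborel (I \<times> I' \<inter> map_prod f g -` E)"
    by (rule emeasure_lborel_pair[OF X, symmetric])
  finally show ?thesis .
qed

lemma product_upper:
  fixes f g :: "real \<Rightarrow> real" and E :: "(real \<times> real) set"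
  assumes [measurable]: "f \<in> borel_measurable borel" "g \<in> borel_measurable borel"
      "I \<in> sets borel" "I' \<in> sets borel" "J \<in> sets borel" "J' \<in> sets borel"
    and maps: "\<And>x. x \<in> I \<Longrightarrow> f x \<in> J"
    and le: "\<And>E. E \<in> sets borel \<Longrightarrow> E \<subseteq> J \<Longrightarrow> emeasure lborel (I \<inter> f -` E) \<le> k * emeasure lborel E"
    and le': "\<And>E. E \<in> sets borel \<Longrightarrow> E \<subseteq> J' \<Longrightarrow> emeasure lborel (I' \<inter> g -` E) \<le> k' * emeasure lborel E"
    and E: "E \<in> sets borel" "E \<subseteq> J \<times> J'"
  shows "emeasure lborel (I \<times> I' \<inter> map_prod f g -` E) \<le> k * k' * emeasure lborel E"
proof -
  note [measurable] = borel_section[OF E(1)]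
  define \<phi> where "\<phi> x = k' * emeasure lborel (Pair x -` E)" for x
  have [measurable]: "\<phi> \<in> borel_measurable borel" unfolding \<phi>_def by measurable
  have X: "I \<times> I' \<inter> map_prod f g -` E \<in> sets borel"
    by (intro sets.Int borel_Times_real measurable_sets_borel[OF borel_map_prod E(1)]) auto
  have "emeasure lborel (I \<times> I' \<inter> map_prod f g -` E) =
      (\<integral>\<^sup>+x. emeasure lborel (Pair x -` (I \<times> I' \<inter> map_prod f g -` E)) \<partial>lborel)"
    by (rule emeasure_lborel_pair[OF X])
  also have "\<dots> \<le> (\<integral>\<^sup>+x. \<phi> (f x) * indicator I x \<partial>lborel)"
  proof (rule nn_integral_mono)
    fix x
    show "emeasure lborel (Pair x -` (I \<times> I' \<inter> map_prod f g -` E)) \<le> \<phi> (f x) * indicator I x"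
    proof (cases "x \<in> I")
      case True
      have "Pair x -` (I \<times> I' \<inter> map_prod f g -` E) = I' \<inter> g -` (Pair (f x) -` E)"
        using True by auto
      moreover have "emeasure lborel (I' \<inter> g -` (Pair (f x) -` E)) \<le> \<phi> (f x)"
        unfolding \<phi>_def by (rule le') (use E(2) borel_section(2)[OF E(1)] in auto)
      ultimately show ?thesis using True by simp
    qed simp
  qed
  also have "\<dots> \<le> k * (\<integral>\<^sup>+x. \<phi> x * indicator J x \<partial>lborel)"
    by (rule nn_integral_image_le[OF _ _ _ _ maps le]) auto
  also have "\<dots> \<le> k * (\<integral>\<^sup>+x. \<phi> x \<partial>lborel)"
    by (intro mult_left_mono nn_integral_mono) (auto simp: indicator_def)
  also have "\<dots> = k * k' * emeasure lborel E"
    unfolding \<phi>_def by (simp add: nn_integral_cmult emeasure_lborel_pair[OF E(1)] mult.assoc)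
  finally show ?thesis .
qed

section \<open>Lebesgue measure under the change to product coordinates\<close>

lemma borel_split_coords [measurable]: "split_coords \<in> borel_measurable borel"
  unfolding split_coords_def borel_prod[symmetric] by measurable

definition split_uncoords :: "real \<times> real \<Rightarrow> split" where
  "split_uncoords p = ((fst p + snd p) / 2, (fst p - snd p) / 2)"

lemma split_coords_uncoords [simp]: "split_coords (split_uncoords p) = p"
  by (simp add: split_coords_def split_uncoords_def field_simps flip: prod_eq_iff)

lemma split_uncoords_coords [simp]: "split_uncoords (split_coords x) = x"
  by (simp add: split_coords_def split_uncoords_def)

lemma borel_split_uncoords [measurable]: "split_uncoords \<in> borel_measurable borel"
  unfolding split_uncoords_def borel_prod[symmetric] by measurable

text \<open>Two substitutions in one variable under Fubini: \<open>u = x + y\<close> for fixed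
  \<open>y\<close> is a translation, and \<open>v = u - 2 y\<close> for fixed \<open>u\<close>
  contributes the factor \<open>2\<close>.\<close>

lemma emeasure_split_coords_vimage:
  fixes E :: "(real \<times> real) set"
  assumes E[measurable]: "E \<in> sets borel"
  shows "2 * emeasure lborel (split_coords -` E) = emeasure lborel E"
proof -
  let ?h = "\<lambda>x y. indicator E (x + y, x - y) :: ennreal"
  have [measurable]: "E \<in> sets (borel \<Otimes>\<^sub>M borel)" using assms unfolding borel_prod .
  have X: "split_coords -` E \<in> sets borel"
    by (rule measurable_sets_borel[OF borel_split_coords E])
  have "emeasure lborel (split_coords -` E) = (\<integral>\<^sup>+x. emeasure lborel (Pair x -` (split_coords -` E)) \<partial>lborel)"
    by (rule emeasure_lborel_pair[OF X])
  also have "\<dots> = (\<integral>\<^sup>+x. (\<integral>\<^sup>+y. ?h x y \<partial>lborel) \<partial>lborel)"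
  proof (rule nn_integral_cong)
    fix x :: real
    have "emeasure lborel (Pair x -` (split_coords -` E)) =
        (\<integral>\<^sup>+y. indicator (Pair x -` (split_coords -` E)) y \<partial>lborel)"
      using borel_section(2)[OF X] by simp
    also have "\<dots> = (\<integral>\<^sup>+y. ?h x y \<partial>lborel)"
      by (intro nn_integral_cong) (simp add: indicator_def split_coords_def)
    finally show "emeasure lborel (Pair x -` (split_coords -` E)) = (\<integral>\<^sup>+y. ?h x y \<partial>lborel)" .
  qed
  also have "\<dots> = (\<integral>\<^sup>+y. (\<integral>\<^sup>+x. ?h x y \<partial>lborel) \<partial>lborel)"
    by (rule lborel_pair.Fubini'[symmetric]) measurable
  also have "\<dots> = (\<integral>\<^sup>+y. (\<integral>\<^sup>+u. indicator E (u, u - 2 * y) \<partial>lborel) \<partial>lborel)"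
  proof (rule nn_integral_cong)
    fix y :: real
    have "(\<integral>\<^sup>+x. ?h x y \<partial>lborel) = ennreal \<bar>1\<bar> * (\<integral>\<^sup>+u. ?h (- y + 1 * u) y \<partial>lborel)"
      by (rule nn_integral_real_affine) auto
    then show "(\<integral>\<^sup>+x. ?h x y \<partial>lborel) = (\<integral>\<^sup>+u. indicator E (u, u - 2 * y) \<partial>lborel)"
      by (simp add: algebra_simps)
  qed
  also have "\<dots> = (\<integral>\<^sup>+u. (\<integral>\<^sup>+y. indicator E (u, u - 2 * y) \<partial>lborel) \<partial>lborel)"
    by (rule lborel_pair.Fubini') measurable
  finally have "2 * emeasure lborel (split_coords -` E) =
      2 * (\<integral>\<^sup>+u. (\<integral>\<^sup>+y. indicator E (u, u - 2 * y) \<partial>lborel) \<partial>lborel)" by simp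
  also have "\<dots> = (\<integral>\<^sup>+u. 2 * (\<integral>\<^sup>+y. indicator E (u, u - 2 * y) \<partial>lborel) \<partial>lborel)"
    by (rule nn_integral_cmult[symmetric]) measurable
  also have "\<dots> = (\<integral>\<^sup>+u. emeasure lborel (Pair u -` E) \<partial>lborel)"
  proof (rule nn_integral_cong)
    fix u :: real
    have "emeasure lborel (Pair u -` E) = (\<integral>\<^sup>+v. indicator E (u, v) \<partial>lborel)"
    proof -
      have "emeasure lborel (Pair u -` E) = (\<integral>\<^sup>+v. indicator (Pair u -` E) v \<partial>lborel)"
        using borel_section(2)[OF E] by simp
      then show ?thesis by (simp add: indicator_def)
    qed
    also have "\<dots> = ennreal \<bar>- 2\<bar> * (\<integral>\<^sup>+y. indicator E (u, u + (- 2) * y) \<partial>lborel)"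
      by (rule nn_integral_real_affine) auto
    finally show "2 * (\<integral>\<^sup>+y. indicator E (u, u - 2 * y) \<partial>lborel) = emeasure lborel (Pair u -` E)"
      by simp
  qed
  also have "\<dots> = emeasure lborel E"
    by (rule emeasure_lborel_pair[OF E, symmetric])
  finally show ?thesis .
qed

section \<open>Convergence\<close>

text \<open>The digits are those of the orbit of \<open>x\<close>, while the innermost remainder
  \<open>T^n x\<close> is replaced by \<open>0\<close>. Evaluation is in the reals, where division
  by \<open>0\<close> gives \<open>0\<close>; \<open>cf_approx_denominator\<close> excludes this for
  orbits that avoid \<open>0\<close>.\<close>

fun cf_approx :: "real \<Rightarrow> real \<Rightarrow> nat \<Rightarrow> real" where
  "cf_approx a x 0 = 0"
| "cf_approx a x (Suc n) = 1 / (of_int \<lfloor>1 / x + a\<rfloor> + cf_approx a (cf_map a x) n)"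

context shifted_cf
begin

text \<open>
  A digit \<open>\<plusminus>1\<close> is followed by a digit of the same sign, so no denominator of a finite
  fraction has absolute value less than \<open>1\<close>.
\<close>

lemma denominator_ge_1:
  fixes w :: real
  assumes x: "x \<in> J" "x \<noteq> 0" "T x \<noteq> 0" and w: "\<bar>w\<bar> \<le> 1" "0 \<le> of_int (digit (T x)) * w"
  shows "1 \<le> \<bar>of_int (digit x) + w\<bar>" "0 \<le> of_int (digit x) * (of_int (digit x) + w)"
proof -
  have d: "digit x \<noteq> 0" using digit_nonzero[OF x(1,2)] .
  have sgn: "0 \<le> w" if "0 < c" "0 \<le> c * w" for c :: real
    using that by (simp add: zero_le_mult_iff)
  have sgn': "w \<le> 0" if "c < 0" "0 \<le> c * w" for c :: real
    using that by (simp add: zero_le_mult_iff)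
  consider "digit x = 1" | "digit x = - 1" | "2 \<le> digit x" | "digit x \<le> - 2"
    using d by linarith
  then have "1 \<le> \<bar>of_int (digit x) + w\<bar> \<and> 0 \<le> of_int (digit x) * (of_int (digit x) + w)"
  proof cases
    case 1
    then have "0 < T x" using digit_pm_1_sign[OF x(1,2)] x(3) by simp
    then have "1 \<le> digit (T x)" using digit_pos cf_map_in_J by blast
    then have "0 < real_of_int (digit (T x))" by linarith
    then have "0 \<le> w" using sgn w(2) by blast
    then show ?thesis using 1 by simp
  next
    case 2
    then have "T x < 0" using digit_pm_1_sign[OF x(1,2)] x(3) by simp
    then have "digit (T x) \<le> - 1" using digit_neg cf_map_in_J by blast
    then have "real_of_int (digit (T x)) < 0" by linarith
    then have "w \<le> 0" using sgn' w(2) by blast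
    then show ?thesis using 2 by simp
  next
    case 3
    then have "2 \<le> real_of_int (digit x)" by linarith
    then have "0 \<le> real_of_int (digit x)" "1 \<le> real_of_int (digit x) + w" using w(1) by linarith+
    then show ?thesis using mult_nonneg_nonneg[of "real_of_int (digit x)" "real_of_int (digit x) + w"] by linarith
  next
    case 4
    then have "real_of_int (digit x) \<le> - 2" by linarith
    then have "real_of_int (digit x) \<le> 0" "real_of_int (digit x) + w \<le> - 1" using w(1) by linarith+
    then show ?thesis using mult_nonpos_nonpos[of "real_of_int (digit x)" "real_of_int (digit x) + w"] by linarith
  qed
  then show "1 \<le> \<bar>of_int (digit x) + w\<bar>" "0 \<le> of_int (digit x) * (of_int (digit x) + w)" by auto
qed

lemma orbit_shift: "(\<And>i. (T ^^ i) x \<noteq> 0) \<Longrightarrow> (T ^^ i) (T x) \<noteq> 0"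
  using funpow_swap1[of T i x] by (metis funpow.simps(2) o_apply)

text \<open>The bound on the modulus does not reproduce itself alone, since \<open>1 + w\<close> may
  be small for \<open>w\<close> near \<open>-1\<close>. The sign condition excludes this: the value
  of a finite fraction does not oppose its leading digit.\<close>

lemma cf_approx_bounds:
  assumes "x \<in> J" "\<And>i. (T ^^ i) x \<noteq> 0"
  shows "\<bar>cf_approx a x n\<bar> \<le> 1 \<and> 0 \<le> of_int (digit x) * cf_approx a x n"
  using assms
proof (induction n arbitrary: x)
  case (Suc n)
  note it = orbit_shift[OF Suc.prems(2)]
  have x: "x \<noteq> 0" "T x \<noteq> 0" using Suc.prems(2)[of 0] it[of 0] by auto
  have "\<bar>cf_approx a (T x) n\<bar> \<le> 1" "0 \<le> of_int (digit (T x)) * cf_approx a (T x) n"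
    using Suc.IH[OF cf_map_in_J it] by auto
  from denominator_ge_1[OF Suc.prems(1) x this] show ?case
    by (auto simp: divide_le_eq zero_le_mult_iff zero_le_divide_iff)
qed simp

lemma cf_approx_denominator:
  assumes "x \<in> J" "\<And>i. (T ^^ i) x \<noteq> 0"
  shows "of_int (digit x) + cf_approx a (T x) n \<noteq> 0"
proof -
  note it = orbit_shift[OF assms(2)]
  have "x \<noteq> 0" "T x \<noteq> 0" using assms(2)[of 0] it[of 0] by auto
  then show ?thesis
    using denominator_ge_1(1)[OF assms(1), of "cf_approx a (T x) n"] cf_approx_bounds[OF cf_map_in_J it, of n] by auto
qed

text \<open>With \<open>w\<close> the tail of the approximant, \<open>x (d + T x) = 1\<close> turns
  the error into \<open>x (w - T x) / (d + w)\<close>, and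
  \<open>|1 / (d + w)| \<le> 1\<close>.\<close>

lemma cf_approx_error_step:
  assumes x: "x \<in> J" "\<And>i. (T ^^ i) x \<noteq> 0"
  shows "\<bar>x - cf_approx a x (Suc n)\<bar> \<le> \<bar>x\<bar> * \<bar>T x - cf_approx a (T x) n\<bar>"
proof -
  have x0: "x \<noteq> 0" using x(2)[of 0] by simp
  let ?d = "of_int (digit x) :: real" and ?w = "cf_approx a (T x) n"
  have w0: "?d + ?w \<noteq> 0" by (rule cf_approx_denominator[OF x])
  have e: "x * (?d + T x) = 1" using inverse_eq[of x] x0 by (simp add: field_simps)
  have "x - 1 / (?d + ?w) = x * (1 / (?d + ?w)) * (?w - T x)"
  proof -
    have "x - 1 / (?d + ?w) = (x * (?d + ?w) - x * (?d + T x)) / (?d + ?w)"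
      unfolding e using w0 by (simp add: field_simps)
    also have "\<dots> = x * (?w - T x) / (?d + ?w)" by (simp add: algebra_simps)
    finally show ?thesis by (simp add: mult_ac)
  qed
  then have "\<bar>x - cf_approx a x (Suc n)\<bar> = \<bar>x\<bar> * \<bar>cf_approx a x (Suc n)\<bar> * \<bar>T x - ?w\<bar>"
    by (simp add: abs_mult abs_minus_commute)
  also have "\<dots> \<le> \<bar>x\<bar> * 1 * \<bar>T x - ?w\<bar>"
    using cf_approx_bounds[OF x, of "Suc n"] by (intro mult_right_mono mult_left_mono) auto
  finally show ?thesis by simp
qed

text \<open>The product \<open>p = |x| |T x|\<close> satisfies \<open>|x| + p \<le> 1\<close> and
  \<open>p \<le> |x|\<close>, whence \<open>2 p \<le> 1\<close>.\<close>

lemma abs_mult_image_le_half: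
  assumes "x \<in> J"
  shows "\<bar>x\<bar> * \<bar>T x\<bar> \<le> 1 / 2"
proof -
  let ?p = "\<bar>x\<bar> * \<bar>T x\<bar>"
  have "\<bar>x\<bar> + ?p \<le> 1" using abs_mult_image_le_1[OF assms] by (simp add: algebra_simps)
  moreover have "?p \<le> \<bar>x\<bar> * 1"
    using abs_less_1[OF cf_map_in_J[of x]] by (intro mult_left_mono) auto
  ultimately show ?thesis by linarith
qed

text \<open>A single step contracts only by \<open>|x|\<close>, which may be close to
  \<open>1\<close>; two consecutive steps contract by \<open>|x| |T x| \<le> 1/2\<close>. Hence the
  exponent \<open>n div 2\<close> and an induction that goes back by two.\<close>

lemma cf_approx_error:
  assumes "x \<in> J" "\<And>i. (T ^^ i) x \<noteq> 0"
  shows "\<bar>x - cf_approx a x n\<bar> \<le> 2 * (1 / 2) ^ (n div 2)"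
  using assms
proof (induction n arbitrary: x rule: less_induct)
  case (less n)
  note it = orbit_shift[OF less.prems(2)]
  show ?case
  proof (cases "n < 2")
    case True
    have "\<bar>x\<bar> \<le> 1" "\<bar>cf_approx a x n\<bar> \<le> 1"
      using abs_less_1[OF less.prems(1)] cf_approx_bounds[OF less.prems, of n] by auto
    then have "\<bar>x - cf_approx a x n\<bar> \<le> 2" by linarith
    then show ?thesis using True by simp
  next
    case False
    then obtain k where n: "n = Suc (Suc k)" by (metis add_2_eq_Suc le_Suc_ex not_less)
    let ?e = "\<bar>T (T x) - cf_approx a (T (T x)) k\<bar>"
    have "\<bar>x - cf_approx a x n\<bar> \<le> \<bar>x\<bar> * \<bar>T x - cf_approx a (T x) (Suc k)\<bar>"
      unfolding n by (rule cf_approx_error_step[OF less.prems])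
    also have "\<dots> \<le> \<bar>x\<bar> * (\<bar>T x\<bar> * ?e)"
      by (intro mult_left_mono cf_approx_error_step[OF cf_map_in_J it]) auto
    also have "\<dots> = (\<bar>x\<bar> * \<bar>T x\<bar>) * ?e" by simp
    also have "\<dots> \<le> 1 / 2 * (2 * (1 / 2) ^ (k div 2))"
      using less.IH[of k "T (T x)", OF _ cf_map_in_J orbit_shift[OF it]] n
      by (intro mult_mono abs_mult_image_le_half less.prems) auto
    finally show ?thesis using n by simp
  qed
qed

lemma cf_approx_tendsto:
  assumes "x \<in> J" "\<And>i. (T ^^ i) x \<noteq> 0"
  shows "cf_approx a x \<longlonglongrightarrow> x"
proof -
  have "(\<lambda>n. 2 * (1 / 2 :: real) ^ (n div 2)) \<longlonglongrightarrow> 0"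
  proof -
    have "filterlim (\<lambda>n :: nat. n div 2) at_top sequentially"
      unfolding filterlim_at_top eventually_sequentially
    proof
      fix Z :: nat
      show "\<exists>N. \<forall>n\<ge>N. Z \<le> n div 2" by (intro exI[of _ "2 * Z"]) auto
    qed
    then have "(\<lambda>n. (1 / 2 :: real) ^ (n div 2)) \<longlonglongrightarrow> 0"
      by (rule filterlim_compose[OF LIMSEQ_power_zero[of "1 / 2 :: real"], rotated]) simp
    then show ?thesis by (rule tendsto_mult_right_zero)
  qed
  then have "(\<lambda>n. cf_approx a x n - x) \<longlonglongrightarrow> 0"
    by (rule Lim_null_comparison[rotated])
      (use cf_approx_error[OF assms] in \<open>auto simp: abs_minus_commute\<close>)
  then show ?thesis by (simp add: LIM_zero_iff)
qed

end

section \<open>The Gauss map in coordinates\<close>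

lemma split_coords_inv:
  assumes "x \<notin> null_cone"
  shows "split_coords (split_inv x) = (1 / fst (split_coords x), 1 / snd (split_coords x))"
proof -
  have Q: "split_Q x = (fst x + snd x) * (fst x - snd x)"
    by (simp add: split_Q_def power2_eq_square algebra_simps)
  then have "fst x + snd x \<noteq> 0" "fst x - snd x \<noteq> 0"
    using assms by (auto simp: null_cone_def)
  then show ?thesis
    by (simp add: split_coords_def split_inv_def split_cnj_def Q divide_inverse flip: distrib_left right_diff_distrib)
qed

lemma null_cone_coords: "x \<in> null_cone \<longleftrightarrow> fst (split_coords x) = 0 \<or> snd (split_coords x) = 0"
proof -
  have "split_Q x = (fst x + snd x) * (fst x - snd x)"
    by (simp add: split_Q_def power2_eq_square algebra_simps)
  then show ?thesis by (simp add: null_cone_def split_coords_def)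
qed

lemma split_coords_0 [simp]: "split_coords 0 = (0, 0)"
  by (simp add: split_coords_def)

text \<open>\<open>a\<close> and \<open>b\<close> are the two coordinates of \<alpha>; that both lie
  in \<open>[0, 1)\<close> expresses \<open>0 \<in> K\<close>.\<close>

locale split_cf = U: shifted_cf a + V: shifted_cf b for a b :: real
begin

definition K :: "split set" where
  "K = split_coords -` (cf_interval a \<times> cf_interval b)"

lemma mem_K: "x \<in> K \<longleftrightarrow> fst (split_coords x) \<in> cf_interval a \<and> snd (split_coords x) \<in> cf_interval b"
  by (simp add: K_def mem_Times_iff)

lemma K_eq: "K = shifted_diamond (split_uncoords (a, b))"
proof -
  have "x \<in> shifted_diamond \<alpha> \<longleftrightarrow> x + \<alpha> \<in> little_diamond" for x \<alpha> :: split
    unfolding shifted_diamond_def by (auto simp: image_iff algebra_simps intro!: bexI[of _ "x + \<alpha>"])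
  then show ?thesis
    by (auto simp: K_def little_diamond_def split_coords_def split_uncoords_def cf_interval_def field_simps)
qed

definition lattice_point :: "int \<times> int \<Rightarrow> split" where
  "lattice_point = (\<lambda>(m, n). split_uncoords (of_int m, of_int n))"

lemma split_coords_lattice_point [simp]: "split_coords (lattice_point (m, n)) = (of_int m, of_int n)"
  by (simp add: lattice_point_def)

lemma split_coords_diff: "split_coords (x - y) = split_coords x - split_coords y"
  by (simp add: split_coords_def)

lemma lattice_part_K:
  "lattice_part K x = lattice_point (\<lfloor>fst (split_coords x) + a\<rfloor>, \<lfloor>snd (split_coords x) + b\<rfloor>)"
  unfolding lattice_part_def K_eq
proof (rule the1_equality[OF ex1_lattice_part], intro conjI)
  let ?m = "\<lfloor>fst (split_coords x) + a\<rfloor>" and ?n = "\<lfloor>snd (split_coords x) + b\<rfloor>"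
  show "lattice_point (?m, ?n) \<in> split_lattice"
  proof -
    have "lattice_point (?m, ?n) = of_int ?m *\<^sub>R (1/2, 1/2) + of_int ?n *\<^sub>R (1/2, - 1/2)"
      by (simp add: lattice_point_def split_uncoords_def add_divide_distrib diff_divide_distrib)
    then show ?thesis unfolding split_lattice_def by blast
  qed
  have "split_coords (x - lattice_point (?m, ?n)) \<in> cf_interval a \<times> cf_interval b"
    unfolding split_coords_diff split_coords_lattice_point mem_Times_iff U.mem_J V.mem_J fst_diff snd_diff fst_conv snd_conv
    by (intro conjI) linarith+
  then show "x - lattice_point (?m, ?n) \<in> shifted_diamond (split_uncoords (a, b))"
    unfolding K_eq[symmetric] by (simp add: K_def)
qed

abbreviation "G \<equiv> gauss_map K"
abbreviation "u \<equiv> \<lambda>x :: split. fst (split_coords x)"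
abbreviation "v \<equiv> \<lambda>x :: split. snd (split_coords x)"

lemma split_coords_gauss:
  "x \<notin> null_cone \<Longrightarrow> split_coords (G x) = (cf_map a (u x), cf_map b (v x))"
  by (simp add: gauss_map_def split_coords_diff lattice_part_K split_coords_inv cf_map_def)

lemma gauss_eq: "G x = (if u x = 0 \<or> v x = 0 then 0 else split_uncoords (cf_map a (u x), cf_map b (v x)))"
proof (cases "x \<in> null_cone")
  case True
  then show ?thesis by (simp add: null_cone_coords gauss_map_def)
next
  case False
  then show ?thesis
    using split_uncoords_coords[of "G x"] by (simp add: split_coords_gauss null_cone_coords)
qed

lemma gauss_in_K: "G x \<in> K"
proof (cases "x \<in> null_cone")
  case True
  then have "G x = 0" by (simp add: gauss_map_def)
  then show ?thesis using U.zero_in_J V.zero_in_J by (simp add: mem_K)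
next
  case False
  then show ?thesis
    using U.cf_map_in_J V.cf_map_in_J unfolding mem_K split_coords_gauss[OF False] by simp
qed

lemma split_coords_cf_digit:
  assumes "(G ^^ i) x \<notin> null_cone"
  shows "split_coords (cf_digit K x i) = (of_int \<lfloor>1 / u ((G ^^ i) x) + a\<rfloor>, of_int \<lfloor>1 / v ((G ^^ i) x) + b\<rfloor>)"
  using assms by (simp add: cf_digit_def lattice_part_K split_coords_inv)

text \<open>\<open>gauss_map\<close> sends a point with one zero coordinate to \<open>0\<close>,
  which resets the other coordinate too. Hence it is followed as a product map only as long as
  neither coordinate has reached \<open>0\<close>.\<close>

lemma split_coords_funpow:
  assumes "\<And>k. k < n \<Longrightarrow> (cf_map a ^^ k) (u x) \<noteq> 0 \<and> (cf_map b ^^ k) (v x) \<noteq> 0"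
  shows "split_coords ((G ^^ n) x) = ((cf_map a ^^ n) (u x), (cf_map b ^^ n) (v x))"
  using assms
proof (induction n)
  case (Suc n)
  then have IH: "split_coords ((G ^^ n) x) = ((cf_map a ^^ n) (u x), (cf_map b ^^ n) (v x))" by simp
  then have "(G ^^ n) x \<notin> null_cone" using Suc.prems[of n] by (simp add: null_cone_coords)
  then show ?case using IH by (simp add: split_coords_gauss)
qed (simp add: prod_eq_iff)

text \<open>Strong induction: nonvanishing before time \<open>n\<close> identifies the orbit with
  the product orbit at time \<open>n\<close>, and there it is off the null cone by
  assumption.\<close>

lemma infinite_digits_coords:
  assumes "infinite_digits K x"
  shows "(cf_map a ^^ n) (u x) \<noteq> 0 \<and> (cf_map b ^^ n) (v x) \<noteq> 0"
proof (induction n rule: less_induct)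
  case (less n)
  then have "split_coords ((G ^^ n) x) = ((cf_map a ^^ n) (u x), (cf_map b ^^ n) (v x))"
    by (intro split_coords_funpow) auto
  moreover have "(G ^^ n) x \<notin> null_cone"
    using assms unfolding infinite_digits_def by blast
  ultimately show ?case unfolding null_cone_coords by simp
qed

lemma infinite_digits_gauss: "infinite_digits K x \<Longrightarrow> infinite_digits K (G x)"
  unfolding infinite_digits_def by (metis funpow.simps(2) funpow_swap1 o_apply)

lemma cf_digit_Suc: "cf_digit K x (Suc i) = cf_digit K (G x) i"
  by (simp add: cf_digit_def funpow_swap1)

text \<open>Since no denominator vanishes, the extended-real evaluation stays finite at every level
  and agrees with the real one.\<close>

lemma cf_value_eq:
  assumes "x \<in> K" "infinite_digits K x"
  shows "cf_value (map (cf_digit K x) [0..<n]) = (ereal (cf_approx a (u x) n), ereal (cf_approx b (v x) n))"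
  using assms
proof (induction n arbitrary: x)
  case 0
  then show ?case by (simp add: zero_ereal_def)
next
  case (Suc n)
  have x0: "x \<notin> null_cone" using Suc.prems(2) unfolding infinite_digits_def by (metis funpow_0)
  have list: "map (cf_digit K x) [0..<Suc n] = cf_digit K x 0 # map (cf_digit K (G x)) [0..<n]"
    by (simp add: map_upt_Suc cf_digit_Suc del: upt_Suc)
  have IH: "cf_value (map (cf_digit K (G x)) [0..<n]) =
      (ereal (cf_approx a (cf_map a (u x)) n), ereal (cf_approx b (cf_map b (v x)) n))"
    using Suc.IH[OF gauss_in_K infinite_digits_gauss[OF Suc.prems(2)]] by (simp add: split_coords_gauss[OF x0])
  have dg: "split_coords (cf_digit K x 0) = (of_int \<lfloor>1 / u x + a\<rfloor>, of_int \<lfloor>1 / v x + b\<rfloor>)"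
    using split_coords_cf_digit[of 0 x] x0 by simp
  have "u x \<in> cf_interval a" "v x \<in> cf_interval b"
    using Suc.prems(1) by (auto simp: mem_K)
  then have nz: "of_int \<lfloor>1 / u x + a\<rfloor> + cf_approx a (cf_map a (u x)) n \<noteq> 0"
      "of_int \<lfloor>1 / v x + b\<rfloor> + cf_approx b (cf_map b (v x)) n \<noteq> 0"
    using U.cf_approx_denominator V.cf_approx_denominator infinite_digits_coords[OF Suc.prems(2)] by blast+
  show ?case
    unfolding list using nz by (simp add: IH ext_coords_def dg inverse_eq_divide)
qed

lemma convergent: "cf_convergent K"
  unfolding cf_convergent_def
proof (intro ballI impI)
  fix x assume x: "x \<in> K" "infinite_digits K x"
  have J: "u x \<in> cf_interval a" "v x \<in> cf_interval b"
    using x(1) by (auto simp: mem_K)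
  have "cf_approx a (u x) \<longlonglongrightarrow> u x" "cf_approx b (v x) \<longlonglongrightarrow> v x"
    using U.cf_approx_tendsto[OF J(1)] V.cf_approx_tendsto[OF J(2)] infinite_digits_coords[OF x(2)] by blast+
  then have "(\<lambda>n. (ereal (cf_approx a (u x) n), ereal (cf_approx b (v x) n))) \<longlonglongrightarrow> (ereal (u x), ereal (v x))"
    by (intro tendsto_Pair tendsto_ereal)
  then show "(\<lambda>n. cf_value (map (cf_digit K x) [0..<n])) \<longlonglongrightarrow> ext_coords x"
    unfolding cf_value_eq[OF x] by (simp add: ext_coords_def map_prod_def case_prod_beta)
qed

end

section \<open>Exactness\<close>

lemma emeasure_lebesgue_borel: "S \<in> sets borel \<Longrightarrow> emeasure lebesgue S = emeasure lborel S"
  by simp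

lemma borel_approx_lebesgue:
  fixes E :: "'a::euclidean_space set"
  assumes "E \<in> sets lebesgue"
  obtains S N where "S \<in> sets borel" "N \<in> null_sets lborel" "S \<subseteq> E" "E \<subseteq> S \<union> N"
    "emeasure lebesgue E = emeasure lborel S"
proof -
  obtain S N N' where SN: "E = S \<union> N" "N \<subseteq> N'" "N' \<in> null_sets lborel" "S \<in> sets lborel"
    using sets_completionE[OF assms] .
  have "emeasure lebesgue E = emeasure lborel S"
  proof (rule antisym)
    have "emeasure lebesgue E \<le> emeasure lebesgue (S \<union> N')"
      using SN by (intro emeasure_mono) (auto simp: null_sets_def)
    also have "\<dots> = emeasure lborel (S \<union> N')"
      using SN by (intro emeasure_lebesgue_borel) (auto simp: null_sets_def)
    also have "\<dots> = emeasure lborel S"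
      using SN by (intro emeasure_Un_null_set) auto
    finally show "emeasure lebesgue E \<le> emeasure lborel S" .
    have "emeasure lborel S = emeasure lebesgue S"
      using SN(4) by simp
    also have "\<dots> \<le> emeasure lebesgue E"
      using SN(1) assms by (intro emeasure_mono) auto
    finally show "emeasure lborel S \<le> emeasure lebesgue E" .
  qed
  then show ?thesis using that[of S N'] SN by auto
qed

lemma lebesgue_between:
  fixes E :: "'a::euclidean_space set"
  assumes "S \<in> sets borel" "N \<in> null_sets lborel" "S \<subseteq> E" "E \<subseteq> S \<union> N"
  shows "E \<in> sets lebesgue"
proof (rule sets_completionI)
  show "E = S \<union> (E - S)" using assms(3) by blast
  show "E - S \<subseteq> N" using assms(4) by blast
qed (use assms in auto)

context split_cf
begin

lemma borel_gauss [measurable]: "G \<in> borel_measurable borel"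
proof -
  have [measurable]: "u \<in> borel_measurable borel" "v \<in> borel_measurable borel"
    unfolding split_coords_def borel_prod[symmetric] by measurable
  have "G = (\<lambda>x. if u x = 0 \<or> v x = 0 then 0 else split_uncoords (cf_map a (u x), cf_map b (v x)))"
    using gauss_eq by auto
  also have "\<dots> \<in> borel_measurable borel"
  proof (rule measurable_If)
    have "(\<lambda>x. (cf_map a (u x), cf_map b (v x))) \<in> borel_measurable borel"
      by (intro borel_measurable_Pair measurable_compose[OF _ U.borel_cf_map] measurable_compose[OF _ V.borel_cf_map]) auto
    then show "(\<lambda>x. split_uncoords (cf_map a (u x), cf_map b (v x))) \<in> borel_measurable borel"
      by (rule measurable_compose[OF _ borel_split_uncoords])
  qed auto
  finally show ?thesis .
qed

lemma borel_K [measurable]: "K \<in> sets borel"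
  unfolding K_def by (rule measurable_sets_borel[OF borel_split_coords]) auto

lemma borel_gauss_funpow: "(G ^^ n) \<in> borel_measurable borel"
  by (rule funpow_measurable[OF borel_gauss])

lemma borel_gauss_vimage: "E \<in> sets borel \<Longrightarrow> (G ^^ n) -` E \<in> sets borel"
  by (rule measurable_sets_borel[OF borel_gauss_funpow])

section \<open>Bounds for the product map and their transfer to K\<close>

abbreviation "prod_map n \<equiv> map_prod (cf_map a ^^ n) (cf_map b ^^ n)"
abbreviation "square \<equiv> cf_interval a \<times> cf_interval b"

lemma borel_prod_map: "E \<in> sets borel \<Longrightarrow> prod_map n -` E \<in> sets borel"
  by (rule measurable_sets_borel[OF borel_map_prod]) auto

lemma prod_upper:
  obtains B where "0 < B" "\<And>n E. E \<in> sets borel \<Longrightarrow> E \<subseteq> square \<Longrightarrow>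
    emeasure lborel (square \<inter> prod_map n -` E) \<le> ennreal B * emeasure lborel E"
proof -
  obtain B where B: "0 < B" "\<And>n E. E \<in> sets borel \<Longrightarrow> E \<subseteq> cf_interval a \<Longrightarrow>
      emeasure lborel (cf_interval a \<inter> (cf_map a ^^ n) -` E) \<le> ennreal B * emeasure lborel E"
    using U.upper_bound by blast
  obtain B' where B': "0 < B'" "\<And>n E. E \<in> sets borel \<Longrightarrow> E \<subseteq> cf_interval b \<Longrightarrow>
      emeasure lborel (cf_interval b \<inter> (cf_map b ^^ n) -` E) \<le> ennreal B' * emeasure lborel E"
    using V.upper_bound by blast
  have maps: "(cf_map a ^^ n) x \<in> cf_interval a" if "x \<in> cf_interval a" for n x
    using that by (induction n) (auto intro: U.cf_map_in_J)
  show ?thesis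
  proof (rule that[of "B * B'"])
    fix n and E :: "(real \<times> real) set" assume E: "E \<in> sets borel" "E \<subseteq> square"
    have "emeasure lborel (square \<inter> prod_map n -` E) \<le> ennreal B * ennreal B' * emeasure lborel E"
      by (rule product_upper[OF U.borel_funpow V.borel_funpow U.borel_J V.borel_J U.borel_J V.borel_J maps B(2) B'(2) E])
    then show "emeasure lborel (square \<inter> prod_map n -` E) \<le> ennreal (B * B') * emeasure lborel E"
      using B(1) B'(1) by (simp add: ennreal_mult)
  qed (use B B' in simp)
qed

lemma prod_lower:
  obtains c where "0 < c" "\<And>I I'. is_interval I \<Longrightarrow> I \<subseteq> cf_interval a \<Longrightarrow> I \<in> sets borel \<Longrightarrow>
      is_interval I' \<Longrightarrow> I' \<subseteq> cf_interval b \<Longrightarrow> I' \<in> sets borel \<Longrightarrow>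
      \<exists>n0. \<forall>n\<ge>n0. \<forall>E\<in>sets borel. E \<subseteq> square \<longrightarrow>
        ennreal c * emeasure lborel (I \<times> I') * emeasure lborel E \<le> emeasure lborel (I \<times> I' \<inter> prod_map n -` E)"
proof -
  obtain c where c: "0 < c" "\<And>I. is_interval I \<Longrightarrow> I \<subseteq> cf_interval a \<Longrightarrow> I \<in> sets borel \<Longrightarrow>
      \<exists>n0. \<forall>n\<ge>n0. \<forall>E\<in>sets borel. E \<subseteq> cf_interval a \<longrightarrow>
        ennreal c * emeasure lborel I * emeasure lborel E \<le> emeasure lborel (I \<inter> (cf_map a ^^ n) -` E)"
    using U.lower_bound by blast
  obtain c' where c': "0 < c'" "\<And>I. is_interval I \<Longrightarrow> I \<subseteq> cf_interval b \<Longrightarrow> I \<in> sets borel \<Longrightarrow>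
      \<exists>n0. \<forall>n\<ge>n0. \<forall>E\<in>sets borel. E \<subseteq> cf_interval b \<longrightarrow>
        ennreal c' * emeasure lborel I * emeasure lborel E \<le> emeasure lborel (I \<inter> (cf_map b ^^ n) -` E)"
    using V.lower_bound by blast
  show ?thesis
  proof (rule that[of "c * c'"])
    fix I I' assume I: "is_interval I" "I \<subseteq> cf_interval a" "I \<in> sets borel"
      and I': "is_interval I'" "I' \<subseteq> cf_interval b" "I' \<in> sets borel"
    obtain n1 where n1: "\<And>n E. n1 \<le> n \<Longrightarrow> E \<in> sets borel \<Longrightarrow> E \<subseteq> cf_interval a \<Longrightarrow>
        ennreal c * emeasure lborel I * emeasure lborel E \<le> emeasure lborel (I \<inter> (cf_map a ^^ n) -` E)"
      using c(2)[OF I] by blast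
    obtain n2 where n2: "\<And>n E. n2 \<le> n \<Longrightarrow> E \<in> sets borel \<Longrightarrow> E \<subseteq> cf_interval b \<Longrightarrow>
        ennreal c' * emeasure lborel I' * emeasure lborel E \<le> emeasure lborel (I' \<inter> (cf_map b ^^ n) -` E)"
      using c'(2)[OF I'] by blast
    have II: "emeasure lborel (I \<times> I') = emeasure lborel I * emeasure lborel I'"
      using lborel.emeasure_pair_measure_Times[of I lborel I'] I(3) I'(3) by (simp add: lborel_prod)
    show "\<exists>n0. \<forall>n\<ge>n0. \<forall>E\<in>sets borel. E \<subseteq> square \<longrightarrow>
        ennreal (c * c') * emeasure lborel (I \<times> I') * emeasure lborel E \<le> emeasure lborel (I \<times> I' \<inter> prod_map n -` E)"
    proof (intro exI[of _ "max n1 n2"] allI impI ballI)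
      fix n and E :: "(real \<times> real) set" assume n: "max n1 n2 \<le> n" and E: "E \<in> sets borel" "E \<subseteq> square"
      have "ennreal c * emeasure lborel I * (ennreal c' * emeasure lborel I') * emeasure lborel E \<le>
          emeasure lborel (I \<times> I' \<inter> prod_map n -` E)"
        by (rule product_lower[OF U.borel_funpow V.borel_funpow I(3) I'(3) U.borel_J V.borel_J n1 n2 E]) (use n in auto)
      moreover have "ennreal (c * c') = ennreal c * ennreal c'" using c(1) c'(1) by (simp add: ennreal_mult)
      ultimately show "ennreal (c * c') * emeasure lborel (I \<times> I') * emeasure lborel E \<le> emeasure lborel (I \<times> I' \<inter> prod_map n -` E)"
        by (simp add: II mult_ac)
    qed
  qed (use c c' in simp)
qed

text \<open>Outside this set the iterates of the Gauss map and of the product map correspond on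
  \<open>K\<close>. A zero of either coordinate counts whatever the other does, hence the cross
  formed by both axes of the square.\<close>

definition singular_orbits :: "split set" where
  "singular_orbits = split_coords -` (\<Union>k. square \<inter> prod_map k -` ({0} \<times> cf_interval b \<union> cf_interval a \<times> {0}))"

text \<open>The two axes of the square are null, and by the upper bound so is each of their
  countably many preimages.\<close>

lemma null_singular_orbits: "singular_orbits \<in> null_sets lborel"
proof -
  obtain B where B: "0 < B" "\<And>n E. E \<in> sets borel \<Longrightarrow> E \<subseteq> square \<Longrightarrow>
      emeasure lborel (square \<inter> prod_map n -` E) \<le> ennreal B * emeasure lborel E"
    using prod_upper by blast
  let ?Z = "{0} \<times> cf_interval b \<union> cf_interval a \<times> {0} :: (real \<times> real) set"
  have Z: "?Z \<in> sets borel" by (intro sets.Un borel_Times_real) auto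
  have "emeasure lborel ?Z = 0"
  proof -
    have "emeasure lborel ({0 :: real} \<times> cf_interval b) = 0" "emeasure lborel (cf_interval a \<times> {0 :: real}) = 0"
      using lborel.emeasure_pair_measure_Times[of "{0 :: real}" lborel "cf_interval b"]
        lborel.emeasure_pair_measure_Times[of "cf_interval a" lborel "{0 :: real}"] by (simp_all add: lborel_prod)
    then have "{0 :: real} \<times> cf_interval b \<in> null_sets lborel" "cf_interval a \<times> {0 :: real} \<in> null_sets lborel"
      by (simp_all add: null_sets_def borel_Times_real)
    then have "?Z \<in> null_sets lborel" by (rule null_sets.Un)
    then show ?thesis by (rule null_setsD1)
  qed
  moreover have "?Z \<subseteq> square" using U.zero_in_J V.zero_in_J by auto
  ultimately have "emeasure lborel (square \<inter> prod_map k -` ?Z) = 0" for k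
    using B(2)[OF Z, of k] by simp
  then have "square \<inter> prod_map k -` ?Z \<in> null_sets lborel" for k
    using borel_prod_map[OF Z, of k] by (auto simp: null_sets_def intro!: sets.Int borel_Times_real)
  then have N: "(\<Union>k. square \<inter> prod_map k -` ?Z) \<in> null_sets lborel"
    by (rule null_sets_UN)
  then have N': "(\<Union>k. square \<inter> prod_map k -` ?Z) \<in> sets borel" by (auto simp: null_sets_def)
  have "2 * emeasure lborel singular_orbits = emeasure lborel (\<Union>k. square \<inter> prod_map k -` ?Z)"
    unfolding singular_orbits_def by (rule emeasure_split_coords_vimage[OF N'])
  then have "emeasure lborel singular_orbits = 0" using N by (simp add: null_sets_def)
  moreover have "singular_orbits \<in> sets borel"
    unfolding singular_orbits_def by (rule measurable_sets_borel[OF borel_split_coords N'])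
  ultimately show ?thesis by (simp add: null_sets_def)
qed

lemma split_coords_funpow_regular:
  assumes "x \<in> K" "x \<notin> singular_orbits"
  shows "split_coords ((G ^^ n) x) = prod_map n (split_coords x)"
proof -
  have x: "u x \<in> cf_interval a" "v x \<in> cf_interval b" using assms(1) by (auto simp: mem_K)
  have "(cf_map a ^^ k) (u x) \<noteq> 0 \<and> (cf_map b ^^ k) (v x) \<noteq> 0" for k
  proof -
    have "(cf_map a ^^ k) (u x) \<in> cf_interval a"
      using x by (induction k) (simp_all add: U.cf_map_in_J)
    moreover have "(cf_map b ^^ k) (v x) \<in> cf_interval b"
      using x by (induction k) (simp_all add: V.cf_map_in_J)
    moreover have "split_coords x \<notin> square \<inter> prod_map k -` ({0} \<times> cf_interval b \<union> cf_interval a \<times> {0})"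
    proof
      assume *: "split_coords x \<in> square \<inter> prod_map k -` ({0} \<times> cf_interval b \<union> cf_interval a \<times> {0})"
      have "x \<in> singular_orbits"
        unfolding singular_orbits_def vimage_eq UN_iff by (intro bexI[of _ k] * UNIV_I)
      then show False using assms(2) by contradiction
    qed
    ultimately show ?thesis using x by (simp add: mem_Times_iff map_prod_def case_prod_beta)
  qed
  then show ?thesis using split_coords_funpow[of n x] by (simp add: map_prod_def case_prod_beta)
qed

text \<open>The factor \<open>2\<close> is the determinant of \<^const>\<open>split_coords\<close>.\<close>

lemma emeasure_gauss_vimage:
  assumes E: "E \<in> sets borel" "E \<subseteq> K" and R: "R \<in> sets borel" "R \<subseteq> square"
  shows "2 * emeasure lborel (split_coords -` R \<inter> (G ^^ n) -` E) =
    emeasure lborel (R \<inter> prod_map n -` (split_uncoords -` E))"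
proof -
  have E': "split_uncoords -` E \<in> sets borel"
    by (rule measurable_sets_borel[OF borel_split_uncoords E(1)])
  have R': "R \<inter> prod_map n -` (split_uncoords -` E) \<in> sets borel"
    using R(1) borel_prod_map[OF E'] by auto
  let ?X = "split_coords -` R \<inter> (G ^^ n) -` E"
  let ?Y = "split_coords -` (R \<inter> prod_map n -` (split_uncoords -` E))"
  have X: "?X \<in> sets lborel"
    using measurable_sets_borel[OF borel_split_coords R(1)] borel_gauss_vimage[OF E(1)] by auto
  have Y: "?Y \<in> sets lborel" using measurable_sets_borel[OF borel_split_coords R'] by simp
  have "x \<in> ?X \<longleftrightarrow> x \<in> ?Y" if "x \<notin> singular_orbits" for x
  proof (cases "split_coords x \<in> R")
    case True
    then have "x \<in> K" using R(2) by (auto simp: K_def)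
    have "prod_map n (split_coords x) = split_coords ((G ^^ n) x)"
      using split_coords_funpow_regular[OF \<open>x \<in> K\<close> that, of n] by simp
    then have "split_uncoords (prod_map n (split_coords x)) = (G ^^ n) x" by simp
    then show ?thesis using True by simp
  qed simp
  then have "emeasure lborel ?X = emeasure lborel ?Y"
    by (intro emeasure_eq_AE[OF _ X Y] AE_I'[OF null_singular_orbits]) auto
  then show ?thesis using emeasure_split_coords_vimage[OF R'] by simp
qed

lemma borel_upper:
  obtains B where "0 < B" "\<And>n E. E \<in> sets borel \<Longrightarrow> E \<subseteq> K \<Longrightarrow>
    emeasure lborel (K \<inter> (G ^^ n) -` E) \<le> ennreal B * emeasure lborel E"
proof -
  obtain B where B: "0 < B" "\<And>n E. E \<in> sets borel \<Longrightarrow> E \<subseteq> square \<Longrightarrow>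
      emeasure lborel (square \<inter> prod_map n -` E) \<le> ennreal B * emeasure lborel E"
    using prod_upper by blast
  show ?thesis
  proof (rule that[OF B(1)])
    fix n and E :: "split set" assume E: "E \<in> sets borel" "E \<subseteq> K"
    let ?E = "split_uncoords -` E"
    have E': "?E \<in> sets borel" by (rule measurable_sets_borel[OF borel_split_uncoords E(1)])
    have sub: "?E \<subseteq> square"
    proof
      fix p assume "p \<in> ?E"
      then have "split_uncoords p \<in> K" using E(2) by auto
      then show "p \<in> square" by (simp add: K_def)
    qed
    have EE: "split_coords -` ?E = E" by (simp add: vimage_def)
    have "2 * emeasure lborel (K \<inter> (G ^^ n) -` E) = emeasure lborel (square \<inter> prod_map n -` ?E)"
      unfolding K_def by (rule emeasure_gauss_vimage[OF E, unfolded K_def]) auto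
    also have "\<dots> \<le> ennreal B * emeasure lborel ?E" by (rule B(2)[OF E' sub])
    also have "emeasure lborel ?E = 2 * emeasure lborel E"
      using emeasure_split_coords_vimage[OF E'] EE by simp
    finally have "2 * emeasure lborel (K \<inter> (G ^^ n) -` E) \<le> 2 * (ennreal B * emeasure lborel E)"
      by (simp add: mult_ac)
    then show "emeasure lborel (K \<inter> (G ^^ n) -` E) \<le> ennreal B * emeasure lborel E"
      by (subst (asm) ennreal_mult_le_mult_iff) auto
  qed
qed

lemma borel_lower:
  obtains c where "0 < c" "\<And>I I'. is_interval I \<Longrightarrow> I \<subseteq> cf_interval a \<Longrightarrow> I \<in> sets borel \<Longrightarrow>
      is_interval I' \<Longrightarrow> I' \<subseteq> cf_interval b \<Longrightarrow> I' \<in> sets borel \<Longrightarrow>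
      \<exists>n0. \<forall>n\<ge>n0. \<forall>E\<in>sets borel. E \<subseteq> K \<longrightarrow>
        ennreal c * emeasure lborel (split_coords -` (I \<times> I')) * emeasure lborel E \<le>
        emeasure lborel (split_coords -` (I \<times> I') \<inter> (G ^^ n) -` E)"
proof -
  obtain c where c: "0 < c" "\<And>I I'. is_interval I \<Longrightarrow> I \<subseteq> cf_interval a \<Longrightarrow> I \<in> sets borel \<Longrightarrow>
      is_interval I' \<Longrightarrow> I' \<subseteq> cf_interval b \<Longrightarrow> I' \<in> sets borel \<Longrightarrow>
      \<exists>n0. \<forall>n\<ge>n0. \<forall>E\<in>sets borel. E \<subseteq> square \<longrightarrow>
        ennreal c * emeasure lborel (I \<times> I') * emeasure lborel E \<le> emeasure lborel (I \<times> I' \<inter> prod_map n -` E)"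
    using prod_lower by blast
  show ?thesis
  proof (rule that[OF c(1)])
    fix I I' assume I: "is_interval I" "I \<subseteq> cf_interval a" "I \<in> sets borel"
      "is_interval I'" "I' \<subseteq> cf_interval b" "I' \<in> sets borel"
    obtain n0 where n0: "\<And>n E. n0 \<le> n \<Longrightarrow> E \<in> sets borel \<Longrightarrow> E \<subseteq> square \<Longrightarrow>
        ennreal c * emeasure lborel (I \<times> I') * emeasure lborel E \<le> emeasure lborel (I \<times> I' \<inter> prod_map n -` E)"
      using c(2)[OF I] by blast
    let ?R = "split_coords -` (I \<times> I')"
    show "\<exists>n0. \<forall>n\<ge>n0. \<forall>E\<in>sets borel. E \<subseteq> K \<longrightarrow>
        ennreal c * emeasure lborel ?R * emeasure lborel E \<le> emeasure lborel (?R \<inter> (G ^^ n) -` E)"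
    proof (intro exI[of _ n0] allI impI ballI)
      fix n and E :: "split set" assume n: "n0 \<le> n" and E: "E \<in> sets borel" "E \<subseteq> K"
      let ?E = "split_uncoords -` E"
      have E': "?E \<in> sets borel" by (rule measurable_sets_borel[OF borel_split_uncoords E(1)])
      have sub: "?E \<subseteq> square"
      proof
        fix p assume "p \<in> ?E"
        then have "split_uncoords p \<in> K" using E(2) by auto
        then show "p \<in> square" by (simp add: K_def)
      qed
      have EE: "split_coords -` ?E = E" by (simp add: vimage_def)
      have II: "I \<times> I' \<in> sets borel" "I \<times> I' \<subseteq> square" using I by auto
      have "2 * (ennreal c * emeasure lborel ?R * emeasure lborel E) =
          ennreal c * (2 * emeasure lborel ?R) * emeasure lborel E" by (simp add: mult_ac)
      \<comment> \<open>One of the two factors \<open>2\<close> is given away so that the constant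
        \<open>c\<close> stays the same.\<close>
      also have "\<dots> \<le> ennreal c * (2 * emeasure lborel ?R) * (2 * emeasure lborel E)"
        by (intro mult_left_mono) (auto simp: mult_2 add_increasing)
      also have "\<dots> = ennreal c * emeasure lborel (I \<times> I') * emeasure lborel ?E"
        using emeasure_split_coords_vimage[OF II(1)] emeasure_split_coords_vimage[OF E'] EE by simp
      also have "\<dots> \<le> emeasure lborel (I \<times> I' \<inter> prod_map n -` ?E)" by (rule n0[OF n E' sub])
      also have "\<dots> = 2 * emeasure lborel (?R \<inter> (G ^^ n) -` E)"
        by (rule emeasure_gauss_vimage[OF E II, symmetric])
      finally show "ennreal c * emeasure lborel ?R * emeasure lborel E \<le> emeasure lborel (?R \<inter> (G ^^ n) -` E)"
        by (subst (asm) ennreal_mult_le_mult_iff) auto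
    qed
  qed
qed

end

lemma differentiable_split_inv:
  assumes "x \<notin> null_cone"
  shows "split_inv differentiable at x within S"
proof -
  have Q: "(fst x)\<^sup>2 - (snd x)\<^sup>2 \<noteq> 0"
    using assms by (simp add: null_cone_def split_Q_def)
  have lin: "(fst :: split \<Rightarrow> real) differentiable at x within S" "(snd :: split \<Rightarrow> real) differentiable at x within S"
    by (auto intro!: bounded_linear_imp_differentiable bounded_linear_fst bounded_linear_snd)
  have "(\<lambda>y :: split. (inverse ((fst y)\<^sup>2 - (snd y)\<^sup>2)) *\<^sub>R (fst y, - snd y)) differentiable at x within S"
    by (intro derivative_intros lin Q)
  then show ?thesis
    by (simp add: split_inv_def[abs_def] split_cnj_def split_Q_def)
qed

section \<open>From Borel sets to Lebesgue measurable sets\<close>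

context split_cf
begin

abbreviation "M \<equiv> lebesgue_on K"

lemma sets_M: "E \<in> sets M \<longleftrightarrow> E \<in> sets lebesgue \<and> E \<subseteq> K"
  by (auto simp: sets_restrict_space_iff)

lemma emeasure_M: "E \<in> sets M \<Longrightarrow> emeasure M E = emeasure lebesgue E"
  by (subst emeasure_restrict_space) (auto simp: sets_M)

lemma emeasure_M_borel: "E \<in> sets borel \<Longrightarrow> E \<subseteq> K \<Longrightarrow> emeasure M E = emeasure lborel E"
  using emeasure_M[of E] emeasure_lebesgue_borel[of E] by (simp add: sets_M)

lemma emeasure_K: "emeasure M K = ennreal (1 / 2)"
proof -
  have "2 * emeasure lborel K = emeasure lborel square"
    unfolding K_def by (rule emeasure_split_coords_vimage) auto
  also have "\<dots> = 1"
    using lborel.emeasure_pair_measure_Times[of "cf_interval a" lborel "cf_interval b"]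
    by (simp add: lborel_prod U.emeasure_J V.emeasure_J)
  also have "1 = 2 * ennreal (1 / 2)" by (subst ennreal_numeral[symmetric], subst ennreal_mult[symmetric]) auto
  finally have "emeasure lborel K = ennreal (1 / 2)"
    by (subst (asm) ennreal_mult_cancel_left) auto
  then show ?thesis using emeasure_M_borel[OF borel_K] by simp
qed

lemma finite_M: "finite_measure M"
  by (rule finite_measureI) (simp add: emeasure_K)

lemma measure_le_iff:
  "0 \<le> k \<Longrightarrow> measure M A \<le> k * measure M E \<longleftrightarrow> emeasure M A \<le> ennreal k * emeasure M E"
  by (simp add: finite_measure.emeasure_eq_measure[OF finite_M] ennreal_mult[symmetric])

text \<open>The bounds for the iterates so far concern Borel sets. They are transferred by enclosing
  a Lebesgue measurable set between a Borel set and its union with a Borel null set.\<close>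

lemma borel_approx_M:
  assumes "E \<in> sets M"
  obtains S N where "S \<in> sets borel" "N \<in> sets borel" "N \<subseteq> K" "emeasure lborel N = 0" "S \<subseteq> E" "E \<subseteq> S \<union> N"
    "emeasure M E = emeasure lborel S" "emeasure lborel (S \<union> N) = emeasure lborel S" "S \<subseteq> K"
proof -
  obtain S N where SN: "S \<in> sets borel" "N \<in> null_sets lborel" "S \<subseteq> E" "E \<subseteq> S \<union> N"
    "emeasure lebesgue E = emeasure lborel S"
    using borel_approx_lebesgue assms sets_M by metis
  have N: "N \<inter> K \<in> null_sets lborel" using SN(2) by (rule null_set_Int2) simp
  show ?thesis
  proof (rule that[of S "N \<inter> K"])
    show "emeasure lborel (S \<union> N \<inter> K) = emeasure lborel S"
      using N SN(1) by (intro emeasure_Un_null_set) auto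
  qed (use SN N assms in \<open>auto simp: sets_M emeasure_M null_sets_def\<close>)
qed

text \<open>Borel measurability does not suffice for the completed measure: preimages of null sets
  must be null, which is the upper bound for \<open>n = 1\<close>.\<close>

lemma gauss_measurable: "G \<in> measurable M M"
proof (rule measurableI)
  show "G x \<in> space M" for x using gauss_in_K by simp
  fix E assume "E \<in> sets M"
  then obtain S N where SN: "S \<in> sets borel" "N \<in> sets borel" "N \<subseteq> K" "emeasure lborel N = 0" "S \<subseteq> E" "E \<subseteq> S \<union> N"
    using borel_approx_M by metis
  obtain B where B: "\<And>n E. E \<in> sets borel \<Longrightarrow> E \<subseteq> K \<Longrightarrow>
      emeasure lborel (K \<inter> (G ^^ n) -` E) \<le> ennreal B * emeasure lborel E"
    using borel_upper by blast
  have "K \<inter> G -` N \<in> null_sets lborel"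
    using B[OF SN(2,3), of 1] SN(4) borel_gauss_vimage[OF SN(2), of 1] by (simp add: null_sets_def)
  then have "G -` E \<inter> K \<in> sets lebesgue"
  proof (rule lebesgue_between[rotated])
    show "K \<inter> G -` S \<in> sets borel" using borel_gauss_vimage[OF SN(1), of 1] by simp
  qed (use SN in auto)
  then show "G -` E \<inter> space M \<in> sets M" by (auto simp: sets_M)
qed

lemma gauss_funpow_vimage: "E \<in> sets M \<Longrightarrow> (G ^^ n) -` E \<inter> K \<in> sets M"
  using measurable_sets[OF funpow_measurable[OF gauss_measurable]] by simp

lemma upper_M:
  obtains B where "0 < B" "\<And>n E. E \<in> sets M \<Longrightarrow> measure M ((G ^^ n) -` E \<inter> K) \<le> B * measure M E"
proof -
  obtain B where B: "0 < B" "\<And>n E. E \<in> sets borel \<Longrightarrow> E \<subseteq> K \<Longrightarrow>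
      emeasure lborel (K \<inter> (G ^^ n) -` E) \<le> ennreal B * emeasure lborel E"
    using borel_upper by blast
  show ?thesis
  proof (rule that[OF B(1)])
    fix n E assume E: "E \<in> sets M"
    obtain S N where SN: "S \<in> sets borel" "N \<in> sets borel" "N \<subseteq> K" "E \<subseteq> S \<union> N"
      "emeasure M E = emeasure lborel S" "emeasure lborel (S \<union> N) = emeasure lborel S" "S \<subseteq> K"
      using borel_approx_M[OF E] by metis
    have X: "K \<inter> (G ^^ n) -` (S \<union> N) \<in> sets borel"
      using borel_gauss_vimage[of "S \<union> N"] SN(1,2) by simp
    have "emeasure M ((G ^^ n) -` E \<inter> K) \<le> emeasure M (K \<inter> (G ^^ n) -` (S \<union> N))"
      using SN X by (intro emeasure_mono) (auto simp: sets_M)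
    also have "\<dots> = emeasure lborel (K \<inter> (G ^^ n) -` (S \<union> N))"
      by (rule emeasure_M_borel[OF X]) simp
    also have "\<dots> \<le> ennreal B * emeasure lborel (S \<union> N)"
      by (rule B(2)) (use SN in auto)
    finally have "emeasure M ((G ^^ n) -` E \<inter> K) \<le> ennreal B * emeasure M E"
      using SN by simp
    then show "measure M ((G ^^ n) -` E \<inter> K) \<le> B * measure M E"
      using B(1) by (simp add: measure_le_iff)
  qed
qed

lemma lower_M:
  obtains c where "0 < c" "\<And>I I'. is_interval I \<Longrightarrow> I \<subseteq> cf_interval a \<Longrightarrow> I \<in> sets borel \<Longrightarrow>
      is_interval I' \<Longrightarrow> I' \<subseteq> cf_interval b \<Longrightarrow> I' \<in> sets borel \<Longrightarrow>
      \<exists>n0. \<forall>n\<ge>n0. \<forall>E\<in>sets M. c * measure M (split_coords -` (I \<times> I')) * measure M E \<le>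
        measure M (split_coords -` (I \<times> I') \<inter> (G ^^ n) -` E)"
proof -
  obtain c where c: "0 < c" "\<And>I I'. is_interval I \<Longrightarrow> I \<subseteq> cf_interval a \<Longrightarrow> I \<in> sets borel \<Longrightarrow>
      is_interval I' \<Longrightarrow> I' \<subseteq> cf_interval b \<Longrightarrow> I' \<in> sets borel \<Longrightarrow>
      \<exists>n0. \<forall>n\<ge>n0. \<forall>E\<in>sets borel. E \<subseteq> K \<longrightarrow>
        ennreal c * emeasure lborel (split_coords -` (I \<times> I')) * emeasure lborel E \<le>
        emeasure lborel (split_coords -` (I \<times> I') \<inter> (G ^^ n) -` E)"
    using borel_lower by blast
  show ?thesis
  proof (rule that[OF c(1)])
    fix I I' assume I: "is_interval I" "I \<subseteq> cf_interval a" "I \<in> sets borel"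
      "is_interval I'" "I' \<subseteq> cf_interval b" "I' \<in> sets borel"
    let ?R = "split_coords -` (I \<times> I')"
    have R: "?R \<in> sets borel" "?R \<subseteq> K"
      using measurable_sets_borel[OF borel_split_coords] I by (auto simp: K_def)
    obtain n0 where n0: "\<And>n E. n0 \<le> n \<Longrightarrow> E \<in> sets borel \<Longrightarrow> E \<subseteq> K \<Longrightarrow>
        ennreal c * emeasure lborel ?R * emeasure lborel E \<le> emeasure lborel (?R \<inter> (G ^^ n) -` E)"
      using c(2)[OF I] by blast
    show "\<exists>n0. \<forall>n\<ge>n0. \<forall>E\<in>sets M. c * measure M ?R * measure M E \<le> measure M (?R \<inter> (G ^^ n) -` E)"
    proof (intro exI[of _ n0] allI impI ballI)
      fix n E assume n: "n0 \<le> n" and E: "E \<in> sets M"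
      obtain S N where SN: "S \<in> sets borel" "S \<subseteq> E" "emeasure M E = emeasure lborel S" "S \<subseteq> K"
        using borel_approx_M[OF E] by metis
      have X: "?R \<inter> (G ^^ n) -` S \<in> sets borel" using R(1) borel_gauss_vimage[OF SN(1)] by simp
      have Y: "?R \<inter> (G ^^ n) -` E \<in> sets M"
      proof -
        have "?R \<inter> (G ^^ n) -` E = ?R \<inter> ((G ^^ n) -` E \<inter> K)" using R(2) by auto
        moreover have "?R \<in> sets M" using R by (simp add: sets_M)
        ultimately show ?thesis using gauss_funpow_vimage[OF E] by auto
      qed
      have "ennreal c * emeasure M ?R * emeasure M E = ennreal c * emeasure lborel ?R * emeasure lborel S"
        using SN emeasure_M_borel[OF R] by simp
      also have "\<dots> \<le> emeasure lborel (?R \<inter> (G ^^ n) -` S)" by (rule n0[OF n SN(1,4)])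
      also have "\<dots> = emeasure M (?R \<inter> (G ^^ n) -` S)"
        by (rule emeasure_M_borel[OF X, symmetric]) (use R in auto)
      also have "\<dots> \<le> emeasure M (?R \<inter> (G ^^ n) -` E)"
        by (rule emeasure_mono[OF _ Y]) (use SN in auto)
      finally show "c * measure M ?R * measure M E \<le> measure M (?R \<inter> (G ^^ n) -` E)"
        using c(1) by (simp add: finite_measure.emeasure_eq_measure[OF finite_M] ennreal_mult[symmetric])
    qed
  qed
qed

text \<open>Even continuous maps may send a Lebesgue measurable set to a non-measurable one. Here
  \<open>G\<close> is differentiable on each of countably many sets with fixed digits, and
  differentiable maps between spaces of equal dimension preserve measurability. The null cone goes
  to the single point \<open>0\<close>.\<close>

lemma gauss_image: "A \<in> sets M \<Longrightarrow> G ` A \<in> sets M"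
proof -
  assume A: "A \<in> sets M"
  have [measurable]: "u \<in> borel_measurable borel" "v \<in> borel_measurable borel"
    unfolding split_coords_def borel_prod[symmetric] by measurable
  define P where "P p = {x. u x \<noteq> 0 \<and> v x \<noteq> 0 \<and> \<lfloor>1 / u x + a\<rfloor> = fst p \<and> \<lfloor>1 / v x + b\<rfloor> = snd p}" for p :: "int \<times> int"
  have P: "P p \<in> sets borel" for p unfolding P_def by measurable
  have "G ` (A \<inter> P p) \<in> sets lebesgue" for p
  proof (rule differentiable_image_in_sets_lebesgue)
    show "A \<inter> P p \<in> sets lebesgue" using A P[of p] by (auto simp: sets_M)
    show "G differentiable_on A \<inter> P p"
      unfolding differentiable_on_def
    proof
      fix x assume x: "x \<in> A \<inter> P p"
      \<comment> \<open>On a set with both digits fixed, \<open>G\<close> is the inversion followed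
        by a fixed translation.\<close>
      have eq: "G y = split_inv y - lattice_point p" if "y \<in> A \<inter> P p" for y
      proof -
        have "y \<notin> null_cone" using that by (simp add: P_def null_cone_coords)
        then show ?thesis
          using that by (simp add: gauss_map_def lattice_part_K split_coords_inv P_def)
      qed
      have "x \<notin> null_cone" using x by (simp add: P_def null_cone_coords)
      then have "(\<lambda>y. split_inv y - lattice_point p) differentiable at x within A \<inter> P p"
        by (intro derivative_intros differentiable_split_inv)
      then show "G differentiable at x within A \<inter> P p"
        by (rule differentiable_transform_within[OF _ zero_less_one x]) (simp add: eq)
    qed
  qed simp
  then have "(\<Union>p. G ` (A \<inter> P p)) \<in> sets lebesgue" by (intro sets.countable_UN') auto
  moreover have "G ` (A \<inter> null_cone) \<in> sets lebesgue"
  proof -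
    have "G ` (A \<inter> null_cone) \<subseteq> {0}" by (auto simp: gauss_map_def)
    then have "finite (G ` (A \<inter> null_cone))" by (rule finite_subset) simp
    then show ?thesis by (intro sets_completionI_sets) (simp add: finite_imp_closed borel_closed)
  qed
  moreover have "G ` A = (\<Union>p. G ` (A \<inter> P p)) \<union> G ` (A \<inter> null_cone)"
  proof -
    have "x \<in> (\<Union>p. P p) \<union> null_cone" for x by (auto simp: P_def null_cone_coords)
    then show ?thesis by blast
  qed
  ultimately have "G ` A \<in> sets lebesgue" by (simp add: sets.Un)
  then show ?thesis using gauss_in_K by (auto simp: sets_M)
qed

lemma gauss_funpow_image: "A \<in> sets M \<Longrightarrow> (G ^^ n) ` A \<in> sets M"
proof (induction n)
  case (Suc n)
  have "(G ^^ Suc n) ` A = G ` ((G ^^ n) ` A)" by (auto simp: image_iff)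
  then show ?case using gauss_image[OF Suc.IH[OF Suc.prems]] by simp
qed simp

lemma box_real_prod: "box c d = {fst c<..<fst d} \<times> {snd c<..<snd d}" for c d :: "real \<times> real"
  by (auto simp: box_def Basis_prod_def inner_prod_def)

text \<open>\<open>dense_box\<close> is applied in product coordinates, where boxes are products of
  intervals, to the image of a Borel set \<open>S \<subseteq> A\<close> with the measure of
  \<open>A\<close>. Both sides of the density inequality scale by \<open>2\<close>.\<close>

lemma dense_rectangle:
  assumes A: "A \<in> sets M" "0 < measure M A" and \<epsilon>: "0 < \<epsilon>"
  obtains I I' where "is_interval I" "I \<subseteq> cf_interval a" "I \<in> sets borel"
    "is_interval I'" "I' \<subseteq> cf_interval b" "I' \<in> sets borel"
    "split_coords -` (I \<times> I') \<in> sets M" "0 < measure M (split_coords -` (I \<times> I'))"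
    "measure M (split_coords -` (I \<times> I') - A) \<le> \<epsilon> * measure M (split_coords -` (I \<times> I'))"
proof -
  obtain S N where SN: "S \<in> sets borel" "S \<subseteq> A" "emeasure M A = emeasure lborel S" "S \<subseteq> K"
    using borel_approx_M[OF A(1)] by metis
  let ?Z = "split_uncoords -` S"
  have Z: "?Z \<in> sets borel" by (rule measurable_sets_borel[OF borel_split_uncoords SN(1)])
  have SZ: "split_coords -` ?Z = S" by (simp add: vimage_def)
  have pos: "0 < emeasure lborel ?Z"
  proof -
    have "0 < emeasure M A" using A(2) by (simp add: finite_measure.emeasure_eq_measure[OF finite_M])
    then have "0 < emeasure lborel S" using SN by simp
    moreover have "emeasure lborel ?Z = 2 * emeasure lborel S"
      using emeasure_split_coords_vimage[OF Z] unfolding SZ by simp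
    ultimately show ?thesis by (simp add: ennreal_zero_less_mult_iff)
  qed
  have sub: "?Z \<subseteq> cbox (- a, - b) (1 - a, 1 - b)"
  proof
    fix p assume "p \<in> ?Z"
    then have "split_uncoords p \<in> K" using SN(4) by auto
    then have "p \<in> square" by (simp add: K_def)
    then show "p \<in> cbox (- a, - b) (1 - a, 1 - b)"
      by (cases p) (auto simp: cbox_Pair_eq U.mem_J V.mem_J)
  qed
  obtain c d where cd: "box c d \<subseteq> box (- a, - b) (1 - a, 1 - b)" "box c d \<noteq> {}"
    "emeasure lborel (box c d - ?Z) \<le> ennreal \<epsilon> * emeasure lborel (box c d)"
    using dense_box[OF Z sub pos \<epsilon>] by blast
  let ?I = "{fst c<..<fst d}" and ?I' = "{snd c<..<snd d}"
  let ?R = "split_coords -` (?I \<times> ?I')"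
  have box: "box c d = ?I \<times> ?I'" by (rule box_real_prod)
  have ne: "?I \<noteq> {}" "?I' \<noteq> {}" using cd(2) unfolding box by auto
  have "?I \<times> ?I' \<subseteq> {- a<..<1 - a} \<times> {- b<..<1 - b}"
    using cd(1) unfolding box_real_prod by simp
  then have II: "?I \<subseteq> {- a<..<1 - a}" "?I' \<subseteq> {- b<..<1 - b}"
    using ne by (auto simp: times_subset_iff)
  have IJ: "?I \<subseteq> cf_interval a" "?I' \<subseteq> cf_interval b"
    using II by (auto simp: cf_interval_def)
  have bx: "box c d \<in> sets borel" by simp
  have R: "?R \<in> sets borel" "?R \<subseteq> K"
    using measurable_sets_borel[OF borel_split_coords bx] IJ unfolding box by (auto simp: K_def)
  have RM: "?R \<in> sets M" using R by (simp add: sets_M)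
  have R2: "2 * emeasure lborel ?R = emeasure lborel (box c d)"
    unfolding box[symmetric] by (rule emeasure_split_coords_vimage[OF bx])
  have RS: "2 * emeasure lborel (?R - S) = emeasure lborel (box c d - ?Z)"
  proof -
    have "?R - S = split_coords -` (box c d - ?Z)"
      unfolding box vimage_Diff SZ ..
    then show ?thesis using emeasure_split_coords_vimage[of "box c d - ?Z"] Z by simp
  qed
  show ?thesis
  proof (rule that[of ?I ?I'])
    show "0 < measure M ?R"
    proof -
      have "0 < emeasure lborel (box c d)"
      proof (rule ccontr)
        assume "\<not> 0 < emeasure lborel (box c d)"
        then have "emeasure lborel (box c d) = 0" by simp
        then have "box c d \<in> null_sets lebesgue" by (intro null_sets_completionI) (simp add: null_sets_def)
        then have "negligible (box c d)" by (simp add: negligible_iff_null_sets)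
        then show False using cd(2) by (simp add: negligible_interval)
      qed
      then have "0 < emeasure lborel ?R" using R2 by (metis mult_zero_right not_gr_zero)
      then have "0 < emeasure M ?R" using emeasure_M_borel[OF R] by simp
      then show ?thesis by (simp add: finite_measure.emeasure_eq_measure[OF finite_M])
    qed
    have "emeasure M (?R - A) \<le> emeasure M (?R - S)"
      using SN(1,2) RM by (intro emeasure_mono) (auto simp: sets_M)
    also have "\<dots> = emeasure lborel (?R - S)"
      by (rule emeasure_M_borel) (use R SN in auto)
    also have "\<dots> \<le> ennreal \<epsilon> * emeasure lborel ?R"
    proof -
      have "2 * emeasure lborel (?R - S) \<le> 2 * (ennreal \<epsilon> * emeasure lborel ?R)"
        using cd(3) unfolding RS R2[symmetric] by (simp add: mult_ac)
      then show ?thesis by (subst (asm) ennreal_mult_le_mult_iff) auto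
    qed
    also have "\<dots> = ennreal \<epsilon> * emeasure M ?R" using emeasure_M_borel[OF R] by simp
    finally show "measure M (?R - A) \<le> \<epsilon> * measure M ?R"
      using \<epsilon> by (simp add: measure_le_iff)
  qed (use IJ RM in \<open>auto simp: is_interval_1\<close>)
qed

lemma exact: "cf_exact K"
proof -
  obtain B where B: "0 < B" "\<And>n E. E \<in> sets M \<Longrightarrow> measure M ((G ^^ n) -` E \<inter> K) \<le> B * measure M E"
    using upper_M by blast
  obtain c where c: "0 < c" "\<And>I I'. is_interval I \<Longrightarrow> I \<subseteq> cf_interval a \<Longrightarrow> I \<in> sets borel \<Longrightarrow>
      is_interval I' \<Longrightarrow> I' \<subseteq> cf_interval b \<Longrightarrow> I' \<in> sets borel \<Longrightarrow>
      \<exists>n0. \<forall>n\<ge>n0. \<forall>E\<in>sets M. c * measure M (split_coords -` (I \<times> I')) * measure M E \<le>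
        measure M (split_coords -` (I \<times> I') \<inter> (G ^^ n) -` E)"
    using lower_M by blast
  have mK: "measure M K = 1 / 2" unfolding measure_def emeasure_K by (rule enn2real_ennreal) simp
  have spK: "space M = K" by simp
  have K_rect: "split_coords -` (cf_interval a \<times> cf_interval b) = K" by (simp add: K_def)
  \<comment> \<open>With both intervals complete the rectangle is \<open>K\<close> itself, which
    yields the lower bound required for the invariant measure.\<close>
  obtain n0 where n0: "\<And>n E. n0 \<le> n \<Longrightarrow> E \<in> sets M \<Longrightarrow> c * measure M K * measure M E \<le> measure M (K \<inter> (G ^^ n) -` E)"
    using c(2)[OF U.is_interval_J order_refl U.borel_J V.is_interval_J order_refl V.borel_J] unfolding K_rect by blast
  obtain \<mu> where \<mu>: "prob_space \<mu>" "sets \<mu> = sets M" "invariant_measure \<mu> G"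
    "\<And>A. A \<in> sets M \<Longrightarrow> measure \<mu> A \<le> B / measure M (space M) * measure M A"
    "\<And>A. A \<in> sets M \<Longrightarrow> c / 2 / measure M (space M) * measure M A \<le> measure \<mu> A"
  proof (rule invariant_measure_exists[OF finite_M _ gauss_measurable B(1)])
    show "0 < measure M (space M)" by (simp add: mK)
    show "measure M ((G ^^ n) -` A \<inter> space M) \<le> B * measure M A" if "A \<in> sets M" for n A
      using B(2)[OF that] by simp
    show "c / 2 * measure M A \<le> measure M ((G ^^ n) -` A \<inter> space M)" if "n0 \<le> n" "A \<in> sets M" for n A
      using n0[OF that] by (simp add: mK Int_commute)
    show "0 < c / 2" using c(1) by simp
  qed blast
  \<comment> \<open>Division by \<open>measure M K = 1/2\<close> doubles both constants:
    \<open>B\<close> becomes \<open>2 B\<close>, and \<open>c / 2\<close> becomes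
    \<open>c\<close>.\<close>
  have up: "measure \<mu> A \<le> 2 * B * measure M A" and low: "c * measure M A \<le> measure \<mu> A" if "A \<in> sets M" for A
    using \<mu>(4,5)[OF that] by (simp_all add: mK)
  have "exact_map \<mu> G"
  proof (rule exact_mapI[OF finite_M \<mu>(1-3) up c(1)])
    show "0 < 2 * B" using B(1) by simp
    show "(G ^^ n) ` A \<in> sets M" if "A \<in> sets M" for n A by (rule gauss_funpow_image[OF that])
    show "\<exists>R\<in>sets M. 0 < measure M R \<and> measure M (R - A) \<le> \<epsilon> * measure M R \<and>
        (\<exists>n0. \<forall>n\<ge>n0. \<forall>E\<in>sets M. c * measure M R * measure M E \<le> measure M (R \<inter> (G ^^ n) -` E))"
      if A: "A \<in> sets M" "0 < measure M A" "0 < \<epsilon>" for A \<epsilon>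
    proof -
      obtain I I' where I: "is_interval I" "I \<subseteq> cf_interval a" "I \<in> sets borel"
        "is_interval I'" "I' \<subseteq> cf_interval b" "I' \<in> sets borel"
        and R: "split_coords -` (I \<times> I') \<in> sets M" "0 < measure M (split_coords -` (I \<times> I'))"
          "measure M (split_coords -` (I \<times> I') - A) \<le> \<epsilon> * measure M (split_coords -` (I \<times> I'))"
        by (rule dense_rectangle[OF A])
      show ?thesis
        by (intro bexI[OF _ R(1)] conjI R c(2)[OF I])
    qed
  qed
  moreover have "comparable_measures \<mu> M"
    unfolding comparable_measures_def
  proof (intro conjI)
    interpret \<mu>: prob_space \<mu> by fact
    \<comment> \<open>The entries serve \<open>1 \<le> C\<close>, the upper bound \<open>2 B\<close>
      and the lower bound \<open>c\<close> for the density of \<open>\<mu>\<close>.\<close>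
    let ?C = "max 1 (max (2 * B) (1 / c))"
    show "\<exists>C\<ge>1. \<forall>A\<in>sets \<mu>. ennreal (inverse C) * emeasure \<mu> A \<le> emeasure M A \<and> emeasure M A \<le> ennreal C * emeasure \<mu> A"
    proof (intro exI[of _ ?C] conjI ballI)
      fix A assume "A \<in> sets \<mu>"
      then have A: "A \<in> sets M" by (simp add: \<mu>(2))
      have C: "1 \<le> ?C" by simp
      have "measure \<mu> A \<le> ?C * measure M A"
        using up[OF A] by (rule order_trans) (intro mult_right_mono, auto)
      then have "inverse ?C * measure \<mu> A \<le> measure M A"
        using C by (simp add: field_simps del: max.bounded_iff)
      then have "ennreal (inverse ?C * measure \<mu> A) \<le> ennreal (measure M A)" by (rule ennreal_leI)
      then show "ennreal (inverse ?C) * emeasure \<mu> A \<le> emeasure M A"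
        using C by (simp add: \<mu>.emeasure_eq_measure finite_measure.emeasure_eq_measure[OF finite_M] ennreal_mult del: max.bounded_iff)
      have "measure M A \<le> 1 / c * measure \<mu> A" using low[OF A] c(1) by (simp add: field_simps)
      also have "\<dots> \<le> ?C * measure \<mu> A" by (intro mult_right_mono) auto
      finally have "ennreal (measure M A) \<le> ennreal (?C * measure \<mu> A)" by (rule ennreal_leI)
      then show "emeasure M A \<le> ennreal ?C * emeasure \<mu> A"
        using C by (simp add: \<mu>.emeasure_eq_measure finite_measure.emeasure_eq_measure[OF finite_M] ennreal_mult del: max.bounded_iff)
    qed simp
  qed (rule \<mu>(2))
  ultimately show ?thesis unfolding cf_exact_def by blast
qed

end

theorem theorem8:
  fixes \<alpha> :: split and K :: "split set"
  assumes "\<bar>fst \<alpha>\<bar> + \<bar>snd \<alpha>\<bar> < 1"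
    and "K = shifted_diamond \<alpha>"
    and "0 \<in> K"
  shows "cf_convergent K \<and> cf_exact K"
proof -
  obtain a b where ab: "split_coords \<alpha> = (a, b)" by (cases "split_coords \<alpha>")
  \<comment> \<open>\<open>0 \<in> K\<close> says that \<alpha> itself lies in the half-open
    diamond, so both of its product coordinates are in \<open>[0, 1)\<close>.\<close>
  have "\<alpha> \<in> little_diamond"
    using assms(2,3) by (auto simp: shifted_diamond_def add_eq_0_iff2)
  then have "split_cf a b"
    using ab by unfold_locales (auto simp: little_diamond_def split_coords_def)
  then interpret split_cf a b .
  have "K = split_cf.K a b"
    using assms(2) ab unfolding K_eq by (metis split_uncoords_coords)
  then show ?thesis using convergent exact by simp
qed

end
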